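(* Let $l\ge 1$ be an integer and let $a$ be an integer with $a+1\equiv 0 \pmod 3$ and $a^2\equiv 1\pmod{3^l}$. Define two finite groups by generators and relations: \[ G_1=\langle \tau,\lambda,\rho : \tau^{3^l}=\lambda^4=1,\ \lambda^2=\rho^2=(\lambda\rho)^2,\ \tau\lambda\tau^{-1}=\rho,\ \tau\rho\tau^{-1}=\lambda\rho\rangle, \] and $G_2=\langle G_1,\nu\rangle$, generated by $\tau,\lambda,\rho,\nu$ subject to the relations of $G_1$ together with \[ \lambda^2=\nu^2,\quad \nu\lambda\nu^{-1}=\rho\lambda,\quad \nu\rho\nu^{-1}=\rho^{-1},\quad \nu\tau\nu^{-1}=\tau^{a}. \] Let $e=\exp(G_2)$ and let $k$ be a field with $\zeta_e\in k$. Then both $k(G_1)$ and $k(G_2)$ are $k$-rational.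
   Context: $\exp(G)$ is the least common multiple of the orders of the elements of a finite group $G$. $\zeta_n$ denotes a primitive $n$-th root of unity in some extension field of $k$; when one writes $\zeta_n\in k$ it is understood that either $\operatorname{char} k=0$ or $\operatorname{char} k=p>0$ with $p\nmid n$. For a finite group $G$ and a field $k$, let $G$ act on the rational function field $k(x_g : g\in G)$ by $k$-automorphisms via $h\cdot x_g = x_{hg}$ for $g,h\in G$, and define $k(G)=k(x_g:g\in G)^G$. A field extension $K/k$ is $k$-rational if $K$ is purely transcendental over $k$. *)

theory Defs
  imports
    "HOL-Algebra.Generated_Fields"
    "HOL-Algebra.Algebraic_Closure_Type"
    "HOL-Computational_Algebra.Fraction_Field"
    "HOL-Library.Poly_Mapping"
    "HOL-Number_Theory.Cong"
begin

section \<open>Groups given by generators and relations\<close>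

text \<open>The letter \<open>(s, True)\<close> stands for the generator \<open>s\<close>, and \<open>(s, False)\<close> for its inverse.\<close>

type_synonym 's word = "('s \<times> bool) list"

definition gen :: "'s \<Rightarrow> 's word" where
  "gen s = [(s, True)]"

definition word_inv :: "'s word \<Rightarrow> 's word" where
  "word_inv w = map (\<lambda>(s, b). (s, \<not> b)) (rev w)"

definition word_pow :: "'s word \<Rightarrow> int \<Rightarrow> 's word" where
  "word_pow w i = concat (replicate (nat \<bar>i\<bar>) (if i < 0 then word_inv w else w))"

text \<open>A pair \<open>(u, v) \<in> R\<close> is the relation \<open>u = v\<close>.  The presented group consists of the words in
  \<open>S\<close> and the inverses of \<open>S\<close>, modulo the congruence generated by \<open>R\<close> and free cancellation.\<close>

inductive word_eq :: "'s set \<Rightarrow> ('s word \<times> 's word) set \<Rightarrow> 's word \<Rightarrow> 's word \<Rightarrow> bool"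
  for S R where
  refl: "w \<in> lists (S \<times> UNIV) \<Longrightarrow> word_eq S R w w"
| sym: "word_eq S R u v \<Longrightarrow> word_eq S R v u"
| trans: "word_eq S R u v \<Longrightarrow> word_eq S R v w \<Longrightarrow> word_eq S R u w"
| append: "word_eq S R u u' \<Longrightarrow> word_eq S R v v' \<Longrightarrow> word_eq S R (u @ v) (u' @ v')"
| cancel: "s \<in> S \<Longrightarrow> word_eq S R [(s, b), (s, \<not> b)] []"
| relation: "(u, v) \<in> R \<Longrightarrow> u \<in> lists (S \<times> UNIV) \<Longrightarrow> v \<in> lists (S \<times> UNIV) \<Longrightarrow> word_eq S R u v"

definition presented_group :: "'s set \<Rightarrow> ('s word \<times> 's word) set \<Rightarrow> 's word set monoid" where
  "presented_group S R =
    \<lparr>carrier = lists (S \<times> UNIV) // {(u, v). word_eq S R u v},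
     monoid.mult = (\<lambda>A B. {w. \<exists>u\<in>A. \<exists>v\<in>B. word_eq S R (u @ v) w}),
     one = {w. word_eq S R [] w}\<rparr>"

lemma word_eq_in_lists:
  assumes "word_eq S R u v"
  shows "u \<in> lists (S \<times> UNIV) \<and> v \<in> lists (S \<times> UNIV)"
  using assms by induction auto

lemma word_inv_in_lists: "u \<in> lists (S \<times> UNIV) \<Longrightarrow> word_inv u \<in> lists (S \<times> UNIV)"
  by (auto simp: word_inv_def lists_eq_set)

lemma word_inv_left:
  assumes "u \<in> lists (S \<times> UNIV)"
  shows "word_eq S R (word_inv u @ u) []"
  using assms
proof (induction u rule: list.induct)
  case Nil
  then show ?case by (simp add: word_inv_def word_eq.refl)
next
  case (Cons x u)
  obtain s b where x: "x = (s, b)" by (cases x)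
  have s: "s \<in> S" and u: "u \<in> lists (S \<times> UNIV)"
    using Cons.prems by (simp_all add: x)
  have r: "word_eq S R (word_inv u) (word_inv u)" and r': "word_eq S R u u"
    using word_eq.refl[OF word_inv_in_lists[OF u]] word_eq.refl[OF u] by this+
  have "word_eq S R [(s, \<not> b), x] []" using word_eq.cancel[OF s, of R "\<not> b"] by (simp add: x)
  then have "word_eq S R ([(s, \<not> b), x] @ u) ([] @ u)" using r' by (rule word_eq.append)
  then have "word_eq S R (word_inv u @ [(s, \<not> b), x] @ u) (word_inv u @ u)"
    unfolding append_Nil by (rule word_eq.append[OF r])
  then have "word_eq S R (word_inv u @ [(s, \<not> b), x] @ u) []"
    using Cons.IH[OF u] by (rule word_eq.trans)
  moreover have "word_inv (x # u) @ x # u = word_inv u @ [(s, \<not> b), x] @ u"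
    by (simp add: word_inv_def x)
  ultimately show ?case by (simp only:)
qed

lemma presented_group_is_group: "group (presented_group S R)"
proof -
  define W where "W = lists (S \<times> (UNIV :: bool set))"
  define cl where "cl u = {w. word_eq S R u w}" for u
  let ?G = "presented_group S R"
  have cl_eqI: "cl u = cl v" if "word_eq S R u v" for u v
  proof (rule Set.set_eqI)
    fix w
    show "w \<in> cl u \<longleftrightarrow> w \<in> cl v"
      unfolding cl_def mem_Collect_eq
      using word_eq.trans[OF that] word_eq.trans[OF word_eq.sym[OF that]] by iprover
  qed
  have self: "u \<in> cl u" if "u \<in> W" for u
    using word_eq.refl that by (simp add: cl_def W_def)
  have carr: "carrier ?G = cl ` W"
    by (auto simp: presented_group_def quotient_def cl_def W_def)
  have append_W: "u @ v \<in> W" if "u \<in> W" "v \<in> W" for u v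
    using that by (simp add: W_def lists_eq_set)
  have Nil_W: "[] \<in> W" by (simp add: W_def)
  have mult: "cl u \<otimes>\<^bsub>?G\<^esub> cl v = cl (u @ v)" if "u \<in> W" "v \<in> W" for u v
  proof (rule Set.set_eqI)
    fix w
    have "w \<in> cl u \<otimes>\<^bsub>?G\<^esub> cl v \<longleftrightarrow> (\<exists>u'\<in>cl u. \<exists>v'\<in>cl v. w \<in> cl (u' @ v'))"
      by (simp add: presented_group_def cl_def)
    also have "\<dots> \<longleftrightarrow> w \<in> cl (u @ v)"
    proof
      assume "w \<in> cl (u @ v)"
      then show "\<exists>u'\<in>cl u. \<exists>v'\<in>cl v. w \<in> cl (u' @ v')" using self that by blast
    next
      assume "\<exists>u'\<in>cl u. \<exists>v'\<in>cl v. w \<in> cl (u' @ v')"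
      then obtain u' v' where *: "u' \<in> cl u" "v' \<in> cl v" "w \<in> cl (u' @ v')" by blast
      then have "word_eq S R (u @ v) (u' @ v')"
        unfolding cl_def mem_Collect_eq by (intro word_eq.append)
      then show "w \<in> cl (u @ v)" using *(3) cl_eqI by blast
    qed
    finally show "w \<in> cl u \<otimes>\<^bsub>?G\<^esub> cl v \<longleftrightarrow> w \<in> cl (u @ v)" .
  qed
  have one: "\<one>\<^bsub>?G\<^esub> = cl []"
    by (simp add: presented_group_def cl_def)
  show ?thesis
  proof (rule groupI)
    fix x y assume "x \<in> carrier ?G" "y \<in> carrier ?G"
    then obtain u v where "u \<in> W" "x = cl u" "v \<in> W" "y = cl v" unfolding carr by blast
    then show "x \<otimes>\<^bsub>?G\<^esub> y \<in> carrier ?G" using mult append_W carr by simp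
  next
    show "\<one>\<^bsub>?G\<^esub> \<in> carrier ?G" unfolding one carr using Nil_W by (rule imageI)
  next
    fix x y z assume "x \<in> carrier ?G" "y \<in> carrier ?G" "z \<in> carrier ?G"
    then obtain u v w where "u \<in> W" "x = cl u" "v \<in> W" "y = cl v" "w \<in> W" "z = cl w"
      unfolding carr by blast
    then show "x \<otimes>\<^bsub>?G\<^esub> y \<otimes>\<^bsub>?G\<^esub> z = x \<otimes>\<^bsub>?G\<^esub> (y \<otimes>\<^bsub>?G\<^esub> z)" using mult append_W by simp
  next
    fix x assume "x \<in> carrier ?G"
    then obtain u where "u \<in> W" "x = cl u" unfolding carr by blast
    then show "\<one>\<^bsub>?G\<^esub> \<otimes>\<^bsub>?G\<^esub> x = x" using mult[of "[]" u] Nil_W one by simp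
  next
    fix x assume "x \<in> carrier ?G"
    then obtain u where u: "u \<in> W" "x = cl u" unfolding carr by blast
    then have inv: "word_inv u \<in> W" unfolding W_def by (intro word_inv_in_lists)
    have "word_eq S R (word_inv u @ u) []" using u(1) unfolding W_def by (rule word_inv_left)
    then have "cl (word_inv u) \<otimes>\<^bsub>?G\<^esub> x = \<one>\<^bsub>?G\<^esub>"
      unfolding u(2) one mult[OF inv u(1)] by (rule cl_eqI)
    then show "\<exists>y\<in>carrier ?G. y \<otimes>\<^bsub>?G\<^esub> x = \<one>\<^bsub>?G\<^esub>"
      unfolding carr using inv by blast
  qed
qed

definition group_exponent :: "('a, 'b) monoid_scheme \<Rightarrow> nat" where
  "group_exponent G = Lcm (group.ord G ` carrier G)"


section \<open>The groups \<open>G\<^sub>1\<close> and \<open>G\<^sub>2\<close>\<close>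

datatype generator = Tau | Lambda | Rho | Nu

abbreviation "tau \<equiv> gen Tau"
abbreviation "lambda \<equiv> gen Lambda"
abbreviation "rho \<equiv> gen Rho"
abbreviation "nu \<equiv> gen Nu"

definition G1_relations :: "nat \<Rightarrow> (generator word \<times> generator word) set" where
  "G1_relations l =
    {(word_pow tau (3 ^ l), []),
     (word_pow lambda 4, []),
     (word_pow lambda 2, word_pow rho 2),
     (word_pow rho 2, word_pow (lambda @ rho) 2),
     (tau @ lambda @ word_inv tau, rho),
     (tau @ rho @ word_inv tau, lambda @ rho)}"

definition G2_relations :: "nat \<Rightarrow> int \<Rightarrow> (generator word \<times> generator word) set" where
  "G2_relations l a = G1_relations l \<union>
    {(word_pow lambda 2, word_pow nu 2),
     (nu @ lambda @ word_inv nu, rho @ lambda),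
     (nu @ rho @ word_inv nu, word_inv rho),
     (nu @ tau @ word_inv nu, word_pow tau a)}"

definition G1 :: "nat \<Rightarrow> generator word set monoid" where
  "G1 l = presented_group {Tau, Lambda, Rho} (G1_relations l)"

definition G2 :: "nat \<Rightarrow> int \<Rightarrow> generator word set monoid" where
  "G2 l a = presented_group {Tau, Lambda, Rho, Nu} (G2_relations l a)"


section \<open>Polynomials in arbitrarily many variables\<close>

abbreviation (input) "lookup \<equiv> Poly_Mapping.lookup"
abbreviation (input) "keys \<equiv> Poly_Mapping.keys"

text \<open>The value at \<open>x\<close> of a polynomial whose coefficients are mapped by \<open>c\<close>.\<close>

definition poly_eval :: "('k::zero \<Rightarrow> 'b::comm_semiring_1) \<Rightarrow> ('i \<Rightarrow> 'b) \<Rightarrow> (('i \<Rightarrow>\<^sub>0 nat) \<Rightarrow>\<^sub>0 'k) \<Rightarrow> 'b"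
  where
  "poly_eval c x p =
    (\<Sum>m\<in>keys p. c (lookup p m) * (\<Prod>i\<in>keys m. x i ^ lookup m i))"

lemma poly_eval_superset:
  assumes "finite M" "keys p \<subseteq> M" "c 0 = 0"
  shows "poly_eval c x p = (\<Sum>m\<in>M. c (lookup p m) * (\<Prod>i\<in>keys m. x i ^ lookup m i))"
  unfolding poly_eval_def
  by (rule sum.mono_neutral_left) (use assms in \<open>auto simp: in_keys_iff\<close>)

lemma poly_eval_add:
  fixes c :: "'k::comm_semiring_1 \<Rightarrow> 'b::comm_semiring_1"
  assumes "c 0 = 0" "\<And>u v. c (u + v) = c u + c v"
  shows "poly_eval c x (p + q) = poly_eval c x p + poly_eval c x q"
  using assms Poly_Mapping.keys_add[of p q]
  by (simp add: poly_eval_superset[of "keys p \<union> keys q"] lookup_add algebra_simps sum.distrib)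

lemma poly_eval_zero: "poly_eval c x 0 = 0"
  by (simp add: poly_eval_def)

lemma poly_eval_sum:
  fixes c :: "'k::comm_semiring_1 \<Rightarrow> 'b::comm_semiring_1"
  assumes "c 0 = 0" "\<And>u v. c (u + v) = c u + c v"
  shows "poly_eval c x (\<Sum>a\<in>A. f a) = (\<Sum>a\<in>A. poly_eval c x (f a))"
  by (induction A rule: infinite_finite_induct) (auto simp: poly_eval_zero poly_eval_add[OF assms])

lemma poly_eval_single:
  assumes "c 0 = 0"
  shows "poly_eval c x (Poly_Mapping.single m a) = c a * (\<Prod>i\<in>keys m. x i ^ lookup m i)"
  using assms by (subst poly_eval_superset[of "{m}"]) auto

lemma poly_mapping_sum_single:
  fixes p :: "'m \<Rightarrow>\<^sub>0 'k::comm_monoid_add"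
  shows "p = (\<Sum>m\<in>keys p. Poly_Mapping.single m (lookup p m))"
  by (rule poly_mapping_eqI) (auto simp: lookup_sum lookup_single when_def in_keys_iff)

lemma monomial_add:
  fixes x :: "'i \<Rightarrow> 'b::comm_semiring_1"
  shows "(\<Prod>i\<in>keys (m + n). x i ^ lookup (m + n) i) =
    (\<Prod>i\<in>keys m. x i ^ lookup m i) * (\<Prod>i\<in>keys n. x i ^ lookup n i)"
proof -
  have ext: "(\<Prod>i\<in>keys k. x i ^ lookup k i) = (\<Prod>i\<in>keys m \<union> keys n. x i ^ lookup k i)"
    if "keys k \<subseteq> keys m \<union> keys n" for k
    by (rule prod.mono_neutral_left) (use that in \<open>auto simp: in_keys_iff\<close>)
  show ?thesis
    unfolding ext[OF Poly_Mapping.keys_add] ext[OF Un_upper1] ext[OF Un_upper2]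
    by (simp add: lookup_add power_add prod.distrib)
qed

lemma poly_eval_mult:
  fixes c :: "'k::comm_semiring_1 \<Rightarrow> 'b::comm_semiring_1"
  assumes c: "c 0 = 0" "\<And>u v. c (u + v) = c u + c v" "\<And>u v. c (u * v) = c u * c v"
  shows "poly_eval c x (p * q) = poly_eval c x p * poly_eval c x q"
proof -
  have "p * q = (\<Sum>m\<in>keys p. Poly_Mapping.single m (lookup p m)) *
      (\<Sum>n\<in>keys q. Poly_Mapping.single n (lookup q n))"
    using poly_mapping_sum_single[of p, symmetric] poly_mapping_sum_single[of q, symmetric] by simp
  also have "\<dots> = (\<Sum>m\<in>keys p. \<Sum>n\<in>keys q.
      Poly_Mapping.single (m + n) (lookup p m * lookup q n))"
    by (simp add: sum_product mult_single)
  finally have "poly_eval c x (p * q) = (\<Sum>m\<in>keys p. \<Sum>n\<in>keys q.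
      poly_eval c x (Poly_Mapping.single (m + n) (lookup p m * lookup q n)))"
    by (simp add: poly_eval_sum[OF c(1,2)])
  also have "\<dots> = poly_eval c x p * poly_eval c x q"
    by (simp only: poly_eval_single[where c = c, OF c(1)] c(3) monomial_add)
      (simp add: poly_eval_def sum_product algebra_simps)
  finally show ?thesis .
qed

text \<open>The library proves that \<open>('i \<Rightarrow>\<^sub>0 nat) \<Rightarrow>\<^sub>0 'k\<close> is an integral domain only for linearly ordered
  \<open>'i\<close>.  The copy \<open>mpoly\<close> of this type is an integral domain for every \<open>'i\<close>.\<close>

typedef (overloaded) ('i, 'k) mpoly = "UNIV :: (('i \<Rightarrow>\<^sub>0 nat) \<Rightarrow>\<^sub>0 'k::zero) set"
  morphisms mapping_of MPoly
  by simp

setup_lifting type_definition_mpoly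

instantiation mpoly :: (type, comm_ring_1) comm_ring_1
begin

lift_definition zero_mpoly :: "('a, 'b) mpoly" is 0 .
lift_definition one_mpoly :: "('a, 'b) mpoly" is 1 .
lift_definition plus_mpoly :: "('a, 'b) mpoly \<Rightarrow> ('a, 'b) mpoly \<Rightarrow> ('a, 'b) mpoly" is "(+)" .
lift_definition minus_mpoly :: "('a, 'b) mpoly \<Rightarrow> ('a, 'b) mpoly \<Rightarrow> ('a, 'b) mpoly" is "(-)" .
lift_definition uminus_mpoly :: "('a, 'b) mpoly \<Rightarrow> ('a, 'b) mpoly" is uminus .
lift_definition times_mpoly :: "('a, 'b) mpoly \<Rightarrow> ('a, 'b) mpoly \<Rightarrow> ('a, 'b) mpoly" is "(*)" .

instance
  by standard (transfer; simp add: algebra_simps)+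

end

lemma unique_product:
  fixes A B :: "('i \<Rightarrow>\<^sub>0 nat) set"
  assumes "finite V" "finite A" "finite B" "A \<noteq> {}" "B \<noteq> {}"
    and "\<And>a a' i. a \<in> A \<Longrightarrow> a' \<in> A \<Longrightarrow> i \<notin> V \<Longrightarrow> lookup a i = lookup a' i"
    and "\<And>b b' i. b \<in> B \<Longrightarrow> b' \<in> B \<Longrightarrow> i \<notin> V \<Longrightarrow> lookup b i = lookup b' i"
  shows "\<exists>a\<in>A. \<exists>b\<in>B. \<forall>a'\<in>A. \<forall>b'\<in>B. a' + b' = a + b \<longrightarrow> a' = a \<and> b' = b"
  using assms
proof (induction V arbitrary: A B rule: finite_induct)
  case empty
  have "a = a'" if "a \<in> A" "a' \<in> A" for a a'
    by (rule poly_mapping_eqI, rule empty.prems(5)[OF that]) simp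
  moreover have "b = b'" if "b \<in> B" "b' \<in> B" for b b'
    by (rule poly_mapping_eqI, rule empty.prems(6)[OF that]) simp
  ultimately show ?case using empty.prems(3,4) by blast
next
  case (insert v V)
  define f where "f a = lookup a v" for a :: "'i \<Rightarrow>\<^sub>0 nat"
  define A' where "A' = {a \<in> A. f a = Max (f ` A)}"
  define B' where "B' = {b \<in> B. f b = Max (f ` B)}"
  have fin: "finite A'" "finite B'" using insert.prems(1,2) by (auto simp: A'_def B'_def)
  have "Max (f ` A) \<in> f ` A" "Max (f ` B) \<in> f ` B"
    using insert.prems(1-4) by (auto intro!: Max_in)
  then have ne: "A' \<noteq> {}" "B' \<noteq> {}" by (auto simp: A'_def B'_def)
  have A'V: "lookup a i = lookup a' i" if "a \<in> A'" "a' \<in> A'" "i \<notin> V" for a a' i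
    using that insert.prems(5)[of a a' i] by (cases "i = v") (auto simp: A'_def f_def)
  have B'V: "lookup a i = lookup a' i" if "a \<in> B'" "a' \<in> B'" "i \<notin> V" for a a' i
    using that insert.prems(6)[of a a' i] by (cases "i = v") (auto simp: B'_def f_def)
  have "\<exists>a\<in>A'. \<exists>b\<in>B'. \<forall>a'\<in>A'. \<forall>b'\<in>B'. a' + b' = a + b \<longrightarrow> a' = a \<and> b' = b"
    by (rule insert.IH[OF fin ne]) (fact A'V B'V)+
  then obtain a b where ab: "a \<in> A'" "b \<in> B'"
    and uniq: "\<And>a' b'. a' \<in> A' \<Longrightarrow> b' \<in> B' \<Longrightarrow> a' + b' = a + b \<Longrightarrow> a' = a \<and> b' = b"
    by blast
  have "a' = a \<and> b' = b" if "a' \<in> A" "b' \<in> B" "a' + b' = a + b" for a' b'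
  proof (rule uniq)
    have "f a' \<le> Max (f ` A)" "f b' \<le> Max (f ` B)"
      using that(1,2) insert.prems(1,2) by auto
    moreover have "f a' + f b' = f a + f b"
      unfolding f_def lookup_add[symmetric] that(3) ..
    moreover have "f a = Max (f ` A)" "f b = Max (f ` B)"
      using ab by (simp_all add: A'_def B'_def)
    ultimately have "f a' = Max (f ` A)" "f b' = Max (f ` B)" by linarith+
    then show "a' \<in> A'" "b' \<in> B'"
      using that(1,2) by (simp_all add: A'_def B'_def)
  qed (rule that)
  then show ?case using ab by (auto simp: A'_def B'_def)
qed

lemma poly_mapping_no_zero_divisors:
  fixes p q :: "('i \<Rightarrow>\<^sub>0 nat) \<Rightarrow>\<^sub>0 'k::semiring_no_zero_divisors"
  assumes "p \<noteq> 0" "q \<noteq> 0"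
  shows "p * q \<noteq> 0"
proof -
  have ne: "keys p \<noteq> {}" "keys q \<noteq> {}"
    using assms by (auto simp: poly_mapping_eq_iff fun_eq_iff simp flip: lookup_not_eq_zero_eq_in_keys)
  define V where "V = (\<Union>m\<in>keys p \<union> keys q. keys m)"
  have "\<exists>a\<in>keys p. \<exists>b\<in>keys q. \<forall>a'\<in>keys p. \<forall>b'\<in>keys q. a' + b' = a + b \<longrightarrow> a' = a \<and> b' = b"
  proof (rule unique_product[of V])
    show "finite V" by (simp add: V_def)
    show "lookup a i = lookup a' i" if "a \<in> keys p" "a' \<in> keys p" "i \<notin> V" for a a' i
      using that by (auto simp: V_def in_keys_iff)
    show "lookup a i = lookup a' i" if "a \<in> keys q" "a' \<in> keys q" "i \<notin> V" for a a' i
      using that by (auto simp: V_def in_keys_iff)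
  qed (use ne in auto)
  then obtain a b where ab: "a \<in> keys p" "b \<in> keys q"
    and uniq: "\<And>a' b'. a' \<in> keys p \<Longrightarrow> b' \<in> keys q \<Longrightarrow> a' + b' = a + b \<Longrightarrow> a' = a \<and> b' = b"
    by blast
  have inner: "(\<Sum>m. lookup q m when a + b = a' + m) = (lookup q b when a' = a)"
    if "a' \<in> keys p" for a'
  proof -
    have "(lookup q m when a + b = a' + m) = ((lookup q b when a' = a) when m = b)" for m
      using uniq[OF that, of m] by (cases "m \<in> keys q") (auto simp: when_def in_keys_iff)
    then show ?thesis by simp
  qed
  have "lookup (p * q) (a + b) = (\<Sum>a'. lookup p a' * (\<Sum>m. lookup q m when a + b = a' + m))"
    by (simp add: lookup_mult)
  also have "\<dots> = (\<Sum>a'. lookup p a * lookup q b when a' = a)"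
  proof (rule Sum_any.cong)
    fix a'
    show "lookup p a' * (\<Sum>m. lookup q m when a + b = a' + m) = (lookup p a * lookup q b when a' = a)"
    proof (cases "a' \<in> keys p")
      case True
      then show ?thesis by (simp only: inner) (auto simp: when_def)
    next
      case False
      then show ?thesis using ab by (auto simp: in_keys_iff when_def)
    qed
  qed
  also have "\<dots> = lookup p a * lookup q b" by simp
  also have "\<dots> \<noteq> 0" using ab by (simp add: in_keys_iff)
  finally show ?thesis by auto
qed

instance mpoly :: (type, idom) idom
proof
  fix p q :: "('a, 'b) mpoly"
  assume "p \<noteq> 0" "q \<noteq> 0"
  then show "p * q \<noteq> 0"
    by transfer (rule poly_mapping_no_zero_divisors)
qed


section \<open>Rational function fields and rational extensions\<close>

type_synonym ('i, 'k) ratfun = "('i, 'k) mpoly fract"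

definition ratfun_const :: "'k::field \<Rightarrow> ('i, 'k) ratfun" where
  "ratfun_const c = Fract (MPoly (Poly_Mapping.single 0 c)) 1"

definition ratfun_var :: "'i \<Rightarrow> ('i, 'k::field) ratfun" where
  "ratfun_var i = Fract (MPoly (Poly_Mapping.single (Poly_Mapping.single i 1) 1)) 1"

definition adjoin :: "'a::field set \<Rightarrow> 'a set \<Rightarrow> 'a set" where
  "adjoin k B = generate_field ring_of_type_algebra (k \<union> B)"

definition alg_independent :: "'a::field set \<Rightarrow> 'a set \<Rightarrow> bool" where
  "alg_independent k B \<longleftrightarrow>
    (\<forall>p :: ('a \<Rightarrow>\<^sub>0 nat) \<Rightarrow>\<^sub>0 'a.
      (\<forall>m\<in>keys p. lookup p m \<in> k \<and> keys m \<subseteq> B) \<longrightarrow> poly_eval id id p = 0 \<longrightarrow> p = 0)"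

text \<open>\<open>K\<close> is purely transcendental over \<open>k\<close>: it is generated by an algebraically independent set.\<close>

definition rational_over :: "'a::field set \<Rightarrow> 'a set \<Rightarrow> bool" where
  "rational_over k K \<longleftrightarrow> (\<exists>B. alg_independent k B \<and> K = adjoin k B)"

definition primitive_root_of_unity :: "nat \<Rightarrow> 'a::field \<Rightarrow> bool" where
  "primitive_root_of_unity n z \<longleftrightarrow> n > 0 \<and> z ^ n = 1 \<and> (\<forall>m. 0 < m \<and> m < n \<longrightarrow> z ^ m \<noteq> 1)"

text \<open>\<open>\<zeta>\<^sub>n \<in> k\<close>, with the customary condition on the characteristic.\<close>

definition contains_zeta :: "'k::field itself \<Rightarrow> nat \<Rightarrow> bool" where
  "contains_zeta _ n \<longleftrightarrow>
    (CHAR('k) = 0 \<or> \<not> CHAR('k) dvd n) \<and> (\<exists>z::'k. primitive_root_of_unity n z)"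


section \<open>The fixed field \<open>k(G)\<close>\<close>

text \<open>The map on fraction fields induced by an injective ring homomorphism; the value is unspecified
  for other maps.\<close>

definition fract_map :: "('a::idom \<Rightarrow> 'b::idom) \<Rightarrow> 'a fract \<Rightarrow> 'b fract" where
  "fract_map \<phi> f = (THE r. \<exists>p q. q \<noteq> 0 \<and> f = Fract p q \<and> r = Fract (\<phi> p) (\<phi> q))"

lemma fract_map_Fract:
  assumes "inj \<phi>" and zero: "\<phi> 0 = 0" and mult: "\<And>x y. \<phi> (x * y) = \<phi> x * \<phi> y" and "q \<noteq> 0"
  shows "fract_map \<phi> (Fract p q) = Fract (\<phi> p) (\<phi> q)"
  unfolding fract_map_def
proof (rule the_equality)
  show "\<exists>p' q'. q' \<noteq> 0 \<and> Fract p q = Fract p' q' \<and> Fract (\<phi> p) (\<phi> q) = Fract (\<phi> p') (\<phi> q')"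
    using assms by blast
next
  have nz: "\<phi> x \<noteq> 0" if "x \<noteq> 0" for x using that assms(1) zero by (metis injD)
  fix r assume "\<exists>p' q'. q' \<noteq> 0 \<and> Fract p q = Fract p' q' \<and> r = Fract (\<phi> p') (\<phi> q')"
  then obtain p' q' where *: "q' \<noteq> 0" "p * q' = p' * q" "r = Fract (\<phi> p') (\<phi> q')"
    using \<open>q \<noteq> 0\<close> by (auto simp: eq_fract)
  then have "\<phi> p * \<phi> q' = \<phi> p' * \<phi> q" using mult by metis
  then show "r = Fract (\<phi> p) (\<phi> q)" using * nz \<open>q \<noteq> 0\<close> by (simp add: eq_fract)
qed

lift_definition mpoly_rename :: "('i \<Rightarrow> 'j) \<Rightarrow> ('i, 'k::comm_semiring_1) mpoly \<Rightarrow> ('j, 'k) mpoly" is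
  "\<lambda>\<pi>. poly_eval (Poly_Mapping.single 0) (\<lambda>i. Poly_Mapping.single (Poly_Mapping.single (\<pi> i) 1) 1)" .

text \<open>There is a variable for every element of the ambient type of \<open>G\<close>; \<open>h\<close> fixes those outside
  \<open>carrier G\<close>, so that it acts by an automorphism.\<close>

definition translation :: "('g, 'b) monoid_scheme \<Rightarrow> 'g \<Rightarrow> ('g, 'k::field) ratfun \<Rightarrow> ('g, 'k) ratfun" where
  "translation G h =
    fract_map (mpoly_rename (\<lambda>g. if g \<in> carrier G then h \<otimes>\<^bsub>G\<^esub> g else g))"

lemma mpoly_rename_add: "mpoly_rename \<pi> (p + q) = mpoly_rename \<pi> p + mpoly_rename \<pi> q"
  by transfer (rule poly_eval_add; simp add: single_add)

lemma mpoly_rename_mult: "mpoly_rename \<pi> (p * q) = mpoly_rename \<pi> p * mpoly_rename \<pi> q"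
  by transfer (rule poly_eval_mult; simp add: single_add mult_single)

lemma mpoly_rename_0 [simp]: "mpoly_rename \<pi> 0 = 0"
  by transfer (rule poly_eval_zero)

lemma mpoly_rename_const [simp]:
  "mpoly_rename \<pi> (MPoly (Poly_Mapping.single 0 c)) = MPoly (Poly_Mapping.single 0 c)"
  by (simp add: mpoly_rename.abs_eq poly_eval_single)

lemma mpoly_rename_var [simp]:
  "mpoly_rename \<pi> (MPoly (Poly_Mapping.single (Poly_Mapping.single i 1) 1)) =
    MPoly (Poly_Mapping.single (Poly_Mapping.single (\<pi> i) 1) 1)"
  by (simp add: mpoly_rename.abs_eq poly_eval_single)

lemma mpoly_rename_1 [simp]: "mpoly_rename \<pi> (1 :: ('i, 'k::comm_ring_1) mpoly) = 1"
  using mpoly_rename_const[of \<pi> "1 :: 'k"] by (simp add: one_mpoly_def)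

lemma mpoly_induct [case_names const var add mult]:
  fixes p :: "('i, 'k::comm_ring_1) mpoly"
  assumes const: "\<And>c. P (MPoly (Poly_Mapping.single 0 c))"
    and var: "\<And>i. P (MPoly (Poly_Mapping.single (Poly_Mapping.single i 1) 1))"
    and add: "\<And>p q. P p \<Longrightarrow> P q \<Longrightarrow> P (p + q)"
    and mult: "\<And>p q. P p \<Longrightarrow> P q \<Longrightarrow> P (p * q)"
  shows "P p"
proof -
  define Q where "Q r = P (MPoly r)" for r
  have Qadd: "Q (r + s)" if "Q r" "Q s" for r s
    using add that by (simp add: Q_def flip: plus_mpoly.abs_eq)
  have Qmult: "Q (r * s)" if "Q r" "Q s" for r s
    using mult that by (simp add: Q_def flip: times_mpoly.abs_eq)
  have Qconst: "Q (Poly_Mapping.single 0 c)" for c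
    using const by (simp add: Q_def)
  have Qpow: "Q (Poly_Mapping.single (Poly_Mapping.single i n) 1)" for i n
  proof (induction n)
    case 0
    then show ?case using Qconst[of 1] by simp
  next
    case (Suc n)
    then have "Q (Poly_Mapping.single (Poly_Mapping.single i 1) 1 *
        Poly_Mapping.single (Poly_Mapping.single i n) 1)"
      using Qmult var by (simp add: Q_def)
    then show ?case by (simp add: mult_single flip: single_add)
  qed
  have Qmon: "Q (Poly_Mapping.single (\<Sum>i\<in>A. Poly_Mapping.single i (f i)) 1)" if "finite A" for A f
    using that
  proof (induction A)
    case empty
    then show ?case using Qconst[of 1] by simp
  next
    case (insert i A)
    then have "Q (Poly_Mapping.single (Poly_Mapping.single i (f i)) 1 *
        Poly_Mapping.single (\<Sum>i\<in>A. Poly_Mapping.single i (f i)) 1)"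
      using Qmult Qpow by simp
    then show ?case using insert by (simp add: mult_single)
  qed
  have Qsingle: "Q (Poly_Mapping.single m c)" for m c
  proof -
    have "Q (Poly_Mapping.single m 1)"
      using Qmon[of "keys m" "lookup m"] poly_mapping_sum_single[of m, symmetric] by simp
    then have "Q (Poly_Mapping.single 0 c * Poly_Mapping.single m 1)"
      using Qmult Qconst by simp
    then show ?thesis by (simp add: mult_single)
  qed
  have Qsum: "Q (\<Sum>m\<in>A. Poly_Mapping.single m (f m))" if "finite A" for A f
    using that
  proof (induction A)
    case empty
    then show ?case using Qconst[of 0] by simp
  qed (simp add: Qadd Qsingle)
  have "Q (mapping_of p)"
    using Qsum[of "keys (mapping_of p)" "lookup (mapping_of p)"]
      poly_mapping_sum_single[of "mapping_of p", symmetric] by simp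
  then show ?thesis by (simp add: Q_def mapping_of_inverse)
qed

lemma mpoly_rename_rename:
  "mpoly_rename \<sigma> (mpoly_rename \<pi> (p :: ('i, 'k::comm_ring_1) mpoly)) = mpoly_rename (\<sigma> \<circ> \<pi>) p"
  by (induction p rule: mpoly_induct) (simp_all add: mpoly_rename_add mpoly_rename_mult del: One_nat_def)

lemma mpoly_rename_id: "mpoly_rename id (p :: ('i, 'k::comm_ring_1) mpoly) = p"
  by (induction p rule: mpoly_induct) (simp_all add: mpoly_rename_add mpoly_rename_mult del: One_nat_def)

lemma inj_mpoly_rename:
  assumes "inj \<pi>"
  shows "inj (mpoly_rename \<pi> :: ('i, 'k::comm_ring_1) mpoly \<Rightarrow> _)"
proof (rule inj_on_inverseI)
  fix p :: "('i, 'k) mpoly"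
  have "inv_into UNIV \<pi> \<circ> \<pi> = id" using assms by (rule inv_o_cancel)
  then show "mpoly_rename (inv_into UNIV \<pi>) (mpoly_rename \<pi> p) = p"
    by (simp only: mpoly_rename_rename mpoly_rename_id)
qed

context
  fixes G :: "('g, 'b) monoid_scheme" and h :: 'g
  assumes G: "group G" and h: "h \<in> carrier G"
begin

interpretation group G by (rule G)

lemma translation_Fract:
  fixes p q :: "('g, 'k::field) mpoly"
  assumes "q \<noteq> 0"
  defines "\<pi> \<equiv> \<lambda>g. if g \<in> carrier G then h \<otimes>\<^bsub>G\<^esub> g else g"
  shows "translation G h (Fract p q) = Fract (mpoly_rename \<pi> p) (mpoly_rename \<pi> q)"
    and "mpoly_rename \<pi> q \<noteq> 0"
proof -
  have inj: "inj \<pi>"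
  proof (rule injI)
    fix x y assume "\<pi> x = \<pi> y"
    then show "x = y"
      using h m_closed[OF h, of x] m_closed[OF h, of y]
      by (cases "x \<in> carrier G"; cases "y \<in> carrier G") (auto simp: \<pi>_def)
  qed
  note inj' = inj_mpoly_rename[OF inj, where ?'k = 'k]
  have tr: "translation G h = (fract_map (mpoly_rename \<pi>) :: ('g, 'k) ratfun \<Rightarrow> _)"
    unfolding translation_def \<pi>_def ..
  show "translation G h (Fract p q) = Fract (mpoly_rename \<pi> p) (mpoly_rename \<pi> q)"
    unfolding tr by (rule fract_map_Fract[OF inj' _ _ assms(1)]) (simp_all add: mpoly_rename_mult)
  show "mpoly_rename \<pi> q \<noteq> 0"
    using assms(1) injD[OF inj', of q 0] by auto
qed

lemma translation_add:
  fixes f g :: "('g, 'k::field) ratfun"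
  shows "translation G h (f + g) = translation G h f + translation G h g"
proof -
  obtain p q where f: "f = Fract p q" "q \<noteq> 0" by (cases f)
  obtain r s where g: "g = Fract r s" "s \<noteq> 0" by (cases g)
  have "q * s \<noteq> 0" using f g by simp
  note tr = translation_Fract[OF f(2)] translation_Fract[OF g(2)] translation_Fract[OF this]
  show ?thesis
    unfolding f(1) g(1) add_fract[OF f(2) g(2)] tr(1,3,5) add_fract[OF tr(2,4)]
    by (simp only: mpoly_rename_add mpoly_rename_mult)
qed

lemma translation_mult:
  fixes f g :: "('g, 'k::field) ratfun"
  shows "translation G h (f * g) = translation G h f * translation G h g"
proof -
  obtain p q where f: "f = Fract p q" "q \<noteq> 0" by (cases f)
  obtain r s where g: "g = Fract r s" "s \<noteq> 0" by (cases g)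
  have "q * s \<noteq> 0" using f g by simp
  note tr = translation_Fract[OF f(2)] translation_Fract[OF g(2)] translation_Fract[OF this]
  show ?thesis
    unfolding f(1) g(1) mult_fract tr(1,3,5) by (simp only: mpoly_rename_mult)
qed

lemma translation_const: "translation G h (ratfun_const c :: ('g, 'k::field) ratfun) = ratfun_const c"
  unfolding ratfun_const_def translation_Fract(1)[OF one_neq_zero] mpoly_rename_const mpoly_rename_1 ..

lemma translation_var:
  assumes "g \<in> carrier G"
  shows "translation G h (ratfun_var g :: ('g, 'k::field) ratfun) = ratfun_var (h \<otimes>\<^bsub>G\<^esub> g)"
  unfolding ratfun_var_def translation_Fract(1)[OF one_neq_zero] mpoly_rename_var mpoly_rename_1
  using assms by simp

end

definition noether_field :: "('g, 'b) monoid_scheme \<Rightarrow> ('g, 'k::field) ratfun set" where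
  "noether_field G =
    {f \<in> adjoin (range ratfun_const) (ratfun_var ` carrier G). \<forall>h\<in>carrier G. translation G h f = f}"

end

theory Submission
  imports Defs
begin

text \<open>
  Write \<open>l = L + 1\<close> and \<open>\<zeta>\<close> for a primitive \<open>3\<^sup>l\<close>-th root of unity.  The hypotheses on \<open>a\<close> force
  \<open>a \<equiv> - 1 (mod 3\<^sup>l)\<close>.  Hence \<open>G\<^sub>2\<close> maps onto the binary octahedral group, with kernel generated by
  \<open>\<tau>\<^sup>3\<close>, and onto the dihedral group of order \<open>2 \<cdot> 3\<^sup>l\<close>, with kernel the quaternion group
  \<open>\<langle>\<lambda>, \<rho>\<rangle>\<close>.  The two standard representations, on \<open>\<langle>x\<^sub>1, x\<^sub>2\<rangle>\<close> and \<open>\<langle>y\<^sub>1, y\<^sub>2\<rangle>\<close>, are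
  together faithful.  They are defined over \<open>k\<close>: the exponent of \<open>G\<^sub>2\<close> is a multiple of \<open>8 \<cdot> 3\<^sup>l\<close>, so
  that \<open>k\<close> contains \<open>\<zeta>\<close>, a square root of \<open>- 1\<close> and one of \<open>- 1 / 2\<close>.  By restriction all this
  serves \<open>G\<^sub>1\<close> too.

  Both representations occur in the space of the linear forms in the variables \<open>x\<^sub>g\<close>.  So \<open>k(x\<^sub>g)\<close> is
  generated by \<open>x\<^sub>1, x\<^sub>2, y\<^sub>1, y\<^sub>2\<close> and all but four of the \<open>x\<^sub>g\<close>, and the fixed field is found
  by descending along
  \<open>k(x\<^sub>g) \<supseteq> k(x\<^sub>1, x\<^sub>2, y\<^sub>1, y\<^sub>2) \<supseteq> k(x\<^sub>1, x\<^sub>2, z\<^sub>1, z\<^sub>2) \<supseteq> k(x\<^sub>1, x\<^sub>2)\<close>.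

  The first and the last step are instances of \<open>no_name\<close>: if the group acts faithfully on \<open>M\<close> and by
  affine substitutions on further generators \<open>Z\<close>, then traces replace \<open>Z\<close> by as many invariant
  generators.  In the middle step \<open>z\<^sub>1, z\<^sub>2\<close> generate the invariants of the cyclic group
  \<open>\<langle>\<tau>\<^sup>3\<rangle>\<close>, which moves \<open>y\<^sub>1\<close> and \<open>y\<^sub>2\<close> only; the group acts on \<open>\<langle>z\<^sub>1, z\<^sub>2\<rangle>\<close> through a
  quotient that is faithful on \<open>k(x\<^sub>1, x\<^sub>2)\<close>.  What remains is \<open>k(x\<^sub>1, x\<^sub>2)\<close>, whose fixed field is
  generated by two quotients of Klein's octahedral forms.  It is computed along the chain
  \<open>\<langle>\<lambda>\<^sup>2\<rangle> \<subseteq> \<langle>\<lambda>, \<rho>\<rangle> \<subseteq> \<langle>\<lambda>, \<rho>, \<tau>\<rangle> \<subseteq> \<langle>\<lambda>, \<rho>, \<tau>, \<nu>\<rangle>\<close>, each step being a simple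
  extension of small degree with that many conjugates (\<open>fixed_in_simple_extension\<close>).

  In this way the fixed field is generated by \<open>|G|\<close> elements.  As \<open>k(x\<^sub>g)\<close> is algebraic over it and
  has transcendence degree \<open>|G|\<close>, Steinitz's theorem (\<open>generators_acl_indep\<close>) makes them algebraically
  independent.  This count is the only place where independence of the generators is dealt with.
\<close>

section \<open>Subfields and the fields they generate\<close>

definition is_subfield :: "'a::field set \<Rightarrow> bool" where
  "is_subfield F \<longleftrightarrow> 1 \<in> F \<and> (\<forall>x\<in>F. \<forall>y\<in>F. x + y \<in> F \<and> x * y \<in> F) \<and>
    (\<forall>x\<in>F. - x \<in> F \<and> inverse x \<in> F)"

lemma is_subfieldI:
  assumes "1 \<in> F" "\<And>x y. x \<in> F \<Longrightarrow> y \<in> F \<Longrightarrow> x + y \<in> F"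
    "\<And>x y. x \<in> F \<Longrightarrow> y \<in> F \<Longrightarrow> x * y \<in> F"
    "\<And>x. x \<in> F \<Longrightarrow> - x \<in> F" "\<And>x. x \<in> F \<Longrightarrow> inverse x \<in> F"
  shows "is_subfield F"
  unfolding is_subfield_def by (intro conjI ballI) (fact assms | rule assms; assumption)+

locale subfld =
  fixes F :: "'a::field set"
  assumes sub: "is_subfield F"
begin

lemma one [simp, intro]: "1 \<in> F"
  and add [intro]: "x \<in> F \<Longrightarrow> y \<in> F \<Longrightarrow> x + y \<in> F"
  and mult [intro]: "x \<in> F \<Longrightarrow> y \<in> F \<Longrightarrow> x * y \<in> F"
  and minus [intro]: "x \<in> F \<Longrightarrow> - x \<in> F"
  and inv [intro]: "x \<in> F \<Longrightarrow> inverse x \<in> F"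
  using sub unfolding is_subfield_def by auto

lemma zero [simp, intro]: "0 \<in> F"
  using add[OF one minus[OF one]] by simp

lemma diff [intro]: "x \<in> F \<Longrightarrow> y \<in> F \<Longrightarrow> x - y \<in> F"
  using add[OF _ minus, of x y] by simp

lemma div [intro]: "x \<in> F \<Longrightarrow> y \<in> F \<Longrightarrow> x / y \<in> F"
  using mult[OF _ inv, of x y] by (simp add: divide_inverse)

lemma pow [intro]: "x \<in> F \<Longrightarrow> x ^ n \<in> F"
  by (induction n) auto

lemma of_nat [simp, intro]: "of_nat n \<in> F"
  by (induction n) auto

lemma numeral [simp, intro]: "numeral n \<in> F"
  using of_nat[of "numeral n"] by simp

lemma sum [intro]: "(\<And>i. i \<in> A \<Longrightarrow> f i \<in> F) \<Longrightarrow> sum f A \<in> F"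
  by (induction A rule: infinite_finite_induct) auto

lemma prod [intro]: "(\<And>i. i \<in> A \<Longrightarrow> f i \<in> F) \<Longrightarrow> prod f A \<in> F"
  by (induction A rule: infinite_finite_induct) auto

end

lemma ring_of_type_algebra_inv:
  fixes x :: "'a::field"
  assumes "x \<noteq> 0"
  shows "inv\<^bsub>ring_of_type_algebra\<^esub> x = inverse x"
proof -
  interpret field "ring_of_type_algebra :: 'a ring" by (rule field_from_type_algebra)
  show ?thesis
    by (rule comm_inv_char) (use assms in \<open>auto simp: ring_of_type_algebra_def\<close>)
qed

lemma ring_of_type_algebra_uminus: "\<ominus>\<^bsub>ring_of_type_algebra\<^esub> (x :: 'a::field) = - x"
proof -
  interpret field "ring_of_type_algebra :: 'a ring" by (rule field_from_type_algebra)
  show ?thesis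
    by (rule minus_equality) (auto simp: ring_of_type_algebra_def)
qed

lemma adjoin_is_subfield: "is_subfield (adjoin k B)"
proof -
  let ?R = "ring_of_type_algebra :: 'a ring"
  have ops: "\<one>\<^bsub>?R\<^esub> = 1" "\<zero>\<^bsub>?R\<^esub> = 0" "x \<oplus>\<^bsub>?R\<^esub> y = x + y" "x \<otimes>\<^bsub>?R\<^esub> y = x * y" for x y
    by (simp_all add: ring_of_type_algebra_def)
  let ?E = "generate_field ?R (k \<union> B)"
  have 1: "1 \<in> ?E" using generate_field.one[of ?R "k \<union> B"] by (simp only: ops)
  have 2: "x + y \<in> ?E" if "x \<in> ?E" "y \<in> ?E" for x y
    using generate_field.eng_add[OF that] by (simp only: ops)
  have 3: "x * y \<in> ?E" if "x \<in> ?E" "y \<in> ?E" for x y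
    using generate_field.eng_mult[OF that] by (simp only: ops)
  have 4: "- x \<in> ?E" if "x \<in> ?E" for x
    using generate_field.a_inv[OF that] by (simp only: ring_of_type_algebra_uminus)
  have 5: "inverse x \<in> ?E" if "x \<in> ?E" for x
  proof (cases "x = 0")
    case True
    then show ?thesis using that by simp
  next
    case False
    then show ?thesis
      using generate_field.m_inv[OF that] by (simp add: ops ring_of_type_algebra_inv)
  qed
  show ?thesis unfolding adjoin_def by (rule is_subfieldI) (fact 1 2 3 4 5)+
qed

lemma subfld_adjoin: "subfld (adjoin k B)"
  by (simp add: subfld_def adjoin_is_subfield)

lemma adjoin_incl: "k \<subseteq> adjoin k B" "B \<subseteq> adjoin k B"
  unfolding adjoin_def by (auto intro: generate_field.incl)

lemma adjoin_least:
  assumes "is_subfield E" "k \<subseteq> E" "B \<subseteq> E"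
  shows "adjoin k B \<subseteq> E"
proof
  interpret subfld E using assms(1) by (simp add: subfld_def)
  fix x assume "x \<in> adjoin k B"
  then show "x \<in> E" unfolding adjoin_def
  proof (induction x rule: generate_field.induct)
    case (m_inv h)
    then have "h \<noteq> 0" by (simp add: ring_of_type_algebra_def)
    then show ?case using m_inv by (auto simp: ring_of_type_algebra_inv)
  qed (use assms in \<open>auto simp: ring_of_type_algebra_uminus, auto simp: ring_of_type_algebra_def\<close>)
qed

lemma adjoin_subset_adjoin:
  "k \<subseteq> adjoin k' B' \<Longrightarrow> B \<subseteq> adjoin k' B' \<Longrightarrow> adjoin k B \<subseteq> adjoin k' B'"
  by (rule adjoin_least[OF adjoin_is_subfield])

lemma adjoin_mono: "k \<subseteq> k' \<Longrightarrow> B \<subseteq> B' \<Longrightarrow> adjoin k B \<subseteq> adjoin k' B'"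
  by (rule adjoin_subset_adjoin; rule subset_trans[OF _ adjoin_incl(1)] subset_trans[OF _ adjoin_incl(2)])

lemma adjoin_adjoin: "adjoin (adjoin k A) B = adjoin k (A \<union> B)"
proof
  show "adjoin (adjoin k A) B \<subseteq> adjoin k (A \<union> B)"
    by (rule adjoin_subset_adjoin) (use adjoin_mono[of k k A "A \<union> B"] adjoin_incl(2)[of "A \<union> B" k] in auto)
  show "adjoin k (A \<union> B) \<subseteq> adjoin (adjoin k A) B"
    using adjoin_incl(1)[where k = "adjoin k A" and B = B] adjoin_incl(2)[where k = "adjoin k A" and B = B]
      adjoin_incl(1)[where k = k and B = A] adjoin_incl(2)[where k = k and B = A]
    by (intro adjoin_subset_adjoin) auto
qed

lemma adjoin_empty: "is_subfield F \<Longrightarrow> adjoin F {} = F"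
  by (intro equalityI adjoin_least adjoin_incl) auto


section \<open>Polynomials with coefficients in a subset\<close>

definition polys_over :: "'a::zero set \<Rightarrow> 'a poly set" where
  "polys_over F = {p. \<forall>i. coeff p i \<in> F}"

lemma polys_over_mono: "F \<subseteq> E \<Longrightarrow> polys_over F \<subseteq> polys_over E"
  by (auto simp: polys_over_def)

lemma polys_overI: "(\<And>i. coeff p i \<in> F) \<Longrightarrow> p \<in> polys_over F"
  by (simp add: polys_over_def)

lemma polys_overD: "p \<in> polys_over F \<Longrightarrow> coeff p i \<in> F"
  by (simp add: polys_over_def)

context subfld
begin

lemma polys_0 [simp, intro]: "0 \<in> polys_over F" and polys_1 [simp, intro]: "1 \<in> polys_over F"
  by (auto simp: polys_over_def coeff_1)

lemma polys_add [intro]: "p \<in> polys_over F \<Longrightarrow> q \<in> polys_over F \<Longrightarrow> p + q \<in> polys_over F"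
  by (auto simp: polys_over_def)

lemma polys_diff [intro]: "p \<in> polys_over F \<Longrightarrow> q \<in> polys_over F \<Longrightarrow> p - q \<in> polys_over F"
  by (auto simp: polys_over_def)

lemma polys_uminus [intro]: "p \<in> polys_over F \<Longrightarrow> - p \<in> polys_over F"
  by (auto simp: polys_over_def)

lemma polys_mult [intro]: "p \<in> polys_over F \<Longrightarrow> q \<in> polys_over F \<Longrightarrow> p * q \<in> polys_over F"
  by (auto simp: polys_over_def coeff_mult)

lemma polys_smult [intro]: "c \<in> F \<Longrightarrow> p \<in> polys_over F \<Longrightarrow> smult c p \<in> polys_over F"
  by (auto simp: polys_over_def)

lemma polys_monom [intro]: "c \<in> F \<Longrightarrow> monom c n \<in> polys_over F"
  by (auto simp: polys_over_def)

lemma polys_pCons [intro]: "c \<in> F \<Longrightarrow> p \<in> polys_over F \<Longrightarrow> pCons c p \<in> polys_over F"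
  by (auto simp: polys_over_def coeff_pCons split: nat.splits)

lemma polys_prod [intro]: "(\<And>i. i \<in> A \<Longrightarrow> f i \<in> polys_over F) \<Longrightarrow> prod f A \<in> polys_over F"
  by (induction A rule: infinite_finite_induct) auto

lemma polys_sum [intro]: "(\<And>i. i \<in> A \<Longrightarrow> f i \<in> polys_over F) \<Longrightarrow> sum f A \<in> polys_over F"
  by (induction A rule: infinite_finite_induct) auto

lemma poly_closed [intro]: "p \<in> polys_over F \<Longrightarrow> x \<in> F \<Longrightarrow> poly p x \<in> F"
  unfolding poly_altdef by (auto simp: polys_over_def)

lemma division_with_remainder:
  assumes "q \<in> polys_over F" "q \<noteq> 0" "p \<in> polys_over F"
  shows "\<exists>s\<in>polys_over F. \<exists>r\<in>polys_over F. p = s * q + r \<and> (r = 0 \<or> degree r < degree q)"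
  using assms(3)
proof (induction "degree p" arbitrary: p rule: less_induct)
  case less
  show ?case
  proof (cases "p = 0 \<or> degree p < degree q")
    case True
    then show ?thesis using less.prems by (intro bexI[of _ 0] bexI[of _ p]) auto
  next
    case False
    define m where "m = monom (lead_coeff p / lead_coeff q) (degree p - degree q)"
    have m: "m \<in> polys_over F"
      unfolding m_def using less.prems assms by (auto simp: polys_over_def)
    have mq: "lead_coeff (m * q) = lead_coeff p" "degree (m * q) = degree p"
      using False assms(2)
      unfolding lead_coeff_mult
      by (auto simp: m_def degree_mult_eq degree_monom_eq monom_eq_0_iff)
    show ?thesis
    proof (cases "degree p = 0")
      case True
      then have "p - m * q = 0"
        using mq by (auto elim!: degree_eq_zeroE)
      then show ?thesis using m by (intro bexI[of _ m] bexI[of _ 0]) auto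
    next
      case False
      have "coeff (p - m * q) (degree p) = 0" using mq by simp
      moreover have "degree (p - m * q) \<le> degree p"
        by (rule degree_diff_le) (simp_all add: mq)
      ultimately have "degree (p - m * q) < degree p"
        using False by (metis eq_zero_or_degree_less degree_0 gr0I)
      from less.hyps[OF this] m assms(1) less.prems obtain s r where
        *: "s \<in> polys_over F" "r \<in> polys_over F" "p - m * q = s * q + r" "r = 0 \<or> degree r < degree q"
        by blast
      then have "p = (s + m) * q + r" by (simp add: algebra_simps)
      then show ?thesis using * m by blast
    qed
  qed
qed

end

definition algebraic_over :: "'a::field set \<Rightarrow> 'a \<Rightarrow> bool" where
  "algebraic_over F x \<longleftrightarrow> (\<exists>p\<in>polys_over F. p \<noteq> 0 \<and> poly p x = 0)"

text \<open>Dividing a minimal polynomial \<open>\<mu>\<close> of \<open>x\<close> by a representative \<open>p\<close> of smaller degree gives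
  \<open>s(x) p(x) = - r(x)\<close> with \<open>deg r < deg p\<close>; so the inverses are found by descent on the degree.\<close>

lemma (in subfld) adjoin_algebraic:
  assumes mu: "\<mu> \<in> polys_over F" "\<mu> \<noteq> 0" "poly \<mu> x = 0" and y: "y \<in> adjoin F {x}"
  shows "\<exists>p\<in>polys_over F. y = poly p x \<and> degree p < degree \<mu>"
proof -
  define P where "P q \<longleftrightarrow> q \<in> polys_over F \<and> q \<noteq> 0 \<and> poly q x = 0" for q
  define m where "m = arg_min degree P"
  have Pm: "P m" and least: "\<And>q. P q \<Longrightarrow> degree m \<le> degree q"
    unfolding m_def using arg_min_natI[of P \<mu> degree] arg_min_nat_le[of P _ degree] mu
    by (auto simp: P_def)
  define E where "E = (\<lambda>p. poly p x) ` polys_over F"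
  have Em: "\<exists>p\<in>polys_over F. y = poly p x \<and> (p = 0 \<or> degree p < degree m)" if "y \<in> E" for y
  proof -
    from that obtain p where p: "p \<in> polys_over F" "y = poly p x" by (auto simp: E_def)
    obtain s r where "r \<in> polys_over F" "p = s * m + r" "r = 0 \<or> degree r < degree m"
      using division_with_remainder[of m p] Pm p by (auto simp: P_def)
    then show ?thesis using Pm p by (intro bexI[of _ r]) (auto simp: P_def)
  qed
  have mult: "a * b \<in> E" if ab: "a \<in> E" "b \<in> E" for a b
  proof -
    from ab obtain p q where "p \<in> polys_over F" "q \<in> polys_over F" "a = poly p x" "b = poly q x"
      unfolding E_def by blast
    then show ?thesis unfolding E_def by (intro image_eqI[of _ _ "p * q"]) auto
  qed
  have inv: "inverse (poly p x) \<in> E" if "p \<in> polys_over F" "poly p x \<noteq> 0" "degree p < degree m" for p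
    using that
  proof (induction "degree p" arbitrary: p rule: less_induct)
    case less
    show ?case
    proof (cases "degree p = 0")
      case True
      then obtain c where "p = [:c:]" by (rule degree_eq_zeroE)
      then show ?thesis unfolding E_def using less.prems polys_overD[of p F 0]
        by (intro image_eqI[of _ _ "[:inverse c:]"]) auto
    next
      case False
      obtain s r where sr: "s \<in> polys_over F" "r \<in> polys_over F" "m = s * p + r" "r = 0 \<or> degree r < degree p"
        using division_with_remainder[of p m] Pm less.prems(1,2) unfolding P_def by force
      have "poly m x = 0" "m \<noteq> 0" using Pm by (auto simp: P_def)
      then have eq: "poly s x * poly p x = - poly r x" using sr(3) by (simp add: eq_neg_iff_add_eq_0)
      have rx: "poly r x \<noteq> 0"
      proof
        assume "poly r x = 0"
        then have "poly s x = 0" using eq less.prems by simp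
        moreover have "s \<noteq> 0"
        proof
          assume "s = 0"
          then have "m = r" using sr by simp
          then show False using sr(4) less.prems \<open>m \<noteq> 0\<close> by auto
        qed
        ultimately have "degree m \<le> degree s" using least[of s] sr by (auto simp: P_def)
        moreover have "degree m = degree s + degree p"
        proof (cases "r = 0")
          case True
          moreover have "p \<noteq> 0" using less.prems by auto
          ultimately show ?thesis using sr \<open>s \<noteq> 0\<close> by (simp add: degree_mult_eq)
        next
          case f: False
          have "p \<noteq> 0" using less.prems by auto
          then have "degree (s * p) = degree s + degree p"
            using \<open>s \<noteq> 0\<close> by (simp add: degree_mult_eq)
          then show ?thesis using sr f by (simp add: degree_add_eq_left)
        qed
        ultimately show False using False by simp
      qed
      then have "r \<noteq> 0" by auto
      then have "inverse (poly r x) \<in> E"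
        using less.hyps[of r] sr rx less.prems by auto
      moreover have "- poly s x \<in> E" unfolding E_def using sr
        by (intro image_eqI[of _ _ "- s"]) auto
      moreover have "inverse (poly p x) = - poly s x * inverse (poly r x)"
        using eq rx less.prems by (simp add: field_simps)
      ultimately show ?thesis using mult by metis
    qed
  qed
  have "is_subfield E"
  proof (rule is_subfieldI)
    show "1 \<in> E" unfolding E_def by (rule image_eqI[of _ _ 1]) auto
    show "a + b \<in> E" if ab: "a \<in> E" "b \<in> E" for a b
    proof -
      from ab obtain p q where "p \<in> polys_over F" "q \<in> polys_over F" "a = poly p x" "b = poly q x"
        unfolding E_def by blast
      then show ?thesis unfolding E_def by (intro image_eqI[of _ _ "p + q"]) auto
    qed
    show "- a \<in> E" if "a \<in> E" for a
    proof -
      from that obtain p where "p \<in> polys_over F" "a = poly p x" unfolding E_def by blast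
      then show ?thesis unfolding E_def by (intro image_eqI[of _ _ "- p"]) auto
    qed
    show "inverse a \<in> E" if a: "a \<in> E" for a
    proof (cases "a = 0")
      case True
      then show ?thesis using a by simp
    next
      case False
      then show ?thesis using Em[OF a] inv by auto
    qed
  qed (rule mult)
  moreover have "F \<subseteq> E"
  proof
    fix c assume "c \<in> F"
    then show "c \<in> E" unfolding E_def by (intro image_eqI[of _ _ "[:c:]"]) auto
  qed
  moreover have "{x} \<subseteq> E" unfolding E_def by (auto intro!: image_eqI[of _ _ "[:0,1:]"])
  ultimately have "y \<in> E" using adjoin_least y by blast
  then obtain p where p: "p \<in> polys_over F" "y = poly p x" "p = 0 \<or> degree p < degree m"
    using Em by blast
  have "degree m \<le> degree \<mu>" using least mu by (auto simp: P_def)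
  moreover have "degree \<mu> \<noteq> 0"
  proof
    assume "degree \<mu> = 0"
    then obtain c where "\<mu> = [:c:]" by (rule degree_eq_zeroE)
    then show False using mu by simp
  qed
  ultimately have "degree p < degree \<mu>" using p(3) by auto
  then show ?thesis using p by blast
qed

section \<open>Linear spans over a subfield\<close>

inductive_set lspan :: "'a::field set \<Rightarrow> 'a set \<Rightarrow> 'a set" for L S where
  zero: "0 \<in> lspan L S"
| step: "c \<in> L \<Longrightarrow> s \<in> S \<Longrightarrow> x \<in> lspan L S \<Longrightarrow> c * s + x \<in> lspan L S"

lemma lspan_mono: "S \<subseteq> T \<Longrightarrow> lspan L S \<subseteq> lspan L T"
proof
  fix x assume "x \<in> lspan L S" "S \<subseteq> T"
  then show "x \<in> lspan L T" by induction (auto intro: lspan.intros)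
qed

lemma lspan_add: "x \<in> lspan L S \<Longrightarrow> y \<in> lspan L S \<Longrightarrow> x + y \<in> lspan L S"
  by (induction x rule: lspan.induct) (auto intro: lspan.intros simp: add.assoc)

lemma lspan_sum: "(\<And>i. i \<in> A \<Longrightarrow> f i \<in> lspan L S) \<Longrightarrow> sum f A \<in> lspan L S"
  by (induction A rule: infinite_finite_induct) (auto intro: lspan.zero lspan_add)

lemma lspan_insertE:
  assumes "x \<in> lspan L (insert z S)" "subfld L"
  obtains a w where "a \<in> L" "w \<in> lspan L S" "x = a * z + w"
proof -
  interpret subfld L by fact
  have "\<exists>a\<in>L. \<exists>w\<in>lspan L S. x = a * z + w"
    using assms(1)
  proof induction
    case zero
    then show ?case by (intro bexI[of _ 0]) (auto intro: lspan.zero)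
  next
    case (step c s x)
    obtain a w where *: "a \<in> L" "w \<in> lspan L S" "x = a * z + w" using step.IH by blast
    show ?case
    proof (cases "s = z")
      case True
      then show ?thesis using step.hyps(1) *
        by (intro bexI[of _ "c + a"] bexI[of _ w]) (auto simp: distrib_right add.assoc)
    next
      case False
      then have "s \<in> S" using step by simp
      then show ?thesis
        using step.hyps(1) * by (intro bexI[of _ a] bexI[of _ "c * s + w"]) (auto simp: add.left_commute intro: lspan.step)
    qed
  qed
  then show ?thesis using that by blast
qed

lemma lspan_empty: "lspan L {} = {0}"
  by (auto elim: lspan.cases intro: lspan.zero)

context subfld
begin

lemma lspan_scale:
  assumes "a \<in> F" "x \<in> lspan F S"
  shows "a * x \<in> lspan F S"
  using assms(2)
proof induction
  case (step c s x)
  have "(a * c) * s + a * x \<in> lspan F S" using step assms(1) by (intro lspan.step) auto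
  then show ?case by (simp add: algebra_simps)
qed (auto intro: lspan.zero)

lemma lspan_superset: "S \<subseteq> lspan F S"
  using lspan.step[OF one _ lspan.zero] by auto

lemma lspan_minus: "x \<in> lspan F S \<Longrightarrow> - x \<in> lspan F S"
  using lspan_scale[of "- 1" x S] by (simp add: minus)

lemma lspan_diff: "x \<in> lspan F S \<Longrightarrow> y \<in> lspan F S \<Longrightarrow> x - y \<in> lspan F S"
  using lspan_add[OF _ lspan_minus, of x S y] by simp

lemma lspan_trans:
  assumes "S \<subseteq> lspan F T"
  shows "lspan F S \<subseteq> lspan F T"
proof
  fix x assume "x \<in> lspan F S"
  then show "x \<in> lspan F T"
    by induction (use assms in \<open>auto intro!: lspan.zero lspan_add lspan_scale\<close>)
qed

lemma lspan_subset_adjoin: "S \<subseteq> adjoin F T \<Longrightarrow> lspan F S \<subseteq> adjoin F T"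
proof
  interpret E: subfld "adjoin F T" by (rule subfld_adjoin)
  fix x assume "x \<in> lspan F S" "S \<subseteq> adjoin F T"
  then show "x \<in> adjoin F T" using adjoin_incl(1)[of F T] by induction auto
qed

text \<open>Steinitz exchange: the elements of \<open>Z\<close> are replaced one at a time by elements of the spanning set
  \<open>I\<close>, while the part \<open>A\<close> of the generating set is kept.\<close>

lemma lspan_exchange:
  assumes "finite Z" "finite A" "A \<subseteq> I" "Z \<subseteq> lspan F I" "I \<subseteq> lspan F (A \<union> Z)"
  shows "\<exists>T. finite T \<and> A \<subseteq> T \<and> T \<subseteq> I \<and> card T \<le> card A + card Z \<and> Z \<subseteq> lspan F T"
  using assms
proof (induction Z arbitrary: A rule: finite_induct)
  case empty
  then show ?case by (intro exI[of _ A]) auto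
next
  case (insert z Z)
  show ?case
  proof (cases "I \<subseteq> lspan F (A \<union> Z)")
    case True
    then obtain T where T: "finite T" "A \<subseteq> T" "T \<subseteq> I" "card T \<le> card A + card Z" "Z \<subseteq> lspan F T"
      using insert.IH[of A] insert.prems by auto
    have "z \<in> lspan F I" using insert.prems(3) by blast
    also have "lspan F I \<subseteq> lspan F (A \<union> Z)" using True by (rule lspan_trans)
    also have "\<dots> \<subseteq> lspan F T"
      using T lspan_superset[of T] by (intro lspan_trans) auto
    finally show ?thesis using T insert.hyps by (intro exI[of _ T]) auto
  next
    case False
    then obtain s where s: "s \<in> I" "s \<notin> lspan F (A \<union> Z)" by blast
    then have "s \<in> lspan F (insert z (A \<union> Z))" using insert.prems by auto
    then obtain a w where aw: "a \<in> F" "w \<in> lspan F (A \<union> Z)" "s = a * z + w"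
      using subfld_axioms by (rule lspan_insertE)
    have "a \<noteq> 0" using aw s by auto
    have w: "w \<in> lspan F (insert s (A \<union> Z))" using aw(2) lspan_mono[of "A \<union> Z"] by blast
    have "s \<in> lspan F (insert s (A \<union> Z))" using lspan_superset by blast
    then have "inverse a * (s - w) \<in> lspan F (insert s (A \<union> Z))"
      using w aw(1) by (intro lspan_scale lspan_diff) auto
    then have z: "z \<in> lspan F (insert s (A \<union> Z))" using aw(3) \<open>a \<noteq> 0\<close> by (simp add: field_simps)
    have "I \<subseteq> lspan F (insert s A \<union> Z)"
    proof -
      have "insert z (A \<union> Z) \<subseteq> lspan F (insert s (A \<union> Z))"
        using z lspan_superset[of "insert s (A \<union> Z)"] by auto
      from lspan_trans[OF this] show ?thesis using insert.prems(4) by simp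
    qed
    then obtain T where T: "finite T" "insert s A \<subseteq> T" "T \<subseteq> I"
        "card T \<le> card (insert s A) + card Z" "Z \<subseteq> lspan F T"
      using insert.IH[of "insert s A"] insert.prems s by auto
    have "insert s (A \<union> Z) \<subseteq> lspan F T" using T lspan_superset[of T] by auto
    then have "z \<in> lspan F T" using z lspan_trans by blast
    moreover have "card (insert s A) \<le> Suc (card A)" by (rule card_insert_le_m1) auto
    ultimately show ?thesis using T insert.hyps by (intro exI[of _ T]) auto
  qed
qed

end


section \<open>Fixed fields\<close>

definition field_endo :: "('a::field \<Rightarrow> 'a) \<Rightarrow> bool" where
  "field_endo \<sigma> \<longleftrightarrow> \<sigma> 1 = 1 \<and> (\<forall>x y. \<sigma> (x + y) = \<sigma> x + \<sigma> y) \<and> (\<forall>x y. \<sigma> (x * y) = \<sigma> x * \<sigma> y)"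

definition fixed_field :: "('a::field \<Rightarrow> 'a) set \<Rightarrow> 'a set" where
  "fixed_field S = {x. \<forall>\<sigma>\<in>S. \<sigma> x = x}"

locale endo =
  fixes \<sigma> :: "'a::field \<Rightarrow> 'a"
  assumes endo: "field_endo \<sigma>"
begin

lemma one [simp]: "\<sigma> 1 = 1"
  and add [simp]: "\<sigma> (x + y) = \<sigma> x + \<sigma> y"
  and mult [simp]: "\<sigma> (x * y) = \<sigma> x * \<sigma> y"
  using endo by (auto simp: field_endo_def)

lemma zero [simp]: "\<sigma> 0 = 0"
proof -
  have "\<sigma> 0 = \<sigma> 0 + \<sigma> 0" using add[of 0 0] by (simp only: add_0_left)
  then show ?thesis by (simp only: add_cancel_right_right)
qed

lemma minus [simp]: "\<sigma> (- x) = - \<sigma> x"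
  using add[of x "- x"] by (simp add: eq_neg_iff_add_eq_0 add.commute del: add)

lemma diff [simp]: "\<sigma> (x - y) = \<sigma> x - \<sigma> y"
  using add[of x "- y"] by simp

lemma eq_0_iff [simp]: "\<sigma> x = 0 \<longleftrightarrow> x = 0"
proof
  assume "\<sigma> x = 0"
  then show "x = 0" using mult[of x "inverse x"] by (cases "x = 0") auto
qed simp

lemma inject [simp]: "\<sigma> x = \<sigma> y \<longleftrightarrow> x = y"
  using eq_0_iff[of "x - y"] by simp

lemma inj: "inj \<sigma>"
  by (rule injI) simp

lemma inv [simp]: "\<sigma> (inverse x) = inverse (\<sigma> x)"
proof (cases "x = 0")
  case False
  then have "\<sigma> x * \<sigma> (inverse x) = 1" by (simp flip: mult)
  then show ?thesis using inverse_unique by metis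
qed simp

lemma div [simp]: "\<sigma> (x / y) = \<sigma> x / \<sigma> y"
  by (simp add: divide_inverse)

lemma power [simp]: "\<sigma> (x ^ n) = \<sigma> x ^ n"
  by (induction n) auto

lemma sum: "\<sigma> (sum f A) = (\<Sum>i\<in>A. \<sigma> (f i))"
  by (induction A rule: infinite_finite_induct) auto

lemma of_nat [simp]: "\<sigma> (of_nat n) = of_nat n"
  by (induction n) auto

lemma numeral [simp]: "\<sigma> (numeral n) = numeral n"
  using of_nat[of "numeral n"] by simp

lemma map_poly_add: "map_poly \<sigma> (p + q) = map_poly \<sigma> p + map_poly \<sigma> q"
  by (rule poly_eqI) (simp add: coeff_map_poly)

lemma map_poly_mult: "map_poly \<sigma> (p * q) = map_poly \<sigma> p * map_poly \<sigma> q"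
  by (rule poly_eqI) (simp add: coeff_map_poly coeff_mult sum)

lemma map_poly_prod: "map_poly \<sigma> (prod f A) = (\<Prod>i\<in>A. map_poly \<sigma> (f i))"
  by (induction A rule: infinite_finite_induct) (auto simp: map_poly_mult)

lemma map_poly_sum: "map_poly \<sigma> (\<Sum>i\<in>A. f i) = (\<Sum>i\<in>A. map_poly \<sigma> (f i))"
  by (induction A rule: infinite_finite_induct) (auto simp: map_poly_add)

lemma map_poly_linear: "map_poly \<sigma> [:a, 1:] = [:\<sigma> a, 1:]"
  by (simp add: map_poly_pCons)

lemma poly_fixed:
  assumes "\<And>i. \<sigma> (coeff p i) = coeff p i"
  shows "\<sigma> (poly p x) = poly p (\<sigma> x)"
  by (simp add: poly_altdef sum assms)

end

lemma fixed_field_is_subfield: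
  assumes "\<And>\<sigma>. \<sigma> \<in> S \<Longrightarrow> field_endo \<sigma>"
  shows "is_subfield (fixed_field S)"
proof (rule is_subfieldI)
  have e: "endo \<sigma>" if "\<sigma> \<in> S" for \<sigma> using assms[OF that] by (simp add: endo_def)
  show "1 \<in> fixed_field S" using endo.one[OF e] by (simp add: fixed_field_def)
  show "x + y \<in> fixed_field S" if "x \<in> fixed_field S" "y \<in> fixed_field S" for x y
    using that by (auto simp: fixed_field_def endo.add[OF e])
  show "x * y \<in> fixed_field S" if "x \<in> fixed_field S" "y \<in> fixed_field S" for x y
    using that by (auto simp: fixed_field_def endo.mult[OF e])
  show "- x \<in> fixed_field S" if "x \<in> fixed_field S" for x
    using that by (auto simp: fixed_field_def endo.minus[OF e])
  show "inverse x \<in> fixed_field S" if "x \<in> fixed_field S" for x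
    using that by (auto simp: fixed_field_def endo.inv[OF e])
qed

text \<open>An element \<open>f\<close> of \<open>F(\<theta>)\<close> is a polynomial in \<open>\<theta>\<close> of degree less than \<open>deg \<mu>\<close>.  If \<open>f\<close> is fixed,
  that polynomial takes the value \<open>f\<close> at all the conjugates of \<open>\<theta>\<close>; these being too many, it is
  constant.\<close>

lemma fixed_in_simple_extension:
  assumes F: "is_subfield F" "F \<subseteq> fixed_field S" and endo: "\<And>\<sigma>. \<sigma> \<in> S \<Longrightarrow> field_endo \<sigma>"
    and mu: "\<mu> \<in> polys_over F" "\<mu> \<noteq> 0" "poly \<mu> \<theta> = 0" "degree \<mu> \<le> card ((\<lambda>\<sigma>. \<sigma> \<theta>) ` S)"
    and f: "f \<in> adjoin F {\<theta>}" "f \<in> fixed_field S"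
  shows "f \<in> F"
proof -
  interpret subfld F using F by (simp add: subfld_def)
  obtain p where p: "p \<in> polys_over F" "f = poly p \<theta>" "degree p < degree \<mu>"
    using adjoin_algebraic[OF mu(1-3) f(1)] by blast
  have "p - [:f:] = 0"
  proof (rule ccontr)
    assume nz: "p - [:f:] \<noteq> 0"
    have "(\<lambda>\<sigma>. \<sigma> \<theta>) ` S \<subseteq> {x. poly (p - [:f:]) x = 0}"
    proof safe
      fix \<sigma> assume s: "\<sigma> \<in> S"
      interpret endo \<sigma> using endo[OF s] by (simp add: endo_def)
      have "\<sigma> (coeff p i) = coeff p i" for i
        using polys_overD[OF p(1), of i] F(2) s by (auto simp: fixed_field_def)
      then have "\<sigma> f = poly p (\<sigma> \<theta>)" unfolding p(2) by (rule poly_fixed)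
      moreover have "\<sigma> f = f" using f(2) s by (simp add: fixed_field_def)
      ultimately show "poly (p - [:f:]) (\<sigma> \<theta>) = 0" by simp
    qed
    then have "card ((\<lambda>\<sigma>. \<sigma> \<theta>) ` S) \<le> card {x. poly (p - [:f:]) x = 0}"
      using poly_roots_finite[OF nz] by (rule card_mono[rotated])
    also have "\<dots> \<le> degree (p - [:f:])" using nz by (rule card_poly_roots_bound)
    also have "\<dots> \<le> degree p" by (rule degree_diff_le) auto
    finally show False using mu(4) p(3) by simp
  qed
  then have "f = coeff p 0" by (metis coeff_pCons_0 eq_iff_diff_eq_0)
  then show ?thesis using polys_overD[OF p(1)] by simp
qed


section \<open>Finite groups of automorphisms\<close>

locale field_auts =
  fixes \<Gamma> :: "('a::field \<Rightarrow> 'a) set"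
  assumes fin: "finite \<Gamma>" and id: "id \<in> \<Gamma>" and endos: "\<And>\<sigma>. \<sigma> \<in> \<Gamma> \<Longrightarrow> field_endo \<sigma>"
    and comp: "\<And>\<sigma> \<tau>. \<sigma> \<in> \<Gamma> \<Longrightarrow> \<tau> \<in> \<Gamma> \<Longrightarrow> \<sigma> \<circ> \<tau> \<in> \<Gamma>"
begin

abbreviation "Fix \<equiv> fixed_field \<Gamma>"

sublocale Fix: subfld Fix
  using fixed_field_is_subfield[OF endos] by unfold_locales

lemma endo: "\<sigma> \<in> \<Gamma> \<Longrightarrow> endo \<sigma>"
  using endos by (simp add: endo_def)

lemma translate: "\<sigma> \<in> \<Gamma> \<Longrightarrow> (\<lambda>\<tau>. \<sigma> \<circ> \<tau>) ` \<Gamma> = \<Gamma>"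
proof (rule endo_inj_surj[OF fin])
  assume s: "\<sigma> \<in> \<Gamma>"
  show "(\<lambda>\<tau>. \<sigma> \<circ> \<tau>) ` \<Gamma> \<subseteq> \<Gamma>" using comp s by auto
  show "inj_on (\<lambda>\<tau>. \<sigma> \<circ> \<tau>) \<Gamma>"
    by (rule inj_onI) (use endo.inj[OF endo[OF s]] in \<open>auto simp: fun_eq_iff inj_eq\<close>)
qed

definition orbit where "orbit x = (\<lambda>\<sigma>. \<sigma> x) ` \<Gamma>"

text \<open>Traces are taken over these pairs and not over \<open>\<Gamma>\<close>, where each term would be repeated as often
  as there are automorphisms that fix \<open>\<theta>\<close> and \<open>m\<close>, a number that may vanish in the field.\<close>

definition orbit2 where "orbit2 \<theta> m = (\<lambda>\<sigma>. (\<sigma> \<theta>, \<sigma> m)) ` \<Gamma>"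

lemma finite_orbit [simp]: "finite (orbit x)" and finite_orbit2 [simp]: "finite (orbit2 x m)"
  using fin by (auto simp: orbit_def orbit2_def)

lemma self_orbit: "x \<in> orbit x" and self_orbit2: "(x, m) \<in> orbit2 x m"
  using id unfolding orbit_def orbit2_def by (auto intro!: image_eqI[of _ _ id])

lemma image_orbit: "\<sigma> \<in> \<Gamma> \<Longrightarrow> \<sigma> ` orbit x = orbit x"
proof -
  assume s: "\<sigma> \<in> \<Gamma>"
  have "\<sigma> ` orbit x = (\<lambda>\<tau>. \<tau> x) ` (\<lambda>\<tau>. \<sigma> \<circ> \<tau>) ` \<Gamma>"
    by (simp add: orbit_def image_image)
  then show ?thesis using translate[OF s] by (simp add: orbit_def)
qed

lemma image_orbit2: "\<sigma> \<in> \<Gamma> \<Longrightarrow> map_prod \<sigma> \<sigma> ` orbit2 x m = orbit2 x m"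
proof -
  assume s: "\<sigma> \<in> \<Gamma>"
  have "map_prod \<sigma> \<sigma> ` orbit2 x m = (\<lambda>\<tau>. (\<tau> x, \<tau> m)) ` (\<lambda>\<tau>. \<sigma> \<circ> \<tau>) ` \<Gamma>"
    by (simp add: orbit2_def image_image)
  then show ?thesis using translate[OF s] by (simp add: orbit2_def)
qed

lemma sum_orbit2:
  assumes s: "\<sigma> \<in> \<Gamma>"
  shows "(\<Sum>(o', w)\<in>orbit2 x m. g (\<sigma> o') (\<sigma> w)) = (\<Sum>(o', w)\<in>orbit2 x m. g o' w)"
proof -
  have inj: "inj_on (map_prod \<sigma> \<sigma>) (orbit2 x m)"
    using endo.inj[OF endo[OF s]] by (intro inj_on_subset[OF prod.inj_map]) auto
  have "(\<Sum>(o', w)\<in>orbit2 x m. g o' w) = (\<Sum>(o', w)\<in>map_prod \<sigma> \<sigma> ` orbit2 x m. g o' w)"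
    using image_orbit2[OF s] by simp
  also have "\<dots> = (\<Sum>(o', w)\<in>orbit2 x m. g (\<sigma> o') (\<sigma> w))"
    using inj by (simp add: sum.reindex case_prod_unfold)
  finally show ?thesis ..
qed

lemma fixed_polysI:
  assumes "p \<in> polys_over L" "\<And>\<sigma>. \<sigma> \<in> \<Gamma> \<Longrightarrow> map_poly \<sigma> p = p"
  shows "p \<in> polys_over (L \<inter> Fix)"
proof (rule polys_overI)
  fix i
  have "\<sigma> (coeff p i) = coeff p i" if "\<sigma> \<in> \<Gamma>" for \<sigma>
    using assms(2)[OF that] coeff_map_poly[of \<sigma> p i] endo.zero[OF endo[OF that]] by simp
  then show "coeff p i \<in> L \<inter> Fix" using polys_overD[OF assms(1)] by (auto simp: fixed_field_def)
qed

definition orbit_poly where "orbit_poly x = (\<Prod>o'\<in>orbit x. [:- o', 1:])"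

lemma orbit_poly_roots: "orbit_poly x \<noteq> 0" "degree (orbit_poly x) = card (orbit x)" "poly (orbit_poly x) x = 0"
proof -
  show "orbit_poly x \<noteq> 0" by (simp add: orbit_poly_def)
  show "degree (orbit_poly x) = card (orbit x)"
    unfolding orbit_poly_def by (subst degree_prod_eq_sum_degree) auto
  show "poly (orbit_poly x) x = 0"
    using self_orbit[of x] by (auto simp: orbit_poly_def poly_prod intro!: bexI[of _ x])
qed

context
  fixes L
  assumes L: "is_subfield L" and stable: "\<And>\<sigma> x. \<sigma> \<in> \<Gamma> \<Longrightarrow> x \<in> L \<Longrightarrow> \<sigma> x \<in> L"
begin

interpretation L: subfld L using L by unfold_locales

lemma orbit_subset: "x \<in> L \<Longrightarrow> orbit x \<subseteq> L"
  using stable by (auto simp: orbit_def)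

lemma orbit_poly_over:
  assumes "x \<in> L"
  shows "orbit_poly x \<in> polys_over (L \<inter> Fix)"
proof (rule fixed_polysI)
  show "orbit_poly x \<in> polys_over L"
    unfolding orbit_poly_def using orbit_subset[OF assms] by blast
  fix \<sigma> assume s: "\<sigma> \<in> \<Gamma>"
  interpret endo \<sigma> using endo[OF s] .
  have "map_poly \<sigma> (orbit_poly x) = (\<Prod>o'\<in>orbit x. [:- \<sigma> o', 1:])"
    by (simp add: orbit_poly_def map_poly_prod map_poly_linear)
  also have "\<dots> = (\<Prod>o'\<in>\<sigma> ` orbit x. [:- o', 1:])"
    by (subst prod.reindex) (auto intro: inj_onI)
  finally show "map_poly \<sigma> (orbit_poly x) = orbit_poly x"
    by (simp add: image_orbit[OF s] orbit_poly_def)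
qed

text \<open>Lagrange interpolation: the polynomial that sends \<open>\<sigma> \<theta>\<close> to \<open>\<sigma> c\<close> has invariant coefficients,
  up to the factor that interpolates the constant \<open>1\<close>.\<close>

lemma invariants_adjoin_separating:
  assumes th: "\<theta> \<in> L" and c: "c \<in> L" and fx: "\<And>\<sigma>. \<sigma> \<in> \<Gamma> \<Longrightarrow> \<sigma> \<theta> = \<theta> \<Longrightarrow> \<sigma> c = c"
  shows "c \<in> adjoin (L \<inter> Fix) {\<theta>}"
proof -
  \<comment> \<open>\<open>R c\<close> has at \<open>\<theta>\<close> the value \<open>c\<close>, up to the factor \<open>Q \<theta>\<close>, which is also the value of \<open>R 1\<close>.\<close>
  define Q where "Q o' = (\<Prod>r\<in>orbit \<theta> - {o'}. [:- r, 1:])" for o'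
  define R where "R c = (\<Sum>(o', w)\<in>orbit2 \<theta> c. smult w (Q o'))" for c
  have pairs: "o' \<in> orbit \<theta>" "w \<in> L" if "(o', w) \<in> orbit2 \<theta> c" "c \<in> L" for o' w c
    using that stable by (auto simp: orbit_def orbit2_def)
  have over: "R c \<in> polys_over (L \<inter> Fix)" if c: "c \<in> L" for c
  proof (rule fixed_polysI)
    show "R c \<in> polys_over L"
      unfolding R_def Q_def using pairs[OF _ c] orbit_subset[OF th]
      by (intro L.polys_sum) (auto intro!: L.polys_smult L.polys_prod L.polys_pCons)
    fix \<sigma> assume s: "\<sigma> \<in> \<Gamma>"
    interpret endo \<sigma> using endo[OF s] .
    have Q: "map_poly \<sigma> (Q o') = Q (\<sigma> o')" for o'
    proof -
      have "map_poly \<sigma> (Q o') = (\<Prod>r\<in>orbit \<theta> - {o'}. [:- \<sigma> r, 1:])"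
        by (simp add: Q_def map_poly_prod map_poly_linear)
      also have "\<dots> = (\<Prod>r\<in>\<sigma> ` (orbit \<theta> - {o'}). [:- r, 1:])"
        by (subst prod.reindex) (auto intro: inj_onI)
      also have "\<sigma> ` (orbit \<theta> - {o'}) = orbit \<theta> - {\<sigma> o'}"
        using image_orbit[OF s, of \<theta>] by (simp add: image_set_diff[OF inj])
      finally show ?thesis by (simp add: Q_def)
    qed
    have "smult w (Q o') = [:w:] * Q o'" for w o' by simp
    then have "map_poly \<sigma> (smult w (Q o')) = smult (\<sigma> w) (Q (\<sigma> o'))" for w o'
      by (simp only: map_poly_mult Q) (simp add: map_poly_pCons)
    then have "map_poly \<sigma> (R c) = (\<Sum>(o', w)\<in>orbit2 \<theta> c. smult (\<sigma> w) (Q (\<sigma> o')))"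
      by (simp add: R_def map_poly_sum case_prod_unfold)
    also have "\<dots> = R c" unfolding R_def by (rule sum_orbit2[OF s, where g = "\<lambda>o' w. smult w (Q o')"])
    finally show "map_poly \<sigma> (R c) = R c" .
  qed
  have Q0: "poly (Q o') \<theta> = 0" if "o' \<noteq> \<theta>" for o'
    using that self_orbit[of \<theta>] by (auto simp: Q_def poly_prod intro!: bexI[of _ \<theta>])
  have Qth: "poly (Q \<theta>) \<theta> \<noteq> 0" by (auto simp: Q_def poly_prod)
  have val: "poly (R c) \<theta> = c * poly (Q \<theta>) \<theta>" if fx: "\<And>\<sigma>. \<sigma> \<in> \<Gamma> \<Longrightarrow> \<sigma> \<theta> = \<theta> \<Longrightarrow> \<sigma> c = c" for c
  proof -
    have "poly (R c) \<theta> = (\<Sum>(o', w)\<in>orbit2 \<theta> c. w * poly (Q o') \<theta>)"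
      by (simp add: R_def poly_sum case_prod_unfold)
    also have "\<dots> = (\<Sum>(o', w)\<in>{(\<theta>, c)}. w * poly (Q o') \<theta>)"
    proof (rule sum.mono_neutral_right)
      show "\<forall>p\<in>orbit2 \<theta> c - {(\<theta>, c)}. (case p of (o', w) \<Rightarrow> w * poly (Q o') \<theta>) = 0"
      proof
        fix p assume "p \<in> orbit2 \<theta> c - {(\<theta>, c)}"
        then have "fst p \<noteq> \<theta>" using fx by (auto simp: orbit2_def)
        then show "(case p of (o', w) \<Rightarrow> w * poly (Q o') \<theta>) = 0" using Q0 by (simp add: case_prod_unfold)
      qed
    qed (use self_orbit2[of \<theta> c] in auto)
    finally show ?thesis by simp
  qed
  interpret E: subfld "adjoin (L \<inter> Fix) {\<theta>}" by (rule subfld_adjoin)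
  have "poly (R c) \<theta> \<in> adjoin (L \<inter> Fix) {\<theta>}" if "c \<in> L" for c
    using over[OF that] polys_over_mono[OF adjoin_incl(1)] adjoin_incl(2)[of "{\<theta>}"]
    by (intro E.poly_closed) auto
  from this[OF c] this[OF L.one]
  have "poly (R c) \<theta> / poly (R 1) \<theta> \<in> adjoin (L \<inter> Fix) {\<theta>}" by blast
  moreover have "poly (R 1) \<theta> = 1 * poly (Q \<theta>) \<theta>" by (rule val) (use endo endo.one in blast)
  moreover have "poly (R c) \<theta> = c * poly (Q \<theta>) \<theta>" by (rule val) (rule fx)
  ultimately show ?thesis using Qth by simp
qed

text \<open>The coefficients of a polynomial over \<open>L\<close> that vanishes at all conjugates of \<open>\<theta>\<close> other than \<open>\<theta>\<close>
  itself combine the traces of the \<open>\<theta>\<^sup>j m\<close> to a nonzero multiple of \<open>m\<close>.\<close>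

lemma in_span_of_traces:
  assumes th: "\<theta> \<in> L" and fx: "\<And>\<sigma>. \<sigma> \<in> \<Gamma> \<Longrightarrow> \<sigma> \<theta> = \<theta> \<Longrightarrow> \<sigma> m = m"
    and M: "\<And>\<sigma>. \<sigma> \<in> \<Gamma> \<Longrightarrow> \<sigma> m \<in> lspan L B"
  shows "m \<in> lspan L (lspan L B \<inter> Fix)"
proof -
  define tr where "tr j = (\<Sum>(o', w)\<in>orbit2 \<theta> m. o' ^ j * w)" for j :: nat
  define Q where "Q = (\<Prod>r\<in>orbit \<theta> - {\<theta>}. [:- r, 1:])"
  define d where "d = poly Q \<theta>"
  have d: "d \<noteq> 0" by (auto simp: d_def Q_def poly_prod)
  have Q: "Q \<in> polys_over L" using orbit_subset[OF th] unfolding Q_def by (intro L.polys_prod) auto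
  then have "d \<in> L" unfolding d_def using th by auto
  have trM: "tr j \<in> lspan L B" for j
    unfolding tr_def using M stable th
    by (intro lspan_sum) (auto simp: orbit2_def intro!: L.lspan_scale)
  have "\<sigma> (tr j) = tr j" if s: "\<sigma> \<in> \<Gamma>" for \<sigma> j
  proof -
    interpret endo \<sigma> using endo[OF s] .
    show ?thesis unfolding tr_def
      using sum_orbit2[OF s, of "\<lambda>o' w. o' ^ j * w" \<theta> m] by (simp add: sum case_prod_unfold)
  qed
  then have tr: "tr j \<in> lspan L B \<inter> Fix" for j using trM by (auto simp: fixed_field_def)
  have "(\<Sum>j\<le>degree Q. coeff Q j * tr j) = (\<Sum>j\<le>degree Q. \<Sum>(o', w)\<in>orbit2 \<theta> m. (coeff Q j * o' ^ j) * w)"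
    by (simp add: tr_def sum_distrib_left case_prod_unfold mult.assoc)
  also have "\<dots> = (\<Sum>(o', w)\<in>orbit2 \<theta> m. poly Q o' * w)"
    by (subst sum.swap) (simp add: poly_altdef sum_distrib_right case_prod_unfold)
  also have "\<dots> = (\<Sum>(o', w)\<in>{(\<theta>, m)}. poly Q o' * w)"
  proof (rule sum.mono_neutral_right)
    show "\<forall>p\<in>orbit2 \<theta> m - {(\<theta>, m)}. (case p of (o', w) \<Rightarrow> poly Q o' * w) = 0"
    proof
      fix p assume p: "p \<in> orbit2 \<theta> m - {(\<theta>, m)}"
      then have "fst p \<in> orbit \<theta>" "fst p \<noteq> \<theta>" using fx by (auto simp: orbit2_def orbit_def)
      then have "poly Q (fst p) = 0" by (auto simp: Q_def poly_prod)
      then show "(case p of (o', w) \<Rightarrow> poly Q o' * w) = 0" by (simp add: case_prod_unfold)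
    qed
  qed (use self_orbit2 in auto)
  finally have eq: "(\<Sum>j\<le>degree Q. coeff Q j * tr j) = d * m" by (simp add: d_def)
  have "inverse d * (\<Sum>j\<le>degree Q. coeff Q j * tr j) \<in> lspan L (lspan L B \<inter> Fix)"
    using \<open>d \<in> L\<close> polys_overD[OF Q] tr L.lspan_superset[of "lspan L B \<inter> Fix"]
    by (intro L.lspan_scale lspan_sum L.inv) auto
  then have "inverse d * (d * m) \<in> lspan L (lspan L B \<inter> Fix)" by (simp only: eq)
  moreover have "inverse d * (d * m) = m" using d by simp
  ultimately show ?thesis by (simp only:)
qed

text \<open>By traces the \<open>L\<close>-space spanned by \<open>1\<close> and \<open>Z\<close> has a generating set of invariants; exchange keeps
  at most \<open>card Z\<close> of them besides \<open>1\<close>.  As \<open>L\<close> is generated by \<open>\<theta>\<close> over its invariants, so is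
  \<open>L(Z) = L(T)\<close> over \<open>(L \<inter> Fix)(T)\<close>, and \<open>\<theta>\<close> has as many conjugates as its degree allows.\<close>

lemma no_name:
  assumes th: "\<theta> \<in> L" and Z: "finite Z"
    and span: "\<And>\<sigma> z. \<sigma> \<in> \<Gamma> \<Longrightarrow> z \<in> Z \<Longrightarrow> \<sigma> z \<in> lspan L (insert 1 Z)"
    and fx: "\<And>\<sigma> x. \<sigma> \<in> \<Gamma> \<Longrightarrow> \<sigma> \<theta> = \<theta> \<Longrightarrow> x \<in> L \<union> Z \<Longrightarrow> \<sigma> x = x"
  shows "\<exists>T. finite T \<and> card T \<le> card Z \<and> adjoin L Z \<inter> Fix = adjoin (L \<inter> Fix) T"
proof -
  define M where "M = lspan L (insert 1 Z)"
  have ZM: "insert 1 Z \<subseteq> M" unfolding M_def by (rule L.lspan_superset)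
  have "insert 1 Z \<subseteq> lspan L (M \<inter> Fix)"
  proof
    fix m assume m: "m \<in> insert 1 Z"
    show "m \<in> lspan L (M \<inter> Fix)"
      unfolding M_def
    proof (rule in_span_of_traces[OF th])
      show "\<sigma> m = m" if "\<sigma> \<in> \<Gamma>" "\<sigma> \<theta> = \<theta>" for \<sigma>
        using fx[OF that] m endo.one[OF endo[OF that(1)]] by auto
      show "\<sigma> m \<in> lspan L (insert 1 Z)" if "\<sigma> \<in> \<Gamma>" for \<sigma>
        using span[OF that] m endo.one[OF endo[OF that(1)]] ZM by (auto simp: M_def)
    qed
  qed
  then have "\<exists>T. finite T \<and> {1} \<subseteq> T \<and> T \<subseteq> M \<inter> Fix \<and> card T \<le> card {1 :: 'a} + card Z \<and> Z \<subseteq> lspan L T"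
    using ZM Z by (intro L.lspan_exchange) (auto simp: M_def)
  then obtain T where T: "finite T" "1 \<in> T" "T \<subseteq> M" "T \<subseteq> Fix" "card T \<le> Suc (card Z)" "Z \<subseteq> lspan L T"
    by auto
  define T' where "T' = T - {1}"
  have cardT': "card T' \<le> card Z" using T by (simp add: T'_def)
  have M_adj: "M \<subseteq> adjoin L Z"
    unfolding M_def using adjoin_incl(1)[of L Z] adjoin_incl(2)[of Z L] L.one by (intro L.lspan_subset_adjoin) auto
  have T_adj: "T \<subseteq> adjoin L T'" using adjoin_incl(1)[of L T'] adjoin_incl(2)[of T' L] L.one by (auto simp: T'_def)
  have eq: "adjoin L Z = adjoin L T'"
  proof
    show "adjoin L Z \<subseteq> adjoin L T'"
      using T(6) L.lspan_subset_adjoin[OF T_adj] adjoin_incl(1)[of L T'] by (intro adjoin_subset_adjoin) auto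
    show "adjoin L T' \<subseteq> adjoin L Z"
      using T(3) M_adj adjoin_incl(1)[of L Z] by (intro adjoin_subset_adjoin) (auto simp: T'_def)
  qed
  define F where "F = adjoin (L \<inter> Fix) T'"
  have F_Fix: "F \<subseteq> Fix" unfolding F_def using T Fix.sub by (intro adjoin_least) (auto simp: T'_def)
  have "L \<subseteq> adjoin (L \<inter> Fix) {\<theta>}" using invariants_adjoin_separating[OF th] fx by blast
  also have "\<dots> \<subseteq> adjoin F {\<theta>}" unfolding F_def by (intro adjoin_mono adjoin_incl) auto
  finally have LF: "L \<subseteq> adjoin F {\<theta>}" .
  have sub: "adjoin L T' \<subseteq> adjoin F {\<theta>}"
    using LF adjoin_incl(2)[of T' "L \<inter> Fix"] adjoin_incl(1)[of F "{\<theta>}"]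
    by (intro adjoin_subset_adjoin) (auto simp: F_def)
  have "adjoin L Z \<inter> Fix = F"
  proof
    show "F \<subseteq> adjoin L Z \<inter> Fix"
      using F_Fix adjoin_mono[of "L \<inter> Fix" L T' T'] by (auto simp: F_def eq)
    show "adjoin L Z \<inter> Fix \<subseteq> F"
    proof
      fix f assume f: "f \<in> adjoin L Z \<inter> Fix"
      show "f \<in> F"
      proof (rule fixed_in_simple_extension[where S = \<Gamma> and \<theta> = \<theta> and \<mu> = "orbit_poly \<theta>"])
        show "orbit_poly \<theta> \<in> polys_over F"
          using orbit_poly_over[OF th] polys_over_mono[OF adjoin_incl(1)[of "L \<inter> Fix" T']] by (auto simp: F_def)
        show "degree (orbit_poly \<theta>) \<le> card ((\<lambda>\<sigma>. \<sigma> \<theta>) ` \<Gamma>)"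
          using orbit_poly_roots(2)[of \<theta>] by (simp add: orbit_def)
        show "is_subfield F" unfolding F_def by (rule adjoin_is_subfield)
      qed (use f sub eq F_Fix endos orbit_poly_roots in auto)
    qed
  qed
  then show ?thesis using cardT' T(1) unfolding F_def T'_def by blast
qed

end

end

section \<open>Algebraic closure as a closure operator\<close>

context subfld
begin

lemma linear_dependence:
  assumes "finite Z" "finite I" "card Z < card I" "\<And>i. i \<in> I \<Longrightarrow> f i \<in> lspan F Z"
  shows "\<exists>c. (\<forall>i\<in>I. c i \<in> F) \<and> (\<exists>i\<in>I. c i \<noteq> 0) \<and> (\<Sum>i\<in>I. c i * f i) = 0"
  using assms
proof (induction Z arbitrary: I f rule: finite_induct)
  case empty
  then have "I \<noteq> {}" by auto
  then show ?case using empty by (intro exI[of _ "\<lambda>_. 1"]) (auto simp: lspan_empty)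
next
  case (insert z Z)
  have "\<forall>i\<in>I. \<exists>a w. a \<in> F \<and> w \<in> lspan F Z \<and> f i = a * z + w"
    using insert.prems(3) lspan_insertE[OF _ subfld_axioms] by metis
  then obtain a w where aw: "\<And>i. i \<in> I \<Longrightarrow> a i \<in> F" "\<And>i. i \<in> I \<Longrightarrow> w i \<in> lspan F Z"
    "\<And>i. i \<in> I \<Longrightarrow> f i = a i * z + w i" by metis
  show ?case
  proof (cases "\<forall>i\<in>I. a i = 0")
    case True
    then show ?thesis using insert.IH[of I f] insert.prems(1,2) insert.hyps aw by simp
  next
    case False
    then obtain p where p: "p \<in> I" "a p \<noteq> 0" by blast
    let ?I = "I - {p}"
    define g where "g i = f i - (a i / a p) * f p" for i
    have "g i = w i - (a i / a p) * w p" if "i \<in> ?I" for i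
      using that p aw(3)[of i] aw(3)[of p] by (simp add: g_def field_simps)
    moreover have "w i - (a i / a p) * w p \<in> lspan F Z" if "i \<in> ?I" for i
      using that p by (intro lspan_diff lspan_scale aw div) auto
    ultimately have "g i \<in> lspan F Z" if "i \<in> ?I" for i using that by simp
    moreover have "card Z < card ?I" using insert.prems insert.hyps p by simp
    ultimately obtain c where c: "\<And>i. i \<in> ?I \<Longrightarrow> c i \<in> F" "\<exists>i\<in>?I. c i \<noteq> 0" "(\<Sum>i\<in>?I. c i * g i) = 0"
      using insert.IH[of ?I g] insert.prems by auto
    define c' where "c' i = (if i = p then - (\<Sum>j\<in>?I. c j * (a j / a p)) else c i)" for i
    have "(\<Sum>i\<in>I. c' i * f i) = c' p * f p + (\<Sum>i\<in>?I. c' i * f i)"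
      using insert.prems(1) p(1) by (simp add: sum.remove)
    also have "(\<Sum>i\<in>?I. c' i * f i) = (\<Sum>i\<in>?I. c i * f i)"
      by (rule sum.cong) (auto simp: c'_def)
    also have "c' p * f p + \<dots> = (\<Sum>i\<in>?I. c i * g i)"
      by (simp add: c'_def g_def sum_distrib_right right_diff_distrib sum_subtractf mult.assoc)
    finally have "(\<Sum>i\<in>I. c' i * f i) = 0" using c(3) by simp
    moreover have "\<forall>i\<in>I. c' i \<in> F" using c(1) aw(1) p by (auto simp: c'_def intro!: minus sum mult div)
    moreover have "\<exists>i\<in>I. c' i \<noteq> 0" using c(2) by (auto simp: c'_def)
    ultimately show ?thesis by blast
  qed
qed

text \<open>All powers of \<open>x\<close> lie in a space spanned by finitely many elements, so they are dependent.\<close>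

lemma algebraic_overI_stable_span:
  assumes "finite Z" "1 \<in> lspan F Z" "\<And>z. z \<in> Z \<Longrightarrow> x * z \<in> lspan F Z"
  shows "algebraic_over F x"
proof -
  have mult: "x * y \<in> lspan F Z" if "y \<in> lspan F Z" for y
    using that
  proof induction
    case (step c s y)
    have "c * (x * s) + x * y \<in> lspan F Z"
      using lspan_add[OF lspan_scale[OF step(1) assms(3)[OF step(2)]] step(4)] .
    then show ?case by (simp add: algebra_simps)
  qed (auto intro: lspan.zero)
  have "x ^ i \<in> lspan F Z" for i
    by (induction i) (use assms(2) mult in auto)
  then obtain c where c: "\<And>i. i \<in> {..card Z} \<Longrightarrow> c i \<in> F" "\<exists>i\<in>{..card Z}. c i \<noteq> 0"
    "(\<Sum>i\<le>card Z. c i * x ^ i) = 0"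
    using linear_dependence[of Z "{..card Z}" "\<lambda>i. x ^ i"] assms(1) by auto
  define p where "p = (\<Sum>i\<le>card Z. monom (c i) i)"
  have "p \<in> polys_over F" unfolding p_def using c(1) by (intro polys_sum polys_monom) auto
  moreover have "poly p x = 0" using c(3) by (simp add: p_def poly_sum poly_monom)
  moreover have "p \<noteq> 0"
  proof -
    obtain i where i: "i \<in> {..card Z}" "c i \<noteq> 0" using c(2) by blast
    then have "coeff p i = c i" by (simp add: p_def coeff_sum)
    then show ?thesis using i by auto
  qed
  ultimately show ?thesis by (auto simp: algebraic_over_def)
qed

lemma algebraic_overE_monic:
  assumes "algebraic_over F x"
  obtains n e where "n > 0" "\<And>j. e j \<in> F" "x ^ n = (\<Sum>j<n. e j * x ^ j)"
proof -
  obtain p where p: "p \<in> polys_over F" "p \<noteq> 0" "poly p x = 0"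
    using assms by (auto simp: algebraic_over_def)
  define n where "n = degree p"
  have "n > 0"
  proof (rule ccontr)
    assume "\<not> n > 0"
    then obtain c where "p = [:c:]" using degree_eq_zeroE[of p] by (auto simp: n_def)
    then show False using p by simp
  qed
  define e where "e j = - coeff p j / lead_coeff p" for j
  have "0 = (\<Sum>j\<le>n. coeff p j * x ^ j)" using p(3) by (simp add: poly_altdef n_def)
  also have "\<dots> = (\<Sum>j<n. coeff p j * x ^ j) + lead_coeff p * x ^ n"
    by (simp add: n_def lessThan_Suc_atMost[symmetric])
  finally have "x ^ n = - (\<Sum>j<n. coeff p j * x ^ j) / lead_coeff p"
    using p(2) by (simp add: field_simps eq_neg_iff_add_eq_0)
  also have "\<dots> = (\<Sum>j<n. e j * x ^ j)"
    by (simp add: e_def sum_divide_distrib sum_negf)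
  finally show ?thesis using that[of n e] \<open>n > 0\<close> polys_overD[OF p(1)] by (auto simp: e_def)
qed

text \<open>A finitely generated module that is stable under \<open>A\<close> is enlarged, by the powers of \<open>x\<close>, to one
  that is stable under \<open>x\<close> as well.\<close>

lemma stable_span_insert:
  assumes Z: "finite Z" "1 \<in> lspan F Z" "\<And>a z. a \<in> A \<Longrightarrow> z \<in> Z \<Longrightarrow> a * z \<in> lspan F Z"
    and x: "n > 0" "x ^ n = (\<Sum>j<n. e j * x ^ j)" "\<And>j z. j < n \<Longrightarrow> z \<in> Z \<Longrightarrow> e j * z \<in> lspan F Z"
  shows "\<exists>Z'. finite Z' \<and> 1 \<in> lspan F Z' \<and> (\<forall>a\<in>insert x A. \<forall>z\<in>Z'. a * z \<in> lspan F Z')"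
proof -
  define Z' where "Z' = (\<lambda>(i, z). x ^ i * z) ` ({..<n} \<times> Z)"
  have pow: "x ^ i * y \<in> lspan F Z'" if "i < n" "y \<in> lspan F Z" for i y
    using that(2)
  proof induction
    case (step c s y)
    have "x ^ i * s \<in> Z'" using step that(1) by (auto simp: Z'_def)
    then have "c * (x ^ i * s) + x ^ i * y \<in> lspan F Z'"
      using step by (intro lspan.step) auto
    then show ?case by (simp add: algebra_simps)
  qed (auto intro: lspan.zero)
  have "finite Z'" using Z(1) by (simp add: Z'_def)
  moreover have "1 \<in> lspan F Z'" using pow[of 0 1] x(1) Z(2) by simp
  moreover have "a * z \<in> lspan F Z'" if az: "a \<in> insert x A" "z \<in> Z'" for a z
  proof -
    from az(2) obtain i y where iy: "i < n" "y \<in> Z" "z = x ^ i * y" by (auto simp: Z'_def)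
    consider "a \<in> A" | "a = x" "Suc i < n" | "a = x" "Suc i = n"
      using az(1) iy(1) Suc_lessI[of i n] by blast
    then show ?thesis
    proof cases
      case 1
      then show ?thesis using pow[OF iy(1) Z(3)[OF 1 iy(2)]] iy(3) by (simp add: mult.left_commute)
    next
      case 2
      then show ?thesis using pow[of "Suc i" y] iy lspan_superset[of Z] by (auto simp: mult.assoc)
    next
      case 3
      have "a * z = x ^ n * y" using 3 iy by (auto simp: mult.assoc)
      also have "\<dots> = (\<Sum>j<n. x ^ j * (e j * y))"
        by (simp add: x(2) sum_distrib_left sum_distrib_right mult_ac)
      also have "\<dots> \<in> lspan F Z'" using x(3) iy by (intro lspan_sum pow) auto
      finally show ?thesis .
    qed
  qed
  ultimately show ?thesis by blast
qed

lemma stable_span_algebraic: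
  assumes "finite A" "\<And>a. a \<in> A \<Longrightarrow> algebraic_over F a"
  shows "\<exists>Z. finite Z \<and> 1 \<in> lspan F Z \<and> (\<forall>a\<in>A. \<forall>z\<in>Z. a * z \<in> lspan F Z)"
  using assms
proof (induction A rule: finite_induct)
  case empty
  then show ?case using lspan_superset[of "{1}"] by (intro exI[of _ "{1}"]) auto
next
  case (insert x A)
  then obtain Z where Z: "finite Z" "1 \<in> lspan F Z" "\<forall>a\<in>A. \<forall>z\<in>Z. a * z \<in> lspan F Z" by auto
  obtain n e where "n > 0" "\<And>j. e j \<in> F" "x ^ n = (\<Sum>j<n. e j * x ^ j)"
    using algebraic_overE_monic insert.prems by blast
  then show ?case
    using Z lspan_superset[of Z] by (intro stable_span_insert[where A = A]) (auto intro: lspan_scale)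
qed

lemma algebraic_over_self: "x \<in> F \<Longrightarrow> algebraic_over F x"
  unfolding algebraic_over_def by (intro bexI[of _ "[:- x, 1:]"]) auto

lemma is_subfield_algebraics: "is_subfield {x. algebraic_over F x}"
proof (rule is_subfieldI)
  show "1 \<in> {x. algebraic_over F x}" using algebraic_over_self by simp
  have *: "x + y \<in> {x. algebraic_over F x} \<and> x * y \<in> {x. algebraic_over F x} \<and> - x \<in> {x. algebraic_over F x}"
    if xy: "x \<in> {x. algebraic_over F x}" "y \<in> {x. algebraic_over F x}" for x y
  proof -
    obtain Z where Z: "finite Z" "1 \<in> lspan F Z" "\<And>a z. a \<in> {x, y} \<Longrightarrow> z \<in> Z \<Longrightarrow> a * z \<in> lspan F Z"
      using stable_span_algebraic[of "{x, y}"] xy by (metis finite.emptyI finite.insertI insertE emptyE mem_Collect_eq)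
    have mult: "x * v \<in> lspan F Z" if "v \<in> lspan F Z" for v
      using that
    proof induction
      case (step c s v)
      have "c * (x * s) + x * v \<in> lspan F Z"
        using lspan_add[OF lspan_scale[OF step(1) Z(3)[OF _ step(2)]] step(4)] by simp
      then show ?case by (simp add: algebra_simps)
    qed (auto intro: lspan.zero)
    have "algebraic_over F (x + y)"
      using Z by (intro algebraic_overI_stable_span[of Z]) (auto simp: distrib_right intro: lspan_add)
    moreover have "algebraic_over F (x * y)"
      using Z mult by (intro algebraic_overI_stable_span[of Z]) (auto simp: mult.assoc)
    moreover have "algebraic_over F (- x)"
      using Z by (intro algebraic_overI_stable_span[of Z]) (auto intro: lspan_minus)
    ultimately show ?thesis by simp
  qed
  fix x y assume "x \<in> {x. algebraic_over F x}" "y \<in> {x. algebraic_over F x}"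
  from *[OF this] show "x + y \<in> {x. algebraic_over F x}" "x * y \<in> {x. algebraic_over F x}" by auto
next
  fix x assume x: "x \<in> {x. algebraic_over F x}"
  then obtain Z where Z: "finite Z" "1 \<in> lspan F Z" "\<And>z. z \<in> Z \<Longrightarrow> x * z \<in> lspan F Z"
    using stable_span_algebraic[of "{x}"] by auto
  show "- x \<in> {x. algebraic_over F x}"
    using Z by (auto intro!: algebraic_overI_stable_span[of Z] lspan_minus)
  show "inverse x \<in> {x. algebraic_over F x}"
  proof (cases "x = 0")
    case False
    obtain p where p: "p \<in> polys_over F" "p \<noteq> 0" "poly p x = 0"
      using x by (auto simp: algebraic_over_def)
    have "poly (reflect_poly p) (inverse x) = 0"
      using False p(3) by (simp add: poly_reflect_poly_nz)
    moreover have "reflect_poly p \<in> polys_over F"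
      using p(1) by (auto simp: polys_over_def coeff_reflect_poly)
    ultimately show ?thesis using p(2) by (auto simp: algebraic_over_def intro!: bexI[of _ "reflect_poly p"])
  qed (use x in simp)
qed

lemma algebraic_over_trans:
  assumes "algebraic_over {y. algebraic_over F y} x"
  shows "algebraic_over F x"
proof -
  interpret E: subfld "{y. algebraic_over F y}" using is_subfield_algebraics by unfold_locales
  obtain n e where e: "n > 0" "\<And>j. e j \<in> {y. algebraic_over F y}" "x ^ n = (\<Sum>j<n. e j * x ^ j)"
    using E.algebraic_overE_monic[OF assms] by blast
  then obtain Z where Z: "finite Z" "1 \<in> lspan F Z" "\<forall>a\<in>e ` {..<n}. \<forall>z\<in>Z. a * z \<in> lspan F Z"
    using stable_span_algebraic[of "e ` {..<n}"] by auto
  then have "\<exists>Z'. finite Z' \<and> 1 \<in> lspan F Z' \<and> (\<forall>a\<in>insert x {}. \<forall>z\<in>Z'. a * z \<in> lspan F Z')"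
    using e by (intro stable_span_insert[of Z]) auto
  then show ?thesis using algebraic_overI_stable_span by auto
qed

lemma adjoin_fraction:
  assumes "y \<in> adjoin F {b}"
  obtains p q where "p \<in> polys_over F" "q \<in> polys_over F" "poly q b \<noteq> 0" "y = poly p b / poly q b"
proof -
  define E where "E = {poly p b / poly q b | p q. p \<in> polys_over F \<and> q \<in> polys_over F \<and> poly q b \<noteq> 0}"
  have EI: "poly p b / poly q b \<in> E" if "p \<in> polys_over F" "q \<in> polys_over F" "poly q b \<noteq> 0" for p q
    using that by (auto simp: E_def)
  have EE: "\<exists>p\<in>polys_over F. \<exists>q\<in>polys_over F. poly q b \<noteq> 0 \<and> v = poly p b / poly q b" if "v \<in> E" for v
    using that by (auto simp: E_def)
  have "is_subfield E"
  proof (rule is_subfieldI)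
    show "1 \<in> E" using EI[of 1 1] by auto
    show "- u \<in> E" if u: "u \<in> E" for u
    proof -
      from EE[OF u] obtain p q where "p \<in> polys_over F" "q \<in> polys_over F" "poly q b \<noteq> 0" "u = poly p b / poly q b"
        by blast
      then show ?thesis using EI[of "- p" q] by auto
    qed
    show "inverse u \<in> E" if u: "u \<in> E" for u
    proof -
      from EE[OF u] obtain p q where pq: "p \<in> polys_over F" "q \<in> polys_over F" "poly q b \<noteq> 0" "u = poly p b / poly q b"
        by blast
      then show ?thesis using EI[of q p] u by (cases "poly p b = 0") auto
    qed
    fix u v assume "u \<in> E" "v \<in> E"
    then obtain p q p' q' where pq: "p \<in> polys_over F" "q \<in> polys_over F" "poly q b \<noteq> 0" "u = poly p b / poly q b"
      "p' \<in> polys_over F" "q' \<in> polys_over F" "poly q' b \<noteq> 0" "v = poly p' b / poly q' b"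
      using EE by meson
    have "u + v = poly (p * q' + p' * q) b / poly (q * q') b"
      unfolding pq(4,8) using pq(3,7) by (simp add: add_frac_eq)
    then show "u + v \<in> E" using pq EI[of "p * q' + p' * q" "q * q'"] by auto
    have "u * v = poly (p * p') b / poly (q * q') b" using pq by simp
    then show "u * v \<in> E" using pq EI[of "p * p'" "q * q'"] by auto
  qed
  moreover have "F \<subseteq> E"
  proof
    fix c assume "c \<in> F"
    then show "c \<in> E" using EI[of "[:c:]" 1] by auto
  qed
  moreover have "{b} \<subseteq> E" using EI[of "[:0, 1:]" 1] by auto
  ultimately have "adjoin F {b} \<subseteq> E" by (rule adjoin_least)
  then have "y \<in> E" using assms by (rule subsetD)
  from EE[OF this] show ?thesis using that by metis
qed

text \<open>A relation for \<open>x\<close> over \<open>F(b)\<close> is, after the denominators are cleared, a polynomial relation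
  between \<open>x\<close> and \<open>b\<close>.  Read as a polynomial in \<open>b\<close>, it has a coefficient that is a nonzero
  polynomial in \<open>x\<close>, which does not vanish as \<open>x\<close> is transcendental.\<close>

lemma algebraic_over_exchange:
  assumes x: "algebraic_over (adjoin F {b}) x" and nx: "\<not> algebraic_over F x"
  shows "algebraic_over (adjoin F {x}) b"
proof -
  obtain P where P: "P \<in> polys_over (adjoin F {b})" "P \<noteq> 0" "poly P x = 0"
    using x by (auto simp: algebraic_over_def)
  define n where "n = degree P"
  have "\<exists>p q. p \<in> polys_over F \<and> q \<in> polys_over F \<and> poly q b \<noteq> 0 \<and> coeff P i = poly p b / poly q b" for i
    using adjoin_fraction[OF polys_overD[OF P(1), of i]] by metis
  then obtain p q where pq: "\<And>i. p i \<in> polys_over F" "\<And>i. q i \<in> polys_over F"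
    "\<And>i. poly (q i) b \<noteq> 0" "\<And>i. coeff P i = poly (p i) b / poly (q i) b" by metis
  define r where "r i = p i * (\<Prod>j\<in>{..n} - {i}. q j)" for i
  define d where "d = (\<Prod>j\<le>n. poly (q j) b)"
  have d: "d \<noteq> 0" using pq(3) by (simp add: d_def)
  have r: "r i \<in> polys_over F" for i using pq by (auto simp: r_def)
  have rP: "poly (r i) b = d * coeff P i" if "i \<le> n" for i
    using that pq(3) by (simp add: r_def d_def pq(4) poly_prod prod.remove[of "{..n}" i])
  define S where "S = (\<Sum>i\<le>n. smult (x ^ i) (r i))"
  interpret E: subfld "adjoin F {x}" by (rule subfld_adjoin)
  have "S \<in> polys_over (adjoin F {x})"
    unfolding S_def using r polys_over_mono[OF adjoin_incl(1)[of F "{x}"]] adjoin_incl(2)[of "{x}" F]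
    by (intro E.polys_sum E.polys_smult E.pow) auto
  moreover have "poly S b = 0"
  proof -
    have "poly S b = (\<Sum>i\<le>n. d * (coeff P i * x ^ i))"
      by (simp add: S_def poly_sum rP mult_ac)
    also have "\<dots> = d * poly P x" by (simp add: poly_altdef n_def sum_distrib_left)
    finally show ?thesis using P(3) by simp
  qed
  moreover have "S \<noteq> 0"
  proof
    assume "S = 0"
    \<comment> \<open>The coefficient of \<open>S\<close> at \<open>k\<close> is a polynomial \<open>T\<close> in \<open>x\<close> whose top coefficient is that of \<open>r n\<close>.\<close>
    define k where "k = degree (r n)"
    define T where "T = (\<Sum>i\<le>n. monom (coeff (r i) k) i)"
    have "poly T x = coeff S k" by (simp add: T_def S_def poly_sum poly_monom coeff_sum mult.commute)
    then have "poly T x = 0" using \<open>S = 0\<close> by simp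
    moreover have "T \<in> polys_over F"
      unfolding T_def using polys_overD[OF r] by (intro polys_sum polys_monom) auto
    moreover have "coeff T n = lead_coeff (r n)" by (simp add: T_def coeff_sum k_def)
    moreover have "r n \<noteq> 0" using rP[of n] d P(2) by (auto simp: n_def)
    ultimately show False using nx by (auto simp: algebraic_over_def)
  qed
  ultimately show ?thesis by (auto simp: algebraic_over_def)
qed

end

definition acl :: "'a::field set \<Rightarrow> 'a set \<Rightarrow> 'a set" where
  "acl k A = {x. algebraic_over (adjoin k A) x}"

lemma algebraic_over_mono: "F \<subseteq> E \<Longrightarrow> algebraic_over F x \<Longrightarrow> algebraic_over E x"
  using polys_over_mono[of F E] by (auto simp: algebraic_over_def)

lemma acl_mono: "A \<subseteq> B \<Longrightarrow> acl k A \<subseteq> acl k B"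
  using algebraic_over_mono[OF adjoin_mono[of k k A B]] by (auto simp: acl_def)

lemma adjoin_subset_acl: "adjoin k A \<subseteq> acl k A"
  using subfld.algebraic_over_self[OF subfld_adjoin] by (auto simp: acl_def)

lemma acl_superset: "A \<subseteq> acl k A"
  using adjoin_subset_acl[of k A] adjoin_incl(2)[of A k] by blast

lemma acl_trans: 
  assumes "A \<subseteq> acl k B"
  shows "acl k A \<subseteq> acl k B"
proof -
  have "adjoin k A \<subseteq> acl k B"
    using assms adjoin_subset_acl[of k B] adjoin_incl(1)[of k B]
      subfld.is_subfield_algebraics[OF subfld_adjoin, of k B]
    by (intro adjoin_least) (auto simp: acl_def)
  then show ?thesis
    using algebraic_over_mono subfld.algebraic_over_trans[OF subfld_adjoin, of k B] unfolding acl_def by blast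
qed

lemma adjoin_insert: "adjoin k (insert b A) = adjoin (adjoin k A) {b}"
  by (simp add: adjoin_adjoin)

lemma acl_exchange: "x \<in> acl k (insert b A) \<Longrightarrow> x \<notin> acl k A \<Longrightarrow> b \<in> acl k (insert x A)"
  unfolding acl_def adjoin_insert[of k b A] adjoin_insert[of k x A] mem_Collect_eq
  by (rule subfld.algebraic_over_exchange[OF subfld_adjoin])

definition acl_indep :: "'a::field set \<Rightarrow> 'a set \<Rightarrow> bool" where
  "acl_indep k B \<longleftrightarrow> (\<forall>b\<in>B. b \<notin> acl k (B - {b}))"

text \<open>If \<open>x \<in> V\<close> is missing from \<open>B\<close>, a subset \<open>C \<supseteq> V \<inter> B\<close> of \<open>B\<close> that is maximal with \<open>x\<close> outside its
  closure shows which \<open>b \<in> B\<close> can be exchanged for \<open>x\<close>.\<close>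

lemma steinitz:
  assumes "finite V" "acl_indep k V" "finite B" "V \<subseteq> acl k B"
  shows "card V \<le> card B"
  using assms(3,4)
proof (induction "card (V - B)" arbitrary: B rule: less_induct)
  case less
  show ?case
  proof (cases "V \<subseteq> B")
    case True
    then show ?thesis by (rule card_mono[OF less.prems(1)])
  next
    case False
    then obtain x where x: "x \<in> V" "x \<notin> B" by blast
    define CC where "CC = {C. V \<inter> B \<subseteq> C \<and> C \<subseteq> B \<and> x \<notin> acl k C}"
    have "V \<inter> B \<subseteq> V - {x}" using x by auto
    then have "acl k (V \<inter> B) \<subseteq> acl k (V - {x})" by (rule acl_mono)
    then have "x \<notin> acl k (V \<inter> B)" using assms(2) x by (auto simp: acl_indep_def)
    then have "V \<inter> B \<in> CC" by (auto simp: CC_def)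
    moreover have "finite CC" using less.prems(1) by (intro finite_subset[of CC "Pow B"]) (auto simp: CC_def)
    ultimately obtain C where C: "C \<in> CC" "\<And>D. D \<in> CC \<Longrightarrow> C \<subseteq> D \<Longrightarrow> C = D"
      using finite_has_maximal[of CC] by blast
    have "C \<noteq> B" using C(1) x less.prems by (auto simp: CC_def)
    then obtain b where b: "b \<in> B" "b \<notin> C" using C(1) by (auto simp: CC_def)
    have "insert b C \<notin> CC" using C(2)[of "insert b C"] b by auto
    then have "x \<in> acl k (insert b C)" using C(1) b by (auto simp: CC_def)
    then have bC: "b \<in> acl k (insert x C)" using C(1) acl_exchange by (auto simp: CC_def)
    define B' where "B' = insert x (B - {b})"
    have "insert x C \<subseteq> B'" using C(1) b by (auto simp: B'_def CC_def)
    then have "b \<in> acl k B'" using bC acl_mono by blast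
    then have "B \<subseteq> acl k B'" using acl_superset[of B' k] by (auto simp: B'_def)
    then have "V \<subseteq> acl k B'" using less.prems(2) acl_trans by blast
    moreover have "b \<notin> V" using b C(1) by (auto simp: CC_def)
    then have "V - B' \<subset> V - B" using x by (auto simp: B'_def)
    then have "card (V - B') < card (V - B)" using assms(1) by (intro psubset_card_mono) auto
    ultimately have "card V \<le> card B'" using less.hyps less.prems(1) by (simp add: B'_def)
    also have "card B' = Suc (card (B - {b}))" using x less.prems(1) by (simp add: B'_def)
    also have "\<dots> = card B" using b(1) less.prems(1) by (rule card_Suc_Diff1[rotated])
    finally show ?thesis .
  qed
qed

text \<open>A redundant generator could be removed, leaving fewer generators than the transcendence degree.
  In this form independence of explicit generators need never be checked; it is enough to count them.\<close>

lemma generators_acl_indep: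
  assumes "finite V" "acl_indep k V" "finite B" "V \<subseteq> acl k B" "card B \<le> card V"
  shows "card B = card V" "acl_indep k B"
proof -
  show "card B = card V" using steinitz[OF assms(1-4)] assms(5) by simp
  show "acl_indep k B"
    unfolding acl_indep_def
  proof safe
    fix b assume b: "b \<in> B" "b \<in> acl k (B - {b})"
    then have "B \<subseteq> acl k (B - {b})" using acl_superset[of "B - {b}" k] by auto
    then have "V \<subseteq> acl k (B - {b})" using acl_trans assms(4) by blast
    then have "card V \<le> card (B - {b})" using steinitz[OF assms(1,2)] assms(3) by simp
    also have "\<dots> < card B" using b(1) assms(3) by (intro psubset_card_mono) auto
    finally show False using assms(5) by simp
  qed
qed

lemma transcendental_coeffs_0:
  assumes "x \<notin> acl k A" "p \<in> polys_over (adjoin k A)" "poly p x = 0"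
  shows "p = 0"
  using assms by (auto simp: acl_def algebraic_over_def)

text \<open>A polynomial relation is read as a polynomial in one of the variables \<open>b\<close>.  Its coefficients vanish
  because \<open>b\<close> is transcendental over the others, and they involve one variable less.\<close>

lemma monomials_independent:
  fixes e :: "'m \<Rightarrow> 'a::field \<Rightarrow> nat"
  assumes "finite B" "acl_indep k B" "finite M" "\<And>m. m \<in> M \<Longrightarrow> c m \<in> k"
    and "\<And>m n. m \<in> M \<Longrightarrow> n \<in> M \<Longrightarrow> (\<And>b. b \<in> B \<Longrightarrow> e m b = e n b) \<Longrightarrow> m = n"
    and "(\<Sum>m\<in>M. c m * (\<Prod>b\<in>B. b ^ e m b)) = 0"
  shows "\<forall>m\<in>M. c m = 0"
  using assms
proof (induction B arbitrary: M rule: finite_induct)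
  case empty
  show ?case
  proof
    fix m assume "m \<in> M"
    then have "M = {m}" using empty.prems(4) by auto
    then show "c m = 0" using empty.prems(5) by simp
  qed
next
  case (insert b B)
  define q where "q j = (\<Sum>m | m \<in> M \<and> e m b = j. c m * (\<Prod>b\<in>B. b ^ e m b))" for j
  define N where "N = (\<lambda>m. e m b) ` M"
  define p where "p = (\<Sum>j\<in>N. monom (q j) j)"
  interpret E: subfld "adjoin k B" by (rule subfld_adjoin)
  have "finite N" using insert.prems by (simp add: N_def)
  have "q j \<in> adjoin k B" for j
    unfolding q_def using insert.prems(3) adjoin_incl(1)[of k B] adjoin_incl(2)[of B k]
    by (intro E.sum E.mult E.prod E.pow) auto
  then have "p \<in> polys_over (adjoin k B)" unfolding p_def by auto
  moreover have "poly p b = 0"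
  proof -
    have "0 = (\<Sum>m\<in>M. c m * (\<Prod>b\<in>B. b ^ e m b) * b ^ e m b)"
      using insert.prems(5) insert.hyps by (simp add: mult_ac)
    also have "\<dots> = (\<Sum>j\<in>N. \<Sum>m | m \<in> M \<and> e m b = j. c m * (\<Prod>b\<in>B. b ^ e m b) * b ^ e m b)"
      unfolding N_def using insert.prems(2) by (rule sum.image_gen)
    also have "\<dots> = poly p b"
      by (simp add: p_def q_def poly_sum poly_monom sum_distrib_right)
    finally show ?thesis by simp
  qed
  moreover have "b \<notin> acl k B" using insert.prems(1) insert.hyps by (simp add: acl_indep_def)
  ultimately have p0: "p = 0" using transcendental_coeffs_0 by blast
  have q0: "q j = 0" if "j \<in> N" for j
  proof -
    have "coeff p j = q j" using that \<open>finite N\<close> by (simp add: p_def coeff_sum)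
    then show ?thesis using p0 by simp
  qed
  have ind: "acl_indep k B"
    unfolding acl_indep_def
  proof safe
    fix x assume x: "x \<in> B" "x \<in> acl k (B - {x})"
    then show False using insert.prems(1) insert.hyps acl_mono[of "B - {x}" "insert b B - {x}" k]
      by (auto simp: acl_indep_def)
  qed
  show ?case
  proof
    fix m assume m: "m \<in> M"
    have "\<forall>m'\<in>{m' \<in> M. e m' b = e m b}. c m' = 0"
    proof (rule insert.IH[OF ind])
      show "m' = n" if "m' \<in> {m' \<in> M. e m' b = e m b}" "n \<in> {m' \<in> M. e m' b = e m b}"
        "\<And>b. b \<in> B \<Longrightarrow> e m' b = e n b" for m' n
        using that by (intro insert.prems(4)) auto
    qed (use insert.prems(2,3) q0[of "e m b"] m in \<open>auto simp: q_def N_def\<close>)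
    then show "c m = 0" using m by simp
  qed
qed

lemma acl_indep_imp_alg_independent:
  assumes "finite B" "acl_indep k B"
  shows "alg_independent k B"
  unfolding alg_independent_def
proof (intro allI impI)
  fix p :: "('a \<Rightarrow>\<^sub>0 nat) \<Rightarrow>\<^sub>0 'a"
  assume p: "\<forall>m\<in>keys p. lookup p m \<in> k \<and> keys m \<subseteq> B" "poly_eval id id p = 0"
  have mon: "(\<Prod>i\<in>keys m. i ^ lookup m i) = (\<Prod>i\<in>B. i ^ lookup m i)" if "m \<in> keys p" for m
    using p(1) that assms(1) by (intro prod.mono_neutral_left) (auto simp: in_keys_iff)
  have "\<forall>m\<in>keys p. lookup p m = 0"
  proof (rule monomials_independent[OF assms])
    show "m = n" if "m \<in> keys p" "n \<in> keys p" "\<And>b. b \<in> B \<Longrightarrow> lookup m b = lookup n b" for m n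
    proof (rule poly_mapping_eqI)
      fix i
      show "lookup m i = lookup n i"
        using that(3)[of i] that(1,2) p(1) by (cases "i \<in> B") (simp, metis in_keys_iff subsetD)
    qed
    show "(\<Sum>m\<in>keys p. lookup p m * (\<Prod>b\<in>B. b ^ lookup m b)) = 0"
      using p(2) by (simp add: poly_eval_def mon)
  qed (use p(1) in auto)
  then show "p = 0" by (metis in_keys_iff lookup_zero poly_mapping_eqI)
qed

section \<open>The variables of a rational function field\<close>

definition ratfun_rename :: "('i \<Rightarrow> 'j) \<Rightarrow> ('i, 'k::field) ratfun \<Rightarrow> ('j, 'k) ratfun" where
  "ratfun_rename \<pi> = fract_map (mpoly_rename \<pi>)"

lemma ratfun_rename_Fract:
  assumes "inj \<pi>" "q \<noteq> 0"
  shows "ratfun_rename \<pi> (Fract p q) = Fract (mpoly_rename \<pi> p) (mpoly_rename \<pi> q)"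
    and "mpoly_rename \<pi> q \<noteq> 0"
proof -
  note inj = inj_mpoly_rename[OF assms(1)]
  show "ratfun_rename \<pi> (Fract p q) = Fract (mpoly_rename \<pi> p) (mpoly_rename \<pi> q)"
    unfolding ratfun_rename_def by (rule fract_map_Fract[OF inj _ _ assms(2)]) (simp_all add: mpoly_rename_mult)
  show "mpoly_rename \<pi> q \<noteq> 0"
    using assms(2) injD[OF inj, of q 0] by auto
qed

lemma ratfun_rename_endo:
  assumes "inj \<pi>"
  shows "field_endo (ratfun_rename \<pi> :: ('i, 'k::field) ratfun \<Rightarrow> _)"
proof -
  note ren = ratfun_rename_Fract[OF assms]
  have "ratfun_rename \<pi> (1 :: ('i, 'k) ratfun) = 1"
    using ren(1)[of 1 1] by (simp add: One_fract_def)
  moreover have "ratfun_rename \<pi> (f + g) = ratfun_rename \<pi> f + ratfun_rename \<pi> g"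
    "ratfun_rename \<pi> (f * g) = ratfun_rename \<pi> f * ratfun_rename \<pi> g" for f g :: "('i, 'k) ratfun"
  proof -
    obtain p q where f: "f = Fract p q" "q \<noteq> 0" by (cases f)
    obtain r s where g: "g = Fract r s" "s \<noteq> 0" by (cases g)
    have "q * s \<noteq> 0" using f g by simp
    note r = ren[OF f(2)] ren[OF g(2)] ren[OF this]
    show "ratfun_rename \<pi> (f + g) = ratfun_rename \<pi> f + ratfun_rename \<pi> g"
      unfolding f(1) g(1) add_fract[OF f(2) g(2)] r(1,3,5) add_fract[OF r(2,4)]
      by (simp only: mpoly_rename_add mpoly_rename_mult)
    show "ratfun_rename \<pi> (f * g) = ratfun_rename \<pi> f * ratfun_rename \<pi> g"
      unfolding f(1) g(1) mult_fract r(1,3,5) by (simp only: mpoly_rename_mult)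
  qed
  ultimately show ?thesis by (simp add: field_endo_def)
qed

lemma ratfun_rename_const:
  assumes "inj \<pi>"
  shows "ratfun_rename \<pi> (ratfun_const c) = ratfun_const c"
  unfolding ratfun_const_def ratfun_rename_Fract(1)[OF assms one_neq_zero] mpoly_rename_const mpoly_rename_1 ..

lemma ratfun_rename_var:
  assumes "inj \<pi>"
  shows "ratfun_rename \<pi> (ratfun_var i) = ratfun_var (\<pi> i)"
  unfolding ratfun_var_def ratfun_rename_Fract(1)[OF assms one_neq_zero] mpoly_rename_var mpoly_rename_1 ..

lemma ratfun_rename_rename:
  assumes "inj \<pi>" "inj \<rho>"
  shows "ratfun_rename \<rho> (ratfun_rename \<pi> f) = ratfun_rename (\<rho> \<circ> \<pi>) f"
proof -
  obtain p q where f: "f = Fract p q" "q \<noteq> 0" by (cases f)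
  have "inj (\<rho> \<circ> \<pi>)" using assms by (simp add: inj_compose)
  then show ?thesis
    using ratfun_rename_Fract[OF assms(1) f(2)] assms(2) f
    by (simp add: ratfun_rename_Fract mpoly_rename_rename)
qed

lemma ratfun_rename_id: "ratfun_rename id f = f"
proof -
  obtain p q where f: "f = Fract p q" "q \<noteq> 0" by (cases f)
  then show ?thesis by (simp add: ratfun_rename_Fract mpoly_rename_id)
qed

lemma ratfun_const_hom:
  "ratfun_const 1 = 1" "ratfun_const 0 = 0"
  "ratfun_const (a + b) = ratfun_const a + ratfun_const b"
  "ratfun_const (a * b) = ratfun_const a * ratfun_const b"
  by (simp_all add: ratfun_const_def One_fract_def one_mpoly_def[symmetric] Zero_fract_def
      zero_mpoly_def[symmetric] single_add plus_mpoly.abs_eq times_mpoly.abs_eq mult_single)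

lemma ratfun_const_uminus: "ratfun_const (- a) = - ratfun_const a"
  using ratfun_const_hom(3)[of a "- a"] by (simp add: ratfun_const_hom(2) eq_neg_iff_add_eq_0 add.commute)

lemma ratfun_const_eq_0_iff: "ratfun_const a = (0 :: ('i, 'k::field) ratfun) \<longleftrightarrow> a = 0"
proof
  assume "ratfun_const a = (0 :: ('i, 'k) ratfun)"
  then have "ratfun_const (a * inverse a) = (0 :: ('i, 'k) ratfun)" by (simp add: ratfun_const_hom(4))
  then show "a = 0" by (cases "a = 0") (simp_all add: ratfun_const_hom(1))
qed (simp add: ratfun_const_hom)

lemma ratfun_const_diff: "ratfun_const (a - b) = ratfun_const a - ratfun_const b"
  using ratfun_const_hom(3)[of a "- b"] by (simp add: ratfun_const_uminus)

lemma inj_ratfun_const: "inj (ratfun_const :: 'k \<Rightarrow> ('i, 'k::field) ratfun)"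
proof (rule injI)
  fix a b :: 'k assume "ratfun_const a = (ratfun_const b :: ('i, 'k) ratfun)"
  then have "ratfun_const (a - b) = (0 :: ('i, 'k) ratfun)" by (simp add: ratfun_const_diff)
  then show "a = b" by (simp add: ratfun_const_eq_0_iff)
qed

lemma ratfun_const_inverse:
  "ratfun_const (inverse a) = (inverse (ratfun_const a) :: ('i, 'k::field) ratfun)"
proof (cases "a = 0")
  case False
  then have "ratfun_const a * ratfun_const (inverse a) = (1 :: ('i, 'k) ratfun)"
    by (simp flip: ratfun_const_hom)
  then show ?thesis using inverse_unique by metis
qed (simp add: ratfun_const_hom)

lemma is_subfield_constants: "is_subfield (range ratfun_const)"
  by (rule is_subfieldI) (auto simp flip: ratfun_const_hom ratfun_const_uminus ratfun_const_inverse)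

lemma ratfun_var_inject: "ratfun_var i = (ratfun_var j :: ('i, 'k::field) ratfun) \<longleftrightarrow> i = j"
proof
  assume "ratfun_var i = (ratfun_var j :: ('i, 'k) ratfun)"
  then have "Poly_Mapping.single (Poly_Mapping.single i 1) (1 :: 'k) = Poly_Mapping.single (Poly_Mapping.single j (1 :: nat)) 1"
    by (simp add: ratfun_var_def eq_fract MPoly_inject)
  then have "Poly_Mapping.single i (1 :: nat) = Poly_Mapping.single j 1"
    by (metis lookup_single_eq lookup_single_not_eq one_neq_zero)
  then show "i = j" by (metis lookup_single_eq lookup_single_not_eq one_neq_zero)
qed simp

text \<open>If \<open>x\<^sub>i\<close> were a root of a polynomial over the field of the other variables, then exchanging \<open>i\<close>
  for indices that do not occur there would give infinitely many roots.\<close>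

lemma ratfun_vars_acl_indep:
  fixes V :: "'i set"
  assumes "infinite (UNIV :: 'i set)" "finite V"
  shows "acl_indep (range ratfun_const) (ratfun_var ` V :: ('i, 'k::field) ratfun set)"
  unfolding acl_indep_def
proof safe
  fix i assume i: "i \<in> V"
  let ?k = "range ratfun_const :: ('i, 'k) ratfun set" and ?x = "ratfun_var :: 'i \<Rightarrow> ('i, 'k) ratfun"
  assume "?x i \<in> acl ?k (?x ` V - {?x i})"
  then obtain p where p: "p \<in> polys_over (adjoin ?k (?x ` V - {?x i}))" "p \<noteq> 0" "poly p (?x i) = 0"
    by (auto simp: acl_def algebraic_over_def)
  have "poly p (?x j) = 0" if j: "j \<notin> V" for j
  proof -
    define \<pi> where "\<pi> v = (if v = i then j else if v = j then i else v)" for v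
    have inj_pi: "inj \<pi>" by (rule injI) (auto simp: \<pi>_def split: if_splits)
    interpret endo "ratfun_rename \<pi> :: ('i, 'k) ratfun \<Rightarrow> ('i, 'k) ratfun"
      using ratfun_rename_endo[OF inj_pi] by unfold_locales
    have "adjoin ?k (?x ` V - {?x i}) \<subseteq> fixed_field {ratfun_rename \<pi>}"
    proof (rule adjoin_least)
      show "is_subfield (fixed_field {ratfun_rename \<pi> :: ('i, 'k) ratfun \<Rightarrow> ('i, 'k) ratfun})"
        using endo by (intro fixed_field_is_subfield) simp
      show "?k \<subseteq> fixed_field {ratfun_rename \<pi>}"
        by (auto simp: fixed_field_def ratfun_rename_const[OF inj_pi])
      show "?x ` V - {?x i} \<subseteq> fixed_field {ratfun_rename \<pi>}"
        using j by (auto simp: fixed_field_def ratfun_rename_var[OF inj_pi] \<pi>_def)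
    qed
    then have "ratfun_rename \<pi> (coeff p m) = coeff p m" for m
      using polys_overD[OF p(1), of m] by (auto simp: fixed_field_def)
    from poly_fixed[of p, OF this, of "?x i"] show ?thesis
      using p(3) by (simp add: ratfun_rename_var[OF inj_pi] \<pi>_def)
  qed
  then have "?x ` (- V) \<subseteq> {z. poly p z = 0}" by auto
  then have "finite (?x ` (- V))" using poly_roots_finite[OF p(2)] finite_subset by blast
  then have "finite (- V)" by (rule finite_imageD) (auto simp: inj_on_def ratfun_var_inject)
  then show False using assms finite_compl by blast
qed

lemma translation_rename:
  assumes "group G" "h \<in> carrier G"
  shows "translation G h = ratfun_rename (\<lambda>g. if g \<in> carrier G then h \<otimes>\<^bsub>G\<^esub> g else g)"
    and "inj (\<lambda>g. if g \<in> carrier G then h \<otimes>\<^bsub>G\<^esub> g else g)"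
proof -
  interpret group G by fact
  show "translation G h = ratfun_rename (\<lambda>g. if g \<in> carrier G then h \<otimes>\<^bsub>G\<^esub> g else g)"
    by (simp add: translation_def ratfun_rename_def)
  show "inj (\<lambda>g. if g \<in> carrier G then h \<otimes>\<^bsub>G\<^esub> g else g)"
  proof (rule injI)
    fix x y assume "(if x \<in> carrier G then h \<otimes>\<^bsub>G\<^esub> x else x) = (if y \<in> carrier G then h \<otimes>\<^bsub>G\<^esub> y else y)"
    then show "x = y"
      using assms(2) m_closed[OF assms(2), of x] m_closed[OF assms(2), of y]
      by (auto split: if_splits)
  qed
qed

lemma translation_endo: "group G \<Longrightarrow> h \<in> carrier G \<Longrightarrow> field_endo (translation G h)"
  by (simp only: translation_rename ratfun_rename_endo)

lemma translation_comp:
  assumes "group G" "h \<in> carrier G" "h' \<in> carrier G"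
  shows "translation G h (translation G h' f) = translation G (h \<otimes>\<^bsub>G\<^esub> h') f"
proof -
  interpret group G by fact
  define \<pi> where "\<pi> = (\<lambda>h g. if g \<in> carrier G then h \<otimes>\<^bsub>G\<^esub> g else g)"
  have tr: "translation G h = ratfun_rename (\<pi> h)" "inj (\<pi> h)" if "h \<in> carrier G" for h
    unfolding \<pi>_def by (rule translation_rename[OF assms(1) that])+
  have "\<pi> h \<circ> \<pi> h' = \<pi> (h \<otimes>\<^bsub>G\<^esub> h')"
    using assms(2,3) by (auto simp: fun_eq_iff m_assoc \<pi>_def)
  then show ?thesis
    by (simp only: tr assms m_closed ratfun_rename_rename)
qed

lemma translation_one: "group G \<Longrightarrow> translation G \<one>\<^bsub>G\<^esub> f = f"
proof -
  assume "group G"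
  then interpret group G .
  have "(\<lambda>g. if g \<in> carrier G then \<one>\<^bsub>G\<^esub> \<otimes>\<^bsub>G\<^esub> g else g) = id" by (auto simp: fun_eq_iff)
  then show ?thesis
    by (simp only: translation_rename(1)[OF \<open>group G\<close> one_closed] ratfun_rename_id)
qed

section \<open>Evaluating words in a monoid\<close>

definition word_value :: "('s \<times> bool \<Rightarrow> 'm::monoid_mult) \<Rightarrow> 's word \<Rightarrow> 'm" where
  "word_value \<phi> w = prod_list (map \<phi> w)"

lemma word_value_append: "word_value \<phi> (u @ v) = word_value \<phi> u * word_value \<phi> v"
  by (simp add: word_value_def)

lemma word_value_gen: "word_value \<phi> (gen s) = \<phi> (s, True)"
  by (simp add: word_value_def gen_def)

lemma word_value_inv_gen: "word_value \<phi> (word_inv (gen s)) = \<phi> (s, False)"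
  by (simp add: word_value_def gen_def word_inv_def)

lemma word_value_pow:
  "word_value \<phi> (word_pow w i) = (if i < 0 then word_value \<phi> (word_inv w) else word_value \<phi> w) ^ nat \<bar>i\<bar>"
proof -
  have "word_value \<phi> (concat (replicate n v)) = word_value \<phi> v ^ n" for n v
    by (induction n) (auto simp: word_value_append, simp add: word_value_def)
  then show ?thesis by (simp add: word_pow_def)
qed

lemma word_value_cong:
  assumes inv: "\<And>s b. s \<in> S \<Longrightarrow> \<phi> (s, b) * \<phi> (s, \<not> b) = 1"
    and rel: "\<And>u v. (u, v) \<in> R \<Longrightarrow> word_value \<phi> u = word_value \<phi> v"
    and "word_eq S R u v"
  shows "word_value \<phi> u = word_value \<phi> v"
  using assms(3)
proof induction
  case (cancel s b)
  then show ?case using inv[of s b] by (simp add: word_value_def)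
qed (auto simp: word_value_append rel)

definition word_class :: "'s set \<Rightarrow> ('s word \<times> 's word) set \<Rightarrow> 's word \<Rightarrow> 's word set" where
  "word_class S R u = {w. word_eq S R u w}"

lemma word_class_eqI:
  assumes "word_eq S R u v"
  shows "word_class S R u = word_class S R v"
proof (rule Set.set_eqI)
  fix w
  show "w \<in> word_class S R u \<longleftrightarrow> w \<in> word_class S R v"
    unfolding word_class_def mem_Collect_eq
    using word_eq.trans[OF assms] word_eq.trans[OF word_eq.sym[OF assms]] by iprover
qed

lemma word_class_self: "u \<in> lists (S \<times> UNIV) \<Longrightarrow> u \<in> word_class S R u"
  by (simp add: word_class_def word_eq.refl)

lemma presented_group_carrier: "carrier (presented_group S R) = word_class S R ` lists (S \<times> UNIV)"
  by (auto simp: presented_group_def quotient_def word_class_def)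

lemma presented_group_one: "\<one>\<^bsub>presented_group S R\<^esub> = word_class S R []"
  by (simp add: presented_group_def word_class_def)

lemma presented_group_mult:
  assumes "u \<in> lists (S \<times> UNIV)" "v \<in> lists (S \<times> UNIV)"
  shows "word_class S R u \<otimes>\<^bsub>presented_group S R\<^esub> word_class S R v = word_class S R (u @ v)"
proof (rule Set.set_eqI)
  fix w
  show "w \<in> word_class S R u \<otimes>\<^bsub>presented_group S R\<^esub> word_class S R v \<longleftrightarrow> w \<in> word_class S R (u @ v)"
  proof
    assume "w \<in> word_class S R (u @ v)"
    then show "w \<in> word_class S R u \<otimes>\<^bsub>presented_group S R\<^esub> word_class S R v"
      using word_class_self[OF assms(1)] word_class_self[OF assms(2)]
      by (auto simp: presented_group_def word_class_def)
  next
    assume "w \<in> word_class S R u \<otimes>\<^bsub>presented_group S R\<^esub> word_class S R v"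
    then obtain u' v' where *: "word_eq S R u u'" "word_eq S R v v'" "word_eq S R (u' @ v') w"
      by (auto simp: presented_group_def word_class_def)
    show "w \<in> word_class S R (u @ v)"
      using word_eq.trans[OF word_eq.append[OF *(1,2)] *(3)] by (simp add: word_class_def)
  qed
qed

text \<open>The homomorphism from the presented group that is given by the values of the letters.\<close>

definition class_value :: "('s \<times> bool \<Rightarrow> 'm::monoid_mult) \<Rightarrow> 's word set \<Rightarrow> 'm" where
  "class_value \<phi> A = word_value \<phi> (SOME w. w \<in> A)"

lemma class_value_class:
  assumes "\<And>s b. s \<in> S \<Longrightarrow> \<phi> (s, b) * \<phi> (s, \<not> b) = 1"
    and "\<And>u v. (u, v) \<in> R \<Longrightarrow> word_value \<phi> u = word_value \<phi> v"
    and "u \<in> lists (S \<times> UNIV)"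
  shows "class_value \<phi> (word_class S R u) = word_value \<phi> u"
proof -
  have "(SOME w. w \<in> word_class S R u) \<in> word_class S R u"
    using word_class_self[OF assms(3)] by (rule someI)
  then have "word_eq S R u (SOME w. w \<in> word_class S R u)" by (simp add: word_class_def)
  from word_value_cong[OF assms(1,2) this] show ?thesis by (simp add: class_value_def)
qed

lemma class_value_mult:
  assumes "\<And>s b. s \<in> S \<Longrightarrow> \<phi> (s, b) * \<phi> (s, \<not> b) = 1"
    and "\<And>u v. (u, v) \<in> R \<Longrightarrow> word_value \<phi> u = word_value \<phi> v"
    and "A \<in> carrier (presented_group S R)" "B \<in> carrier (presented_group S R)"
  shows "class_value \<phi> (A \<otimes>\<^bsub>presented_group S R\<^esub> B) = class_value \<phi> A * class_value \<phi> B"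
proof -
  from assms(3,4) obtain u v where uv: "u \<in> lists (S \<times> UNIV)" "A = word_class S R u"
    "v \<in> lists (S \<times> UNIV)" "B = word_class S R v" by (auto simp: presented_group_carrier)
  then have "u @ v \<in> lists (S \<times> UNIV)" by (simp add: lists_eq_set)
  then show ?thesis
    using uv by (simp only: presented_group_mult class_value_class[OF assms(1,2)] word_value_append)
qed

context
  fixes S :: "'s set" and R :: "('s word \<times> 's word) set"
begin

interpretation P: group "presented_group S R" by (rule presented_group_is_group)

lemma word_class_closed: "u \<in> lists (S \<times> UNIV) \<Longrightarrow> word_class S R u \<in> carrier (presented_group S R)"
  by (simp add: presented_group_carrier)

lemma gen_in_lists: "s \<in> S \<Longrightarrow> gen s \<in> lists (S \<times> UNIV)"
  by (simp add: gen_def)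

lemma word_class_inv:
  assumes "u \<in> lists (S \<times> UNIV)"
  shows "word_class S R (word_inv u) = inv\<^bsub>presented_group S R\<^esub> (word_class S R u)"
proof -
  have "word_class S R (word_inv u) \<otimes>\<^bsub>presented_group S R\<^esub> word_class S R u = \<one>\<^bsub>presented_group S R\<^esub>"
    using word_class_eqI[OF word_inv_left[OF assms, of R]] assms word_inv_in_lists[OF assms]
    by (simp add: presented_group_mult presented_group_one)
  then show ?thesis
    using P.inv_equality word_class_closed assms word_inv_in_lists[OF assms] by metis
qed

lemma word_class_replicate:
  assumes "u \<in> lists (S \<times> UNIV)"
  shows "concat (replicate n u) \<in> lists (S \<times> UNIV) \<and>
    word_class S R (concat (replicate n u)) = word_class S R u [^]\<^bsub>presented_group S R\<^esub> n"
proof (induction n)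
  case (Suc n)
  then have *: "concat (replicate n u) \<in> lists (S \<times> UNIV)"
    "word_class S R (concat (replicate n u)) = word_class S R u [^]\<^bsub>presented_group S R\<^esub> n" by auto
  have "u @ concat (replicate n u) \<in> lists (S \<times> UNIV)" using * assms by (simp add: lists_eq_set)
  moreover have "word_class S R (u @ concat (replicate n u)) =
      word_class S R u [^]\<^bsub>presented_group S R\<^esub> Suc n"
    unfolding presented_group_mult[OF assms *(1), symmetric] *(2)
    by (rule P.nat_pow_Suc2[OF word_class_closed[OF assms], symmetric])
  ultimately show ?case by simp
qed (simp add: presented_group_one)

lemma word_class_pow_nat:
  assumes "u \<in> lists (S \<times> UNIV)"
  shows "word_class S R (word_pow u (int n)) = word_class S R u [^]\<^bsub>presented_group S R\<^esub> n"
  using word_class_replicate[OF assms] by (simp add: word_pow_def)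

lemma word_class_relation:
  "(u, v) \<in> R \<Longrightarrow> u \<in> lists (S \<times> UNIV) \<Longrightarrow> v \<in> lists (S \<times> UNIV) \<Longrightarrow> word_class S R u = word_class S R v"
  by (rule word_class_eqI) (rule word_eq.relation)

text \<open>Every element of the group is a product of letters, so a set of elements that contains \<open>\<one>\<close> and
  is closed under multiplication by the letters from the left is everything.\<close>

lemma presented_group_induct:
  assumes "A \<in> carrier (presented_group S R)" "\<one>\<^bsub>presented_group S R\<^esub> \<in> H"
    and "\<And>s h. s \<in> S \<Longrightarrow> h \<in> H \<Longrightarrow> h \<in> carrier (presented_group S R) \<Longrightarrow>
      word_class S R (gen s) \<otimes>\<^bsub>presented_group S R\<^esub> h \<in> H"
    and "\<And>s h. s \<in> S \<Longrightarrow> h \<in> H \<Longrightarrow> h \<in> carrier (presented_group S R) \<Longrightarrow>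
      inv\<^bsub>presented_group S R\<^esub> (word_class S R (gen s)) \<otimes>\<^bsub>presented_group S R\<^esub> h \<in> H"
  shows "A \<in> H"
proof -
  from assms(1) obtain u where u: "u \<in> lists (S \<times> UNIV)" "A = word_class S R u"
    by (auto simp: presented_group_carrier)
  have "word_class S R u \<in> H" using u(1)
  proof (induction u rule: list.induct)
    case Nil
    then show ?case using assms(2) by (simp add: presented_group_one)
  next
    case (Cons x u)
    obtain s b where x: "x = (s, b)" by (cases x)
    have s: "s \<in> S" "u \<in> lists (S \<times> UNIV)" using Cons.prems by (auto simp: x)
    have "word_class S R (x # u) = word_class S R [x] \<otimes>\<^bsub>presented_group S R\<^esub> word_class S R u"
      using s by (simp add: presented_group_mult x)
    moreover have "word_class S R [x] = (if b then word_class S R (gen s) else inv\<^bsub>presented_group S R\<^esub> (word_class S R (gen s)))"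
    proof (cases b)
      case False
      have "[x] = word_inv (gen s)" using False by (simp add: x word_inv_def gen_def)
      then show ?thesis using False word_class_inv[OF gen_in_lists[OF s(1)]] by simp
    qed (simp add: x gen_def)
    ultimately show ?case using assms(3,4) s Cons.IH word_class_closed by simp
  qed
  then show ?thesis using u by simp
qed

end

section \<open>Two by two matrices\<close>

datatype 'k mat2 = Mat2 (m11: 'k) (m12: 'k) (m21: 'k) (m22: 'k)

instantiation mat2 :: (comm_ring_1) monoid_mult
begin

definition one_mat2 :: "'a mat2" where "one_mat2 = Mat2 1 0 0 1"

definition times_mat2 :: "'a mat2 \<Rightarrow> 'a mat2 \<Rightarrow> 'a mat2" where
  "A * B = Mat2 (m11 A * m11 B + m12 A * m21 B) (m11 A * m12 B + m12 A * m22 B)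
     (m21 A * m11 B + m22 A * m21 B) (m21 A * m12 B + m22 A * m22 B)"

instance
  by standard (simp_all add: one_mat2_def times_mat2_def algebra_simps)

end

lemma mat2_sel [simp]:
  fixes A B :: "'a::comm_ring_1 mat2"
  shows "m11 (A * B) = m11 A * m11 B + m12 A * m21 B" "m12 (A * B) = m11 A * m12 B + m12 A * m22 B"
    "m21 (A * B) = m21 A * m11 B + m22 A * m21 B" "m22 (A * B) = m21 A * m12 B + m22 A * m22 B"
    "m11 (1 :: 'a mat2) = 1" "m12 (1 :: 'a mat2) = 0" "m21 (1 :: 'a mat2) = 0" "m22 (1 :: 'a mat2) = 1"
  by (simp_all add: times_mat2_def one_mat2_def)

lemma mat2_eqI:
  "m11 A = m11 B \<Longrightarrow> m12 A = m12 B \<Longrightarrow> m21 A = m21 B \<Longrightarrow> m22 A = m22 B \<Longrightarrow> A = B"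
  by (rule mat2.expand) simp

lemma diag_pow: "Mat2 x 0 0 y ^ n = (Mat2 (x ^ n) 0 0 (y ^ n) :: 'a::comm_ring_1 mat2)"
  by (induction n) (auto intro!: mat2_eqI)

section \<open>A normal form\<close>

context group
begin

lemma pow_commute:
  assumes "x \<in> carrier G" "y \<in> carrier G" "z \<in> carrier G" "x \<otimes> y = z \<otimes> x"
  shows "x \<otimes> y [^] (i::nat) = z [^] i \<otimes> x"
proof (induction i)
  case (Suc i)
  have "x \<otimes> y [^] Suc i = (x \<otimes> y [^] i) \<otimes> y" using assms by (simp add: m_assoc)
  also have "\<dots> = z [^] i \<otimes> (x \<otimes> y)" using assms Suc by (simp add: m_assoc)
  also have "\<dots> = z [^] Suc i \<otimes> x" using assms by (simp add: m_assoc)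
  finally show ?case .
qed (use assms in simp)

lemma left_mult_pow:
  assumes "x \<in> carrier G" "H \<subseteq> carrier G" "\<And>h. h \<in> H \<Longrightarrow> x \<otimes> h \<in> H" "h \<in> H"
  shows "x [^] (i::nat) \<otimes> h \<in> H"
proof (induction i)
  case 0
  then show ?case using assms by auto
next
  case (Suc i)
  have "x [^] Suc i \<otimes> h = x \<otimes> (x [^] i \<otimes> h)"
    unfolding nat_pow_Suc2[OF assms(1)] using assms by (simp add: m_assoc subset_iff)
  then show ?case using assms(3) Suc by simp
qed

lemma commute_from_conj:
  assumes "x \<otimes> (y \<otimes> inv x) = z" "x \<in> carrier G" "y \<in> carrier G" "z \<in> carrier G"
  shows "x \<otimes> y = z \<otimes> x"
  using assms by (metis inv_closed inv_solve_right' m_assoc m_closed)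

lemma inv_eq_pow:
  assumes "x \<in> carrier G" "x [^] Suc m = \<one>"
  shows "inv x = x [^] m"
  using assms by (intro inv_equality) simp_all

end

text \<open>The relations of \<open>G\<^sub>1\<close> and \<open>G\<^sub>2\<close> in a form that moves generators to the left.  The sets \<open>Q\<close>,
  \<open>H\<close> and \<open>K\<close> below are the quaternion group, its extension by \<open>t\<close> and that by \<open>n\<close>.\<close>

locale quaternion_cyclic = group G for G (structure) +
  fixes l r t :: 'a
  assumes closed [simp]: "l \<in> carrier G" "r \<in> carrier G" "t \<in> carrier G"
    and rl: "r \<otimes> l = l [^] (3::nat) \<otimes> r" and rr: "r \<otimes> r = l \<otimes> l"
    and tl: "t \<otimes> l = r \<otimes> t" and tr: "t \<otimes> r = (l \<otimes> r) \<otimes> t"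
begin

lemma r_pow4: "r [^] (4::nat) = l [^] (4::nat)"
proof -
  have "r [^] (4::nat) = (r \<otimes> r) \<otimes> (r \<otimes> r)" by (simp add: numeral_eq_Suc m_assoc)
  also have "\<dots> = l [^] (4::nat)" unfolding rr by (simp add: numeral_eq_Suc m_assoc)
  finally show ?thesis .
qed

definition "Q = {l [^] i \<otimes> r [^] j | (i::nat) j. j < (2::nat)}"

lemma QI: "j < 2 \<Longrightarrow> l [^] (i::nat) \<otimes> r [^] (j::nat) \<in> Q"
  unfolding Q_def by blast

lemma QE: "q \<in> Q \<Longrightarrow> (\<And>i j. j < 2 \<Longrightarrow> q = l [^] (i::nat) \<otimes> r [^] (j::nat) \<Longrightarrow> P) \<Longrightarrow> P"
  unfolding Q_def by blast

lemma Q_closed: "Q \<subseteq> carrier G"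
  by (auto elim: QE)

lemma one_Q: "\<one> \<in> Q"
  using QI[of 0 0] by simp

lemma l_Q: "q \<in> Q \<Longrightarrow> l \<otimes> q \<in> Q"
proof (elim QE)
  fix i j :: nat assume j: "j < 2" "q = l [^] i \<otimes> r [^] j"
  then have "l \<otimes> q = l [^] Suc i \<otimes> r [^] j" unfolding nat_pow_Suc2[OF closed(1)] by (simp add: m_assoc)
  then show ?thesis using QI[OF j(1)] by metis
qed

lemma r_Q: "q \<in> Q \<Longrightarrow> r \<otimes> q \<in> Q"
proof (elim QE)
  fix i j :: nat assume j: "j < 2" "q = l [^] i \<otimes> r [^] j"
  have "r \<otimes> q = (r \<otimes> l [^] i) \<otimes> r [^] j" using j by (simp add: m_assoc)
  also have "r \<otimes> l [^] i = l [^] (3 * i) \<otimes> r"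
    using pow_commute[of r l "l [^] (3::nat)" i] rl by (simp add: nat_pow_pow)
  finally have eq: "r \<otimes> q = l [^] (3 * i) \<otimes> r \<otimes> r [^] j" .
  consider "j = 0" | "j = 1" using j by linarith
  then show ?thesis
  proof cases
    case 1
    then have "r \<otimes> q = l [^] (3 * i) \<otimes> r [^] (1::nat)" using eq by simp
    then show ?thesis using QI[of 1] by simp
  next
    case 2
    then have "r \<otimes> q = l [^] (3 * i) \<otimes> (r \<otimes> r)" using eq by (simp add: m_assoc)
    also have "\<dots> = l [^] (3 * i + 2) \<otimes> r [^] (0::nat)"
      by (simp add: rr nat_pow_mult[symmetric] numeral_2_eq_2 m_assoc)
    finally show ?thesis using QI[of 0 "3 * i + 2"] by (simp only: zero_less_numeral)
  qed
qed

text \<open>Conjugation by \<open>x\<close> turns a product of powers of \<open>l\<close> and \<open>r\<close> into one of powers of \<open>y\<close> and \<open>z\<close>.\<close>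

lemma conj_Q:
  assumes x: "x \<in> carrier G" "x \<otimes> l = y \<otimes> x" "x \<otimes> r = z \<otimes> x" "y \<in> carrier G" "z \<in> carrier G"
    and yz: "\<And>q. q \<in> Q \<Longrightarrow> y \<otimes> q \<in> Q" "\<And>q. q \<in> Q \<Longrightarrow> z \<otimes> q \<in> Q" and q: "q \<in> Q"
  shows "\<exists>q'\<in>Q. x \<otimes> q = q' \<otimes> x"
proof -
  obtain i j :: nat where j: "j < 2" "q = l [^] i \<otimes> r [^] j" using q by (rule QE)
  have "x \<otimes> q = (x \<otimes> l [^] i) \<otimes> r [^] j" using x j by (simp add: m_assoc)
  also have "\<dots> = y [^] i \<otimes> (x \<otimes> r [^] j)" using x by (simp add: pow_commute[of x l y] m_assoc)
  also have "\<dots> = (y [^] i \<otimes> (z [^] j \<otimes> \<one>)) \<otimes> x" using x by (simp add: pow_commute[of x r z] m_assoc)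
  finally show ?thesis
    using left_mult_pow[OF x(4) Q_closed yz(1)] left_mult_pow[OF x(5) Q_closed yz(2) one_Q] by blast
qed

lemma t_Q: "q \<in> Q \<Longrightarrow> \<exists>q'\<in>Q. t \<otimes> q = q' \<otimes> t"
proof (rule conj_Q[OF _ tl tr])
  show "l \<otimes> r \<otimes> q \<in> Q" if "q \<in> Q" for q
    using l_Q[OF r_Q[OF that]] that Q_closed by (auto simp: m_assoc)
qed (auto simp: r_Q)

definition "H = {q \<otimes> t [^] k | q (k::nat). q \<in> Q}"

lemma HI: "q \<in> Q \<Longrightarrow> q \<otimes> t [^] (k::nat) \<in> H"
  unfolding H_def by blast

lemma HE: "h \<in> H \<Longrightarrow> (\<And>q k. q \<in> Q \<Longrightarrow> h = q \<otimes> t [^] (k::nat) \<Longrightarrow> P) \<Longrightarrow> P"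
  unfolding H_def by blast

lemma H_closed: "H \<subseteq> carrier G"
  using Q_closed by (auto elim!: HE)

lemma one_H: "\<one> \<in> H"
  using HI[OF one_Q, of 0] by simp

lemma left_Q_H:
  assumes "x \<in> carrier G" "\<And>q. q \<in> Q \<Longrightarrow> x \<otimes> q \<in> Q" "h \<in> H"
  shows "x \<otimes> h \<in> H"
proof -
  from assms(3) obtain q k where qk: "q \<in> Q" "h = q \<otimes> t [^] (k::nat)" by (rule HE)
  then have "x \<otimes> h = (x \<otimes> q) \<otimes> t [^] k" using assms(1) Q_closed by (auto simp: m_assoc)
  then show ?thesis using HI assms(2) qk by simp
qed

lemma l_H: "h \<in> H \<Longrightarrow> l \<otimes> h \<in> H" and r_H: "h \<in> H \<Longrightarrow> r \<otimes> h \<in> H"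
  by (auto intro!: left_Q_H l_Q r_Q)

lemma t_H: "h \<in> H \<Longrightarrow> t \<otimes> h \<in> H"
proof (elim HE)
  fix q k assume qk: "q \<in> Q" "h = q \<otimes> t [^] (k::nat)"
  then obtain q' where q': "q' \<in> Q" "t \<otimes> q = q' \<otimes> t" using t_Q by blast
  have "t \<otimes> h = (t \<otimes> q) \<otimes> t [^] k" using qk Q_closed by (auto simp: m_assoc)
  also have "\<dots> = q' \<otimes> t [^] Suc k"
    unfolding nat_pow_Suc2[OF closed(3)] using q' Q_closed by (auto simp: m_assoc)
  finally show ?thesis using HI[OF q'(1), of "Suc k"] by (simp only:)
qed

end

locale quaternion_cyclic_ext = quaternion_cyclic +
  fixes n :: 'a and b :: nat
  assumes n_closed [simp]: "n \<in> carrier G"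
    and nl: "n \<otimes> l = (r \<otimes> l) \<otimes> n" and nr: "n \<otimes> r = r [^] (3::nat) \<otimes> n"
    and nt: "n \<otimes> t = t [^] b \<otimes> n" and nn: "n \<otimes> n = l \<otimes> l"
begin

lemma n_Q: "q \<in> Q \<Longrightarrow> \<exists>q'\<in>Q. n \<otimes> q = q' \<otimes> n"
proof (rule conj_Q[OF _ nl nr])
  show "r \<otimes> l \<otimes> q \<in> Q" if "q \<in> Q" for q
    using r_Q[OF l_Q[OF that]] that Q_closed by (auto simp: m_assoc)
  show "r [^] (3::nat) \<otimes> q \<in> Q" if "q \<in> Q" for q
    using left_mult_pow[OF _ Q_closed r_Q that] by simp
qed auto

lemma n_H: "h \<in> H \<Longrightarrow> \<exists>h'\<in>H. n \<otimes> h = h' \<otimes> n"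
proof (elim HE)
  fix q k assume qk: "q \<in> Q" "h = q \<otimes> t [^] (k::nat)"
  then obtain q' where q': "q' \<in> Q" "n \<otimes> q = q' \<otimes> n" using n_Q by blast
  have "n \<otimes> h = (n \<otimes> q) \<otimes> t [^] k" using qk Q_closed by (auto simp: m_assoc)
  also have "\<dots> = q' \<otimes> (n \<otimes> t [^] k)" using q' Q_closed by (auto simp: m_assoc)
  also have "\<dots> = (q' \<otimes> t [^] (b * k)) \<otimes> n"
    using q' Q_closed pow_commute[OF _ _ _ nt, of k] by (auto simp: m_assoc nat_pow_pow)
  finally show ?thesis using HI q' by blast
qed

text \<open>Needed to move \<open>n\<^sup>2 = l\<^sup>2\<close> to the left of an element of \<open>H\<close>.\<close>

lemma H_central: "h \<in> H \<Longrightarrow> h \<otimes> (l \<otimes> l) = (l \<otimes> l) \<otimes> h"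
proof -
  let ?z = "l \<otimes> l"
  have zr: "?z \<otimes> r = r \<otimes> ?z" by (simp flip: rr add: m_assoc)
  have zl: "?z \<otimes> l = l \<otimes> ?z" by (simp add: m_assoc)
  have zt: "?z \<otimes> t = t \<otimes> ?z"
  proof -
    have "t \<otimes> ?z = (t \<otimes> l) \<otimes> l" by (simp add: m_assoc)
    also have "\<dots> = r \<otimes> (t \<otimes> l)" unfolding tl by (simp add: m_assoc tl)
    also have "\<dots> = (r \<otimes> r) \<otimes> t" unfolding tl by (simp add: m_assoc)
    finally show ?thesis by (simp only: rr)
  qed
  assume "h \<in> H"
  then obtain i j k :: nat where h: "h = l [^] i \<otimes> r [^] j \<otimes> t [^] k" by (metis HE QE)
  have "?z \<otimes> h = ((?z \<otimes> l [^] i) \<otimes> r [^] j) \<otimes> t [^] k" by (simp add: h m_assoc)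
  also have "?z \<otimes> l [^] i = l [^] i \<otimes> ?z" using zl by (intro pow_commute) auto
  also have "(l [^] i \<otimes> ?z) \<otimes> r [^] j = l [^] i \<otimes> (?z \<otimes> r [^] j)" by (simp add: m_assoc)
  also have "?z \<otimes> r [^] j = r [^] j \<otimes> ?z" using zr by (intro pow_commute) auto
  also have "(l [^] i \<otimes> (r [^] j \<otimes> ?z)) \<otimes> t [^] k = (l [^] i \<otimes> r [^] j) \<otimes> (?z \<otimes> t [^] k)" by (simp add: m_assoc)
  also have "?z \<otimes> t [^] k = t [^] k \<otimes> ?z" using zt by (intro pow_commute) auto
  finally show ?thesis by (simp add: h m_assoc)
qed

definition "K = {h \<otimes> n [^] e | h e. h \<in> H \<and> e < (2::nat)}"

lemma KI: "h \<in> H \<Longrightarrow> e < 2 \<Longrightarrow> h \<otimes> n [^] (e::nat) \<in> K"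
  unfolding K_def by blast

lemma KE: "x \<in> K \<Longrightarrow> (\<And>h e. h \<in> H \<Longrightarrow> e < 2 \<Longrightarrow> x = h \<otimes> n [^] (e::nat) \<Longrightarrow> P) \<Longrightarrow> P"
  unfolding K_def by blast

lemma K_closed: "K \<subseteq> carrier G"
  using H_closed by (auto elim!: KE)

lemma one_K: "\<one> \<in> K"
  using KI[OF one_H, of 0] by simp

lemma left_H_K:
  assumes "x \<in> carrier G" "\<And>h. h \<in> H \<Longrightarrow> x \<otimes> h \<in> H" "y \<in> K"
  shows "x \<otimes> y \<in> K"
proof -
  from assms(3) obtain h e where he: "h \<in> H" "e < 2" "y = h \<otimes> n [^] (e::nat)" by (rule KE)
  then have "x \<otimes> y = (x \<otimes> h) \<otimes> n [^] e" using assms(1) H_closed by (auto simp: m_assoc)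
  then show ?thesis using KI assms(2) he by simp
qed

lemma l_K: "x \<in> K \<Longrightarrow> l \<otimes> x \<in> K" and r_K: "x \<in> K \<Longrightarrow> r \<otimes> x \<in> K" and t_K: "x \<in> K \<Longrightarrow> t \<otimes> x \<in> K"
  by (auto intro!: left_H_K l_H r_H t_H)

lemma n_K: "x \<in> K \<Longrightarrow> n \<otimes> x \<in> K"
proof (elim KE)
  fix h e assume he: "h \<in> H" "e < (2::nat)" "x = h \<otimes> n [^] e"
  then obtain h' where h': "h' \<in> H" "n \<otimes> h = h' \<otimes> n" using n_H by blast
  have "n \<otimes> x = (n \<otimes> h) \<otimes> n [^] e" using he H_closed by (auto simp: m_assoc)
  then have eq: "n \<otimes> x = h' \<otimes> n \<otimes> n [^] e" using h' by simp
  consider "e = 0" | "e = 1" using he by linarith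
  then show ?thesis
  proof cases
    case 1
    then have "n \<otimes> x = h' \<otimes> n [^] (1::nat)" using eq h' H_closed by auto
    then show ?thesis using KI[OF h'(1), of 1] by simp
  next
    case 2
    then have "n \<otimes> x = h' \<otimes> (n \<otimes> n)" using eq h' H_closed by (auto simp: m_assoc)
    also have "\<dots> = l \<otimes> (l \<otimes> h')" using h' H_closed by (auto simp: nn H_central m_assoc)
    also have "\<dots> = l \<otimes> (l \<otimes> h') \<otimes> n [^] (0::nat)" using h' H_closed by auto
    finally show ?thesis using KI[OF l_H[OF l_H[OF h'(1)]], of 0] by simp
  qed
qed

end

section \<open>The action on two pairs of variables\<close>

lemma adjoin_fixed:
  assumes "\<And>\<sigma>. \<sigma> \<in> S \<Longrightarrow> field_endo \<sigma>" "k \<subseteq> fixed_field S" "B \<subseteq> fixed_field S"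
  shows "adjoin k B \<subseteq> fixed_field S"
  using assms by (intro adjoin_least fixed_field_is_subfield)

lemma adjoin_stable:
  assumes "field_endo \<sigma>" "\<And>x. x \<in> k \<Longrightarrow> \<sigma> x \<in> adjoin k B" "\<And>x. x \<in> B \<Longrightarrow> \<sigma> x \<in> adjoin k B" "x \<in> adjoin k B"
  shows "\<sigma> x \<in> adjoin k B"
proof -
  interpret endo \<sigma> using assms(1) by unfold_locales
  interpret E: subfld "adjoin k B" by (rule subfld_adjoin)
  have "is_subfield {x. \<sigma> x \<in> adjoin k B}" by (rule is_subfieldI) auto
  then have "adjoin k B \<subseteq> {x. \<sigma> x \<in> adjoin k B}" using assms(2,3) by (intro adjoin_least) auto
  then show ?thesis using assms(4) by auto
qed

text \<open>The automorphisms \<open>la\<close>, \<open>ro\<close>, \<open>ta\<close>, \<open>nu\<close> are those of \<open>\<lambda>\<close>, \<open>\<rho>\<close>, \<open>\<tau>\<close>, \<open>\<nu>\<close>; the case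
  \<open>nu = id\<close> is that of \<open>G\<^sub>1\<close>.  On \<open>x\<^sub>1, x\<^sub>2\<close> they act as the unit quaternions
  \<open>i\<close>, \<open>j\<close>, \<open>- (1 + i + j + k) / 2\<close> and \<open>(i - k) / \<surd>2\<close>, where \<open>c = i / \<surd>2\<close>.\<close>

locale octahedral_action = field_auts \<Gamma> for \<Gamma> :: "('a::field \<Rightarrow> 'a) set" +
  fixes k0 :: "'a set" and la ro ta nu :: "'a \<Rightarrow> 'a" and x1 x2 y1 y2 im c \<zeta> :: 'a and L :: nat
  assumes k0: "is_subfield k0" and k0_fixed: "k0 \<subseteq> fixed_field \<Gamma>"
    and const: "im \<in> k0" "c \<in> k0" "\<zeta> \<in> k0" "im\<^sup>2 = -1" "2 * c\<^sup>2 = -1" "(2 :: 'a) \<noteq> 0"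
      "\<And>j. \<zeta> ^ j = 1 \<longleftrightarrow> 3 * 3 ^ L dvd j"
    and gens: "la \<in> \<Gamma>" "ro \<in> \<Gamma>" "ta \<in> \<Gamma>" "nu \<in> \<Gamma>"
    and la: "la x1 = im * x1" "la x2 = - im * x2" "la y1 = y1" "la y2 = y2"
    and ro: "ro x1 = - x2" "ro x2 = x1" "ro y1 = y1" "ro y2 = y2"
    and ta: "ta x1 = - (1 + im) / 2 * x1 + (1 - im) / 2 * x2" "ta x2 = - (1 + im) / 2 * x1 - (1 - im) / 2 * x2"
      "ta y1 = \<zeta> * y1" "ta y2 = y2 / \<zeta>"
    and nu: "nu = id \<or> nu x1 = c * (x1 - x2) \<and> nu x2 = - c * (x1 + x2) \<and> nu y1 = y2 \<and> nu y2 = y1"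
    and normal_form: "\<And>\<sigma>. \<sigma> \<in> \<Gamma> \<Longrightarrow> \<exists>i j k e. e < 2 \<and> \<sigma> = la ^^ i \<circ> ro ^^ j \<circ> ta ^^ k \<circ> nu ^^ e"
    and lin_x: "\<And>\<sigma>. \<sigma> \<in> \<Gamma> \<Longrightarrow> \<exists>p\<in>k0. \<exists>q\<in>k0. \<exists>r\<in>k0. \<exists>s\<in>k0. \<sigma> x1 = p * x1 + r * x2 \<and> \<sigma> x2 = q * x1 + s * x2"
    and lin_y: "\<And>\<sigma>. \<sigma> \<in> \<Gamma> \<Longrightarrow> \<exists>p\<in>k0. p \<noteq> 0 \<and>
      (\<sigma> y1 = p * y1 \<and> \<sigma> y2 = y2 / p \<or> \<sigma> y1 = p * y2 \<and> \<sigma> y2 = y1 / p)"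
    and tr: "x1 \<notin> acl k0 {}" "x2 \<notin> acl k0 {x1}" "y1 \<notin> acl k0 {x1, x2}" "y2 \<notin> acl k0 {x1, x2, y1}"
begin

sublocale k0: subfld k0 using k0 by unfold_locales
sublocale la: endo la using gens endo by blast
sublocale ro: endo ro using gens endo by blast
sublocale ta: endo ta using gens endo by blast
sublocale nu: endo nu using gens endo by blast

lemma const_fixed: "\<sigma> \<in> \<Gamma> \<Longrightarrow> x \<in> k0 \<Longrightarrow> \<sigma> x = x"
  using k0_fixed by (auto simp: fixed_field_def)

lemma im_fixed [simp]: "la im = im" "ro im = im" "ta im = im" "nu im = im"
  and c_fixed [simp]: "nu c = c" and zeta_fixed [simp]: "ta \<zeta> = \<zeta>"
  using const_fixed gens const by auto

definition "LU = adjoin k0 {x1, x2}"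

text \<open>The quadratic forms \<open>qa\<close>, \<open>qb\<close>, \<open>qc\<close> are, up to constants, the coordinates of the three
  dimensional rotation representation, so that the generators permute them up to constants.  Their
  product is Klein's form of degree \<open>6\<close>, whose roots are the vertices of an octahedron, and \<open>w8\<close> is the
  form of degree \<open>8\<close> given by the faces; the numerator of \<open>v\<close> is the form of degree \<open>12\<close> given by the
  edges.\<close>

definition "u = x1 / x2"
definition "qa = 2 * x1 * x2"
definition "qb = x1\<^sup>2 - x2\<^sup>2"
definition "qc = x1\<^sup>2 + x2\<^sup>2"
definition "w8 = qa ^ 4 + qa\<^sup>2 * qb\<^sup>2 + qb ^ 4"
definition "w = (qb\<^sup>2 + qc\<^sup>2) / qa\<^sup>2"
definition "v = (qb\<^sup>2 + qc\<^sup>2) * (qb\<^sup>2 - qa\<^sup>2) * (qa\<^sup>2 + qc\<^sup>2) / (qa * qb * qc)\<^sup>2"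
definition "f0 = w8 / (qa * qb * qc)"

lemma im_im: "im * im = -1" "im * (im * x) = - x"
proof -
  show *: "im * im = -1" using const(4) by (simp add: power2_eq_square)
  show "im * (im * x) = - x" unfolding mult.assoc[symmetric] * by simp
qed

lemma x_nz: "x1 \<noteq> 0" "x2 \<noteq> 0"
  using tr(1,2) subfld.zero[OF subfld_adjoin] adjoin_subset_acl by (metis subsetD)+

lemma u_transcendental:
  assumes "p \<in> polys_over k0" "p \<noteq> 0"
  shows "poly p u \<noteq> 0"
proof
  assume "poly p u = 0"
  then have u: "u \<in> acl k0 {x1}"
    using assms polys_over_mono[OF adjoin_incl(1)[of k0 "{x1}"]] unfolding acl_def algebraic_over_def by blast
  interpret A: subfld "acl k0 {x1}"
    using subfld.is_subfield_algebraics[OF subfld_adjoin, of k0 "{x1}"] by (simp add: acl_def subfld_def)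
  have "x1 / u \<in> acl k0 {x1}" using u acl_superset[of "{x1}" k0] by auto
  then show False using tr(2) x_nz by (simp add: u_def)
qed

lemma one_neq_minus_one: "x \<noteq> 0 \<Longrightarrow> x \<noteq> - (x :: 'a)"
proof
  assume "x \<noteq> 0" "x = - x"
  then have "2 * x = 0" by (metis add.right_inverse mult_2)
  then show False using const(6) \<open>x \<noteq> 0\<close> by simp
qed

lemma q_nz: "qa \<noteq> 0" "qb \<noteq> 0" "qc \<noteq> 0" "w8 \<noteq> 0" "v \<noteq> 0" "u \<noteq> 0" "u\<^sup>2 \<noteq> 1" "u\<^sup>2 \<noteq> -1"
proof -
  \<comment> \<open>The constant \<open>u\<close> depends on \<open>x1\<close>, so that \<open>x1 = u * x2\<close> would loop as a rewrite rule.\<close>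
  define U where "U = u"
  have x1_U: "x1 = U * x2" using x_nz by (simp add: u_def U_def)
  have ne: "poly p U \<noteq> 0" if "p \<in> polys_over k0" "lead_coeff p \<noteq> 0" for p
    using u_transcendental that by (auto simp: U_def)
  show qa: "qa \<noteq> 0" using x_nz const(6) by (simp add: qa_def)
  show "u \<noteq> 0" using x_nz by (simp add: u_def)
  have 1: "poly [:-1, 0, 1:] U \<noteq> 0" and 2: "poly [:1, 0, 1:] U \<noteq> 0"
    and 3: "poly [:1, 0, 0, 0, 14, 0, 0, 0, 1:] U \<noteq> 0" and 4: "poly [:1, 0, 0, 0, 1:] U \<noteq> 0"
    and 5: "poly [:1, 0, -6, 0, 1:] U \<noteq> 0" and 6: "poly [:1, 0, 6, 0, 1:] U \<noteq> 0"
    by (rule ne; simp add: k0.polys_pCons k0.minus)+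
  show "u\<^sup>2 \<noteq> 1" using 1 by (simp add: power2_eq_square U_def)
  show "u\<^sup>2 \<noteq> -1" using 2 by (simp add: U_def power2_eq_square eq_neg_iff_add_eq_0 add.commute)
  have a: "qa = x2\<^sup>2 * (2 * U)" and b: "qb = x2\<^sup>2 * (U * U - 1)" and c: "qc = x2\<^sup>2 * (U * U + 1)"
    unfolding qa_def qb_def qc_def by (simp_all add: x1_U algebra_simps power2_eq_square)
  then show qb: "qb \<noteq> 0" and qc: "qc \<noteq> 0" using 1 2 x_nz by (simp_all add: add.commute)
  have "w8 = (x2\<^sup>2) ^ 4 * ((2 * U) ^ 4 + (2 * U)\<^sup>2 * (U * U - 1)\<^sup>2 + (U * U - 1) ^ 4)"
    unfolding w8_def a b power_mult_distrib by (simp add: algebra_simps)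
  also have "(2 * U) ^ 4 + (2 * U)\<^sup>2 * (U * U - 1)\<^sup>2 + (U * U - 1) ^ 4 = poly [:1, 0, 0, 0, 14, 0, 0, 0, 1:] U"
  proof -
    define t where "t = U * U"
    have 1: "(t - 1)\<^sup>2 = t * t - 2 * t + 1" by (simp add: power2_eq_square algebra_simps)
    have "(t - 1) ^ 4 = (t * t - 2 * t + 1) * (t * t - 2 * t + 1)"
      unfolding 1[symmetric] by (simp add: power4_eq_xxxx power2_eq_square)
    then have 2: "(t - 1) ^ 4 = t * t * t * t - 4 * (t * t * t) + 6 * (t * t) - 4 * t + 1" by (simp add: algebra_simps)
    have "(2 * U) ^ 4 + (2 * U)\<^sup>2 * (U * U - 1)\<^sup>2 + (U * U - 1) ^ 4 = 16 * (t * t) + 4 * t * (t - 1)\<^sup>2 + (t - 1) ^ 4"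
      by (simp add: t_def power4_eq_xxxx power2_eq_square)
    also have "\<dots> = t * t * t * t + 14 * (t * t) + 1"
      unfolding 1 2 by (simp add: algebra_simps)
    also have "\<dots> = poly [:1, 0, 0, 0, 14, 0, 0, 0, 1:] U"
      by (simp add: t_def algebra_simps)
    finally show ?thesis .
  qed
  finally show "w8 \<noteq> 0" using 3 x_nz by simp
  have e: "qb\<^sup>2 + qc\<^sup>2 = (x2\<^sup>2)\<^sup>2 * (2 * poly [:1, 0, 0, 0, 1:] U)"
    "qb\<^sup>2 - qa\<^sup>2 = (x2\<^sup>2)\<^sup>2 * poly [:1, 0, -6, 0, 1:] U"
    "qa\<^sup>2 + qc\<^sup>2 = (x2\<^sup>2)\<^sup>2 * poly [:1, 0, 6, 0, 1:] U"
    unfolding a b c by (simp_all add: power2_eq_square algebra_simps)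
  have "qb\<^sup>2 + qc\<^sup>2 \<noteq> 0" "qb\<^sup>2 - qa\<^sup>2 \<noteq> 0" "qa\<^sup>2 + qc\<^sup>2 \<noteq> 0"
    unfolding e by (intro no_zero_divisors power_not_zero x_nz const 4 5 6)+
  then show "v \<noteq> 0" using qa qb qc by (simp add: v_def)
qed

lemma q_rel: "qc\<^sup>2 = qa\<^sup>2 + qb\<^sup>2"
  by (simp add: qa_def qb_def qc_def power2_eq_square algebra_simps)

lemma q_rel4: "qc ^ 4 = (qa\<^sup>2 + qb\<^sup>2)\<^sup>2"
proof -
  have "qc ^ 4 = (qc\<^sup>2)\<^sup>2" by (simp flip: power_mult)
  then show ?thesis by (simp only: q_rel)
qed

lemma la_q: "la qa = qa" "la qb = - qb" "la qc = - qc"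
  by (simp_all add: qa_def qb_def qc_def la power2_eq_square mult_ac im_im)

lemma ro_q: "ro qa = - qa" "ro qb = - qb" "ro qc = qc"
  by (simp_all add: qa_def qb_def qc_def ro)

lemma ta_q: "ta qa = im * qc" "ta qb = - qa" "ta qc = im * qb"
proof -
  have im: "im * im = - 1" using const(4) by (simp add: power2_eq_square)
  define p q where "p = (1 + im) / 2" and "q = (1 - im) / 2"
  have pq: "2 * (p * p) = im" "2 * (q * q) = - im" "2 * (p * q) = 1"
    using im const(6) by (simp_all add: p_def q_def field_simps)
  have t: "ta x1 = - p * x1 + q * x2" "ta x2 = - p * x1 - q * x2"
    by (simp_all add: ta p_def q_def minus_divide_left)
  have "ta qa = (2 * (p * p)) * x1\<^sup>2 - (2 * (q * q)) * x2\<^sup>2"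
    by (simp add: qa_def t algebra_simps power2_eq_square)
  then show "ta qa = im * qc" by (simp only: pq) (simp add: qc_def algebra_simps)
  have "ta qb = - (2 * (p * q)) * (2 * x1 * x2)"
    by (simp add: qb_def t algebra_simps power2_eq_square)
  then show "ta qb = - qa" by (simp only: pq) (simp add: qa_def)
  have "ta qc = (2 * (p * p)) * x1\<^sup>2 + (2 * (q * q)) * x2\<^sup>2"
    by (simp add: qc_def t algebra_simps power2_eq_square)
  then show "ta qc = im * qb" by (simp only: pq) (simp add: qb_def algebra_simps)
qed

lemma nu_q:
  assumes "nu \<noteq> id"
  shows "nu qa = qb" "nu qb = qa" "nu qc = - qc"
proof -
  have n: "nu x1 = c * (x1 - x2)" "nu x2 = - c * (x1 + x2)" using nu assms by auto
  have "nu qa = - (2 * c\<^sup>2) * qb" by (simp add: qa_def qb_def n algebra_simps power2_eq_square)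
  then show "nu qa = qb" by (simp only: const) simp
  have "nu qb = - (2 * c\<^sup>2) * qa" by (simp add: qa_def qb_def n algebra_simps power2_eq_square)
  then show "nu qb = qa" by (simp only: const) simp
  have "nu qc = (2 * c\<^sup>2) * qc" by (simp add: qc_def n algebra_simps power2_eq_square)
  then show "nu qc = - qc" by (simp only: const) simp
qed

lemma im_powers: "(im * x)\<^sup>2 = - x\<^sup>2" "(im * x) ^ 4 = x ^ 4"
  by (simp_all add: power4_eq_xxxx power2_eq_square mult_ac im_im)

lemma invariants_la: "la w = w" "la v = v" "la f0 = f0"
  by (simp_all add: w_def v_def f0_def w8_def la_q)

lemma invariants_ro: "ro w = w" "ro v = v" "ro f0 = f0"
  by (simp_all add: w_def v_def f0_def w8_def ro_q)

lemma invariants_ta: "ta v = v" "ta f0 = f0"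
proof -
  have "(im * qc * (- qa) * (im * qb)) = qa * qb * qc"
    by (simp add: mult_ac im_im)
  then have t: "ta (qa * qb * qc) = qa * qb * qc" by (simp add: ta_q)
  have "ta w8 = qc ^ 4 - qc\<^sup>2 * qa\<^sup>2 + qa ^ 4"
    by (simp add: w8_def ta_q im_powers)
  also have "\<dots> = w8"
    unfolding q_rel4 q_rel w8_def by (simp add: power4_eq_xxxx power2_eq_square algebra_simps)
  finally have "ta w8 = w8" .
  then show "ta f0 = f0" unfolding f0_def using t by simp
  have "ta ((qb\<^sup>2 + qc\<^sup>2) * (qb\<^sup>2 - qa\<^sup>2) * (qa\<^sup>2 + qc\<^sup>2)) = (qb\<^sup>2 + qc\<^sup>2) * (qb\<^sup>2 - qa\<^sup>2) * (qa\<^sup>2 + qc\<^sup>2)"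
    by (simp add: ta_q im_powers) (simp add: algebra_simps)
  then show "ta v = v" unfolding v_def using t by (simp only: ta.div ta.power)
qed

lemma anti_invariants_nu: "nu \<noteq> id \<Longrightarrow> nu v = - v" "nu \<noteq> id \<Longrightarrow> nu f0 = - f0"
proof -
  assume "nu \<noteq> id"
  note n = nu_q[OF this]
  have "nu ((qb\<^sup>2 + qc\<^sup>2) * (qb\<^sup>2 - qa\<^sup>2) * (qa\<^sup>2 + qc\<^sup>2)) = - ((qb\<^sup>2 + qc\<^sup>2) * (qb\<^sup>2 - qa\<^sup>2) * (qa\<^sup>2 + qc\<^sup>2))"
    by (simp add: n algebra_simps)
  moreover have t: "nu (qa * qb * qc) = - (qa * qb * qc)" by (simp add: n)
  ultimately show "nu v = - v" unfolding v_def nu.div nu.power by simp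
  have "nu w8 = w8" by (simp add: w8_def n algebra_simps)
  then show "nu f0 = - f0" unfolding f0_def nu.div t by simp
qed

text \<open>With \<open>\<alpha> = qa\<^sup>2\<close>, \<open>\<beta> = qb\<^sup>2\<close> and \<open>\<gamma> = - qc\<^sup>2\<close>, which have sum \<open>0\<close>, the orbit of \<open>w\<close> consists of
  \<open>(\<beta> - \<gamma>) / \<alpha>\<close>, \<open>(\<alpha> - \<beta>) / \<gamma>\<close> and \<open>(\<gamma> - \<alpha>) / \<beta>\<close>.\<close>

lemma ta_w: "ta w = (qb\<^sup>2 - qa\<^sup>2) / qc\<^sup>2" "ta (ta w) = - (qa\<^sup>2 + qc\<^sup>2) / qb\<^sup>2" "ta (ta (ta w)) = w"
proof -
  show 1: "ta w = (qb\<^sup>2 - qa\<^sup>2) / qc\<^sup>2"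
    using q_nz by (simp add: w_def ta_q im_powers) (simp add: divide_simps)
  show 2: "ta (ta w) = - (qa\<^sup>2 + qc\<^sup>2) / qb\<^sup>2"
    unfolding 1 using q_nz by (simp add: ta_q im_powers minus_divide_left)
  show "ta (ta (ta w)) = w"
    unfolding 2 using q_nz by (simp add: w_def ta_q im_powers)
qed

text \<open>Equality of two conjugates would be the vanishing of \<open>2 w8\<close>.\<close>

lemma w_conjugates: "w \<noteq> ta w" "w \<noteq> ta (ta w)" "ta w \<noteq> ta (ta w)"
proof -
  show 1: "w \<noteq> ta w"
  proof
    assume "w = ta w"
    then have "(qb\<^sup>2 + qc\<^sup>2) * qc\<^sup>2 = (qb\<^sup>2 - qa\<^sup>2) * qa\<^sup>2"
      unfolding ta_w using q_nz by (simp add: w_def field_simps)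
    moreover have "2 * w8 = (qb\<^sup>2 + qc\<^sup>2) * qc\<^sup>2 - (qb\<^sup>2 - qa\<^sup>2) * qa\<^sup>2"
      unfolding w8_def q_rel by (simp add: power4_eq_xxxx power2_eq_square algebra_simps)
    ultimately have "2 * w8 = 0" by simp
    then show False using q_nz(4) const(6) by simp
  qed
  then show "ta w \<noteq> ta (ta w)" by simp
  show "w \<noteq> ta (ta w)"
  proof
    assume "w = ta (ta w)"
    then have "(qb\<^sup>2 + qc\<^sup>2) * qb\<^sup>2 = - ((qa\<^sup>2 + qc\<^sup>2) * qa\<^sup>2)"
      unfolding ta_w(2) using q_nz by (simp add: w_def field_simps)
    moreover have "2 * w8 = (qb\<^sup>2 + qc\<^sup>2) * qb\<^sup>2 + (qa\<^sup>2 + qc\<^sup>2) * qa\<^sup>2"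
      unfolding w8_def q_rel by (simp add: power4_eq_xxxx power2_eq_square algebra_simps)
    ultimately have "2 * w8 = 0" by simp
    then show False using q_nz(4) const(6) by simp
  qed
qed

end

context octahedral_action
begin

interpretation LU: subfld LU unfolding LU_def by (rule subfld_adjoin)

lemma k0_LU: "k0 \<subseteq> LU" and x_LU: "x1 \<in> LU" "x2 \<in> LU"
  using adjoin_incl(1)[of k0 "{x1, x2}"] adjoin_incl(2)[of "{x1, x2}" k0] by (auto simp: LU_def)

lemma const_gens: "x \<in> k0 \<Longrightarrow> la x = x" "x \<in> k0 \<Longrightarrow> ro x = x" "x \<in> k0 \<Longrightarrow> ta x = x" "x \<in> k0 \<Longrightarrow> nu x = x"
  using const_fixed gens by auto

lemma const_gens_fixed: "k0 \<subseteq> fixed_field {id, la \<circ> la}" "k0 \<subseteq> fixed_field {id, la, ro, la \<circ> ro}"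
  "k0 \<subseteq> fixed_field {id, ta, ta \<circ> ta}" "k0 \<subseteq> fixed_field {id, nu}"
  using const_gens by (auto simp: fixed_field_def)

lemma f0_LU: "f0 \<in> LU" and v_LU: "v \<in> LU"
  and w_LU: "w \<in> LU"
proof -
  have "qa \<in> LU" "qb \<in> LU" "qc \<in> LU"
    unfolding qa_def qb_def qc_def using x_LU by auto
  then show "f0 \<in> LU" "v \<in> LU" "w \<in> LU"
    unfolding f0_def v_def w_def w8_def by (auto intro!: LU.div LU.mult LU.add LU.diff LU.pow simp del: power_mult_distrib)
qed

lemma u_values: "la u = - u" "ro u = - inverse u"
  using const(4) by (auto simp: u_def la ro)

lemma w_u: "w = (u\<^sup>2 + (inverse u)\<^sup>2) / 2"
proof -
  have *: "(2 * (a * a + b * b)) / (2 * (2 * (a * b))) = (a / b + b / a) / 2" if "a \<noteq> 0" "b \<noteq> 0" for a b :: 'a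
  proof -
    have "(2 * (a * a + b * b)) / (2 * (2 * (a * b))) = (a * a + b * b) / (2 * (a * b))"
      by (rule nonzero_mult_divide_mult_cancel_left) (rule const(6))
    also have "\<dots> = (a * a + b * b) / (a * b) / 2" by (simp add: mult.commute)
    also have "(a * a + b * b) / (a * b) = a / b + b / a"
      using that by (simp add: add_frac_eq mult.commute)
    finally show ?thesis .
  qed
  have "qb\<^sup>2 + qc\<^sup>2 = 2 * (x1\<^sup>2 * x1\<^sup>2 + x2\<^sup>2 * x2\<^sup>2)" "qa\<^sup>2 = 2 * (2 * (x1\<^sup>2 * x2\<^sup>2))"
    unfolding qa_def qb_def qc_def by (simp_all add: power2_eq_square algebra_simps)
  then show ?thesis
    using *[of "x1\<^sup>2" "x2\<^sup>2"] x_nz by (simp only: w_def u_def) (simp add: power_divide)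
qed

text \<open>The next four lemmas shrink \<open>k(x\<^sub>1, x\<^sub>2)\<close> to the fixed fields of the groups generated by
  \<open>\<lambda>\<^sup>2\<close>, by \<open>\<lambda>\<close> and \<open>\<rho>\<close>, by these and \<open>\<tau>\<close>, and finally by all four generators.  In each of
  them the larger field is generated by one element over the smaller one, here by \<open>x\<^sub>2\<close>, as
  \<open>f0 / x\<^sub>2\<^sup>2\<close> is a rational function of \<open>u = x\<^sub>1 / x\<^sub>2\<close>.\<close>

lemma fixed_by_center_in_k_u_f0:
  assumes "f \<in> LU" "la (la f) = f"
  shows "f \<in> adjoin k0 {u, f0}"
proof (rule fixed_in_simple_extension[where S = "{id, la \<circ> la}" and \<theta> = x2])
  let ?F = "adjoin k0 {u, f0}"
  interpret F: subfld ?F by (rule subfld_adjoin)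
  show endo: "field_endo \<sigma>" if "\<sigma> \<in> {id, la \<circ> la}" for \<sigma>
    using that endos gens comp id by blast
  have uF: "u \<in> ?F" "f0 \<in> ?F" using adjoin_incl(2)[of "{u, f0}" k0] by auto
  show "?F \<subseteq> fixed_field {id, la \<circ> la}"
    by (rule adjoin_fixed[OF endo]) (assumption | rule const_gens_fixed | simp add: fixed_field_def u_values invariants_la)+
  define g where "g = f0 / x2\<^sup>2"
  have "qa / x2\<^sup>2 = 2 * u" "qb / x2\<^sup>2 = u\<^sup>2 - 1" "qc / x2\<^sup>2 = u\<^sup>2 + 1"
    using x_nz by (simp_all add: qa_def qb_def qc_def u_def power2_eq_square field_simps)
  moreover have "2 * u \<in> ?F" "u\<^sup>2 - 1 \<in> ?F" "u\<^sup>2 + 1 \<in> ?F" using uF by auto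
  ultimately have q: "qa / x2\<^sup>2 \<in> ?F" "qb / x2\<^sup>2 \<in> ?F" "qc / x2\<^sup>2 \<in> ?F" by simp_all
  have "g = ((qa / x2\<^sup>2) ^ 4 + (qa / x2\<^sup>2)\<^sup>2 * (qb / x2\<^sup>2)\<^sup>2 + (qb / x2\<^sup>2) ^ 4) /
      ((qa / x2\<^sup>2) * (qb / x2\<^sup>2) * (qc / x2\<^sup>2))"
  proof -
    have *: "(A / y) ^ 4 + (A / y)\<^sup>2 * (B / y)\<^sup>2 + (B / y) ^ 4 = (A ^ 4 + A\<^sup>2 * B\<^sup>2 + B ^ 4) / y ^ 4"
      if "y \<noteq> 0" for A B y :: 'a
      using that by (simp add: power_divide add_divide_distrib flip: power_add)
    have "(A ^ 4 + A\<^sup>2 * B\<^sup>2 + B ^ 4) / (A * B * C) / y = (A ^ 4 + A\<^sup>2 * B\<^sup>2 + B ^ 4) / y ^ 4 / ((A / y) * (B / y) * (C / y))"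
      if "y \<noteq> 0" for A B C y :: 'a
      using that by (simp add: power4_eq_xxxx)
    then show ?thesis using x_nz by (simp add: g_def f0_def w8_def *)
  qed
  moreover have "\<dots> \<in> ?F" by (rule q F.div F.mult F.add F.pow)+
  ultimately have gF: "g \<in> ?F" by (simp only:)
  have g_nz: "g \<noteq> 0" using q_nz x_nz by (simp add: g_def f0_def)
  show "[:- f0 / g, 0, 1:] \<in> polys_over ?F"
    using uF gF by (intro F.polys_pCons) auto
  show "poly [:- f0 / g, 0, 1:] x2 = 0" using g_nz x_nz by (simp add: g_def power2_eq_square)
  have "(\<lambda>\<sigma>. \<sigma> x2) ` {id, la \<circ> la} = {x2, - x2}"
    by (simp add: la im_im)
  then show "degree [:- f0 / g, 0, 1:] \<le> card ((\<lambda>\<sigma>. \<sigma> x2) ` {id, la \<circ> la})"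
    using one_neq_minus_one[OF x_nz(2)] by simp
  show "f \<in> fixed_field {id, la \<circ> la}" using assms by (simp add: fixed_field_def)
  have "x1 = u * x2" using x_nz by (simp add: u_def)
  moreover interpret E: subfld "adjoin ?F {x2}" by (rule subfld_adjoin)
  have *: "x2 \<in> adjoin ?F {x2}" "u \<in> adjoin ?F {x2}"
    using adjoin_incl(2)[of "{x2}" ?F] adjoin_incl(1)[of ?F "{x2}"] uF by auto
  ultimately have "x1 \<in> adjoin ?F {x2}" using E.mult[of u x2] by (simp only:)
  then have "LU \<subseteq> adjoin ?F {x2}"
    unfolding LU_def using * adjoin_incl(1)[of k0 "{u, f0}"] adjoin_incl(1)[of ?F "{x2}"]
    by (intro adjoin_subset_adjoin) auto
  then show "f \<in> adjoin ?F {x2}" using assms by blast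
qed (auto intro: adjoin_is_subfield)

text \<open>The conjugates of \<open>u\<close> are \<open>u\<close>, \<open>- u\<close>, \<open>- 1 / u\<close> and \<open>1 / u\<close>, and \<open>w\<close> is the mean of their
  squares.\<close>

lemma fixed_by_Q8_in_k_w_f0:
  assumes "f \<in> adjoin k0 {u, f0}" "la f = f" "ro f = f"
  shows "f \<in> adjoin k0 {w, f0}"
proof (rule fixed_in_simple_extension[where S = "{id, la, ro, la \<circ> ro}" and \<theta> = u])
  let ?F = "adjoin k0 {w, f0}" and ?S = "{id, la, ro, la \<circ> ro}"
  interpret F: subfld ?F by (rule subfld_adjoin)
  show endo: "field_endo \<sigma>" if "\<sigma> \<in> ?S" for \<sigma>
    using that endos gens comp id by blast
  have wF: "w \<in> ?F" "f0 \<in> ?F" using adjoin_incl(2)[of "{w, f0}" k0] by auto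
  show "?F \<subseteq> fixed_field ?S"
    by (rule adjoin_fixed[OF endo]) (assumption | rule const_gens_fixed | simp add: fixed_field_def invariants_la invariants_ro)+
  show "[:1, 0, - 2 * w, 0, 1:] \<in> polys_over ?F"
    using wF by (intro F.polys_pCons) auto
  show "poly [:1, 0, - 2 * w, 0, 1:] u = 0"
    using q_nz const(6) by (simp add: w_u field_simps power2_eq_square)
  have 1: "u \<noteq> - u" by (rule one_neq_minus_one) (rule q_nz)
  have 2: "u \<noteq> inverse u" "u \<noteq> - inverse u"
    using q_nz by (auto simp: power2_eq_square field_simps)
  have "card {u, - u, - inverse u, inverse u} = 4"
    using 1 2 one_neq_minus_one[of "inverse u"] q_nz(6) minus_equation_iff[of u "inverse u"]
    by (auto simp: card_insert_if)
  moreover have "(\<lambda>\<sigma>. \<sigma> u) ` ?S = {u, - u, - inverse u, inverse u}"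
    by (simp add: u_values insert_commute)
  ultimately show "degree [:1, 0, - 2 * w, 0, 1:] \<le> card ((\<lambda>\<sigma>. \<sigma> u) ` ?S)" by simp
  show "f \<in> fixed_field ?S" using assms by (simp add: fixed_field_def)
  have "adjoin k0 {u, f0} \<subseteq> adjoin ?F {u}"
    using wF adjoin_incl(1)[of k0 "{w, f0}"] adjoin_incl(1)[of ?F "{u}"] adjoin_incl(2)[of "{u}" ?F]
    by (intro adjoin_subset_adjoin) auto
  then show "f \<in> adjoin ?F {u}" using assms by blast
qed (auto intro: adjoin_is_subfield)

text \<open>The polynomial with the roots \<open>w\<close>, \<open>ta w\<close> and \<open>ta (ta w)\<close>.\<close>

lemma w_cubic: "w ^ 3 - v * w\<^sup>2 - 9 * w + v = 0"
proof -
  define A B where "A = qa\<^sup>2" and "B = qb\<^sup>2"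
  have nz: "A \<noteq> 0" "B \<noteq> 0" "A + B \<noteq> 0" using q_nz by (auto simp: A_def B_def simp flip: q_rel)
  define P where "P = A * B * (A + B)"
  define V where "V = (A + 2 * B) * (B - A) * (2 * A + B)"
  define W where "W = A + 2 * B"
  have P: "P \<noteq> 0" using nz by (simp add: P_def)
  have w: "w = W / A" by (simp add: w_def q_rel A_def B_def W_def add_ac)
  have v: "v = V / P"
    by (simp add: v_def power_mult_distrib q_rel A_def B_def V_def P_def add_ac)
  have "P * W ^ 3 - V * W\<^sup>2 * A - 9 * P * W * A\<^sup>2 + V * A ^ 3 = 0"
    by (simp add: P_def V_def W_def power2_eq_square power3_eq_cube algebra_simps)
  then have "(P * W ^ 3 - V * W\<^sup>2 * A - 9 * P * W * A\<^sup>2 + V * A ^ 3) / (P * A ^ 3) = 0" by simp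
  also have "(P * W ^ 3 - V * W\<^sup>2 * A - 9 * P * W * A\<^sup>2 + V * A ^ 3) / (P * A ^ 3) =
      (W / A) ^ 3 - V / P * (W / A)\<^sup>2 - 9 * (W / A) + V / P"
    using P nz by (simp add: diff_divide_distrib add_divide_distrib power_divide power2_eq_square power3_eq_cube)
  finally show ?thesis by (simp add: w v)
qed

lemma fixed_by_tau_in_k_v_f0:
  assumes "f \<in> adjoin k0 {w, f0}" "ta f = f"
  shows "f \<in> adjoin k0 {v, f0}"
proof (rule fixed_in_simple_extension[where S = "{id, ta, ta \<circ> ta}" and \<theta> = w])
  let ?F = "adjoin k0 {v, f0}" and ?S = "{id, ta, ta \<circ> ta}"
  interpret F: subfld ?F by (rule subfld_adjoin)
  show endo: "field_endo \<sigma>" if "\<sigma> \<in> ?S" for \<sigma>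
    using that endos gens comp id by blast
  have vF: "v \<in> ?F" "f0 \<in> ?F" using adjoin_incl(2)[of "{v, f0}" k0] by auto
  show "?F \<subseteq> fixed_field ?S"
    by (rule adjoin_fixed[OF endo]) (assumption | rule const_gens_fixed | simp add: fixed_field_def invariants_ta)+
  show "[:v, - 9, - v, 1:] \<in> polys_over ?F"
    using vF by (intro F.polys_pCons) auto
  show "poly [:v, - 9, - v, 1:] w = 0"
    using w_cubic by (simp add: power2_eq_square power3_eq_cube algebra_simps)
  have "card {w, ta w, ta (ta w)} = 3" using w_conjugates by (simp add: card_insert_if)
  moreover have "(\<lambda>\<sigma>. \<sigma> w) ` ?S = {w, ta w, ta (ta w)}" by simp
  ultimately show "degree [:v, - 9, - v, 1:] \<le> card ((\<lambda>\<sigma>. \<sigma> w) ` ?S)" by simp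
  show "f \<in> fixed_field ?S" using assms by (simp add: fixed_field_def)
  have "adjoin k0 {w, f0} \<subseteq> adjoin ?F {w}"
    using vF adjoin_incl(1)[of k0 "{v, f0}"] adjoin_incl(1)[of ?F "{w}"] adjoin_incl(2)[of "{w}" ?F]
    by (intro adjoin_subset_adjoin) auto
  then show "f \<in> adjoin ?F {w}" using assms by blast
qed (auto intro: adjoin_is_subfield)

text \<open>Both \<open>v\<close> and \<open>f0\<close> change their sign under \<open>\<nu>\<close>.\<close>

lemma fixed_by_nu_in_k_v2_f0v:
  assumes "f \<in> adjoin k0 {v, f0}" "nu f = f" "nu \<noteq> id"
  shows "f \<in> adjoin k0 {v\<^sup>2, f0 * v}"
proof (rule fixed_in_simple_extension[where S = "{id, nu}" and \<theta> = v])
  let ?F = "adjoin k0 {v\<^sup>2, f0 * v}" and ?S = "{id, nu}"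
  interpret F: subfld ?F by (rule subfld_adjoin)
  note nu_v = anti_invariants_nu[OF assms(3)]
  show endo: "field_endo \<sigma>" if "\<sigma> \<in> ?S" for \<sigma>
    using that endos gens id by blast
  have vF: "v\<^sup>2 \<in> ?F" "f0 * v \<in> ?F" using adjoin_incl(2)[of "{v\<^sup>2, f0 * v}" k0] by auto
  show "?F \<subseteq> fixed_field ?S"
    by (rule adjoin_fixed[OF endo]) (assumption | rule const_gens_fixed | simp add: fixed_field_def nu_v)+
  show "[:- v\<^sup>2, 0, 1:] \<in> polys_over ?F"
    using vF by (intro F.polys_pCons) auto
  show "poly [:- v\<^sup>2, 0, 1:] v = 0" by (simp add: power2_eq_square)
  show "degree [:- v\<^sup>2, 0, 1:] \<le> card ((\<lambda>\<sigma>. \<sigma> v) ` ?S)"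
    using one_neq_minus_one[OF q_nz(5)] by (simp add: nu_v)
  show "f \<in> fixed_field ?S" using assms by (simp add: fixed_field_def)
  interpret E: subfld "adjoin ?F {v}" by (rule subfld_adjoin)
  have E: "v \<in> adjoin ?F {v}" "f0 * v \<in> adjoin ?F {v}"
    using adjoin_incl(2)[of "{v}" ?F] adjoin_incl(1)[of ?F "{v}"] vF by auto
  have "f0 * v / v \<in> adjoin ?F {v}" using E by (intro E.div)
  then have "f0 \<in> adjoin ?F {v}" using q_nz by simp
  then have "adjoin k0 {v, f0} \<subseteq> adjoin ?F {v}"
    using E adjoin_incl(1)[of k0 "{v\<^sup>2, f0 * v}"] adjoin_incl(1)[of ?F "{v}"]
    by (intro adjoin_subset_adjoin) auto
  then show "f \<in> adjoin ?F {v}" using assms by blast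
qed (auto intro: adjoin_is_subfield)

lemma fixed_by_generators:
  assumes "la x = x" "ro x = x" "ta x = x" "nu x = x"
  shows "x \<in> Fix"
  unfolding fixed_field_def
proof safe
  fix \<sigma> assume "\<sigma> \<in> \<Gamma>"
  then obtain i j k e where "\<sigma> = la ^^ i \<circ> ro ^^ j \<circ> ta ^^ k \<circ> nu ^^ e" using normal_form by blast
  moreover have "(g ^^ m) x = x" if "g x = x" for g :: "'a \<Rightarrow> 'a" and m
    using that by (induction m) auto
  ultimately show "\<sigma> x = x" using assms by simp
qed

lemma LU_fixed: "\<exists>B. finite B \<and> card B \<le> 2 \<and> LU \<inter> Fix = adjoin k0 B"
proof -
  define B where "B = (if nu = id then {v, f0} else {v\<^sup>2, f0 * v})"
  have "finite B" "card B \<le> 2" by (auto simp: B_def card_insert_if)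
  moreover have "LU \<inter> Fix = adjoin k0 B"
  proof
    have "B \<subseteq> LU" using f0_LU v_LU by (auto simp: B_def)
    moreover have "b \<in> Fix" if "b \<in> B" for b
      using that anti_invariants_nu
      by (intro fixed_by_generators) (auto simp: B_def invariants_la invariants_ro invariants_ta split: if_splits)
    ultimately show "adjoin k0 B \<subseteq> LU \<inter> Fix"
      using adjoin_least[OF LU.sub k0_LU, of B] adjoin_least[OF Fix.sub k0_fixed, of B] by auto
    show "LU \<inter> Fix \<subseteq> adjoin k0 B"
    proof
      fix f assume f: "f \<in> LU \<inter> Fix"
      then have g: "la f = f" "ro f = f" "ta f = f" "nu f = f" using gens by (auto simp: fixed_field_def)
      have "f \<in> adjoin k0 {v, f0}"
        using fixed_by_center_in_k_u_f0 fixed_by_Q8_in_k_w_f0 fixed_by_tau_in_k_v_f0 f g by auto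
      then show "f \<in> adjoin k0 B" using fixed_by_nu_in_k_v2_f0v g by (auto simp: B_def)
    qed
  qed
  ultimately show ?thesis by blast
qed

end

context octahedral_action
begin

interpretation LU: subfld LU unfolding LU_def by (rule subfld_adjoin)

text \<open>The product \<open>y\<^sub>1 y\<^sub>2\<close> is invariant, and \<open>y\<^sub>1\<^sup>N\<close> and \<open>y\<^sub>2\<^sup>N\<close> are invariant under \<open>\<tau>\<^sup>3\<close>.
  Division by \<open>(y\<^sub>1 y\<^sub>2)\<^sup>m\<close>, where \<open>N = 2 m + 1\<close>, achieves \<open>z\<^sub>1 z\<^sub>2 = y\<^sub>1 y\<^sub>2\<close>; so these two elements
  already generate the invariants of \<open>\<tau>\<^sup>3\<close>, and the group acts on them linearly again.\<close>

definition "N = (3 :: nat) ^ L"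
definition "m = (N - 1) div 2"
definition "z1 = y1 ^ N / (y1 * y2) ^ m"
definition "z2 = y2 ^ N / (y1 * y2) ^ m"
definition "L0 = adjoin k0 {x1, x2, y1, y2}"
definition "L1 = adjoin LU {z1, z2}"

lemma N_odd: "N = 2 * m + 1"
proof -
  have "odd N" by (simp add: N_def)
  then show ?thesis unfolding m_def by presburger
qed

lemma N_pos: "N > 0"
  by (simp add: N_def)

lemma y_nz: "y1 \<noteq> 0" "y2 \<noteq> 0"
  using tr(3,4) subfld.zero[OF subfld_adjoin] adjoin_subset_acl by (metis subsetD)+

lemma zeta_nz: "\<zeta> \<noteq> 0"
  using const(7)[of "3 * 3 ^ L"] by (auto simp: power_0_left)

lemma z12: "z1 * z2 = y1 * y2"
proof -
  have "z1 * z2 = (y1 * y2) ^ N / ((y1 * y2) ^ m * (y1 * y2) ^ m)"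
    by (simp add: z1_def z2_def power_mult_distrib)
  also have "(y1 * y2) ^ N = (y1 * y2) ^ m * (y1 * y2) ^ m * (y1 * y2)"
    by (simp add: N_odd mult_2 power_add)
  finally show ?thesis using y_nz by simp
qed

lemma z_transform:
  assumes "\<sigma> \<in> \<Gamma>" "p \<noteq> 0"
  shows "\<sigma> y1 = p * y1 \<Longrightarrow> \<sigma> y2 = y2 / p \<Longrightarrow> \<sigma> z1 = p ^ N * z1 \<and> \<sigma> z2 = inverse p ^ N * z2"
    and "\<sigma> y1 = p * y2 \<Longrightarrow> \<sigma> y2 = y1 / p \<Longrightarrow> \<sigma> z1 = p ^ N * z2 \<and> \<sigma> z2 = inverse p ^ N * z1"
proof -
  interpret endo \<sigma> using endo assms by blast
  assume 1: "\<sigma> y1 = p * y1" "\<sigma> y2 = y2 / p"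
  have prod: "p * y1 * (y2 / p) = y1 * y2" using assms by simp
  show "\<sigma> z1 = p ^ N * z1 \<and> \<sigma> z2 = inverse p ^ N * z2"
    unfolding z1_def z2_def div power mult 1 prod by (simp add: power_mult_distrib divide_inverse)
next
  interpret endo \<sigma> using endo assms by blast
  assume 1: "\<sigma> y1 = p * y2" "\<sigma> y2 = y1 / p"
  have prod: "p * y2 * (y1 / p) = y1 * y2" using assms by simp
  show "\<sigma> z1 = p ^ N * z2 \<and> \<sigma> z2 = inverse p ^ N * z1"
    unfolding z1_def z2_def div power mult 1 prod by (simp add: power_mult_distrib divide_inverse)
qed

lemma funpow_in: "\<sigma> \<in> \<Gamma> \<Longrightarrow> \<sigma> ^^ j \<in> \<Gamma>"
  by (induction j) (auto intro: id comp)

lemma ta3_x: "ta (ta (ta x1)) = x1" "ta (ta (ta x2)) = x2"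
proof -
  define p q where "p = (1 + im) / 2" and "q = (1 - im) / 2"
  have "(2 :: 'a) * 2 \<noteq> 0" using const(6) by (intro no_zero_divisors)
  then have four: "(4 :: 'a) \<noteq> 0" by simp
  have t: "ta x1 = - p * x1 + q * x2" "ta x2 = - p * x1 - q * x2" "ta p = p" "ta q = q"
    by (simp_all add: ta p_def q_def minus_divide_left)
  have im: "p + q = 1" "p - q = im" and pim: "p * im = - q" "q * im = p"
    using const(6) four by (simp_all add: p_def q_def field_simps im_im)
  have "ta (ta x1) = (p * (p - q)) * x1 - (q * (p + q)) * x2"
    "ta (ta x2) = (p * (p + q)) * x1 - (q * (p - q)) * x2"
    by (simp_all add: t algebra_simps)
  then have 2: "ta (ta x1) = - q * x1 - q * x2" "ta (ta x2) = p * x1 - p * x2"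
    by (simp_all only: im pim) simp_all
  have pq: "2 * (p * q) = 1" using const(6) four by (simp add: p_def q_def field_simps im_im)
  have "ta (ta (ta x1)) = 2 * (p * q) * x1" "ta (ta (ta x2)) = 2 * (p * q) * x2"
    unfolding 2 by (simp_all add: t algebra_simps)
  then show "ta (ta (ta x1)) = x1" "ta (ta (ta x2)) = x2" by (simp_all only: pq mult_1_left)
qed

lemma ta_pow_y: "(ta ^^ j) y1 = \<zeta> ^ j * y1" "(ta ^^ j) y2 = y2 / \<zeta> ^ j"
  by (induction j) (auto simp: ta field_simps)

lemma ta_pow3_x: "(ta ^^ (3 * j)) x1 = x1" "(ta ^^ (3 * j)) x2 = x2"
  by (induction j) (auto simp: ta3_x funpow_add numeral_3_eq_3)

text \<open>Under the \<open>N\<close> powers of \<open>\<tau>\<^sup>3\<close> the element \<open>y\<^sub>1\<close> has \<open>N\<close> conjugates, and \<open>y\<^sub>1\<^sup>N\<close> lies in \<open>L1\<close>.\<close>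

lemma fixed_by_tau_cubed:
  assumes "f \<in> L0 \<inter> Fix"
  shows "f \<in> L1"
proof -
  define S where "S = (\<lambda>j. ta ^^ (3 * j)) ` {..<N}"
  have S_sub: "\<sigma> \<in> \<Gamma>" if "\<sigma> \<in> S" for \<sigma> using that gens funpow_in by (auto simp: S_def)
  interpret L1: subfld L1 unfolding L1_def by (rule subfld_adjoin)
  have LU_L1: "LU \<subseteq> L1" "z1 \<in> L1" "z2 \<in> L1"
    using adjoin_incl(1)[of LU "{z1, z2}"] adjoin_incl(2)[of "{z1, z2}" LU] by (auto simp: L1_def)
  have fixed: "\<sigma> x1 = x1 \<and> \<sigma> x2 = x2 \<and> \<sigma> z1 = z1 \<and> \<sigma> z2 = z2" if "\<sigma> \<in> S" for \<sigma>
  proof -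
    from that obtain j where j: "\<sigma> = ta ^^ (3 * j)" by (auto simp: S_def)
    have "\<zeta> ^ (3 * j * N) = 1" unfolding const(7) by (simp add: N_def)
    then have 1: "(\<zeta> ^ (3 * j)) ^ N = 1" by (simp add: power_mult)
    have "\<sigma> z1 = (\<zeta> ^ (3 * j)) ^ N * z1 \<and> \<sigma> z2 = inverse (\<zeta> ^ (3 * j)) ^ N * z2"
      by (rule z_transform(1)[OF S_sub[OF that]]) (simp_all add: j ta_pow_y zeta_nz)
    moreover have "inverse (\<zeta> ^ (3 * j)) ^ N = 1" using 1 by (simp add: power_inverse)
    ultimately show ?thesis using 1 ta_pow3_x by (simp add: j)
  qed
  show ?thesis
  proof (rule fixed_in_simple_extension[where S = S and \<theta> = y1 and \<mu> = "monom 1 N - [:z1 * (z1 * z2) ^ m:]"])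
    show "is_subfield L1" by (rule L1.sub)
    show endoS: "field_endo \<sigma>" if "\<sigma> \<in> S" for \<sigma> using endos[OF S_sub[OF that]] .
    have "k0 \<subseteq> fixed_field S" using const_fixed[OF S_sub] by (auto simp: fixed_field_def)
    then have "LU \<subseteq> fixed_field S"
      unfolding LU_def using fixed by (intro adjoin_fixed[OF endoS]) (auto simp: fixed_field_def)
    then show "L1 \<subseteq> fixed_field S"
      unfolding L1_def using fixed by (intro adjoin_fixed[OF endoS]) (auto simp: fixed_field_def)
    show "monom 1 N - [:z1 * (z1 * z2) ^ m:] \<in> polys_over L1"
      using LU_L1 by (intro L1.polys_diff L1.polys_monom L1.polys_pCons) auto
    have deg: "degree (monom (1 :: 'a) N - [:z1 * (z1 * z2) ^ m:]) = N"
    proof -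
      have "degree [:z1 * (z1 * z2) ^ m:] < degree (monom (1 :: 'a) N)" using N_pos by (simp add: degree_monom_eq)
      then have "degree (monom (1 :: 'a) N - [:z1 * (z1 * z2) ^ m:]) = degree (monom (1 :: 'a) N)"
        by (simp only: diff_conv_add_uminus) (rule degree_add_eq_left, simp)
      then show ?thesis by (simp add: degree_monom_eq)
    qed
    then show "monom 1 N - [:z1 * (z1 * z2) ^ m:] \<noteq> 0" using N_pos by auto
    show "poly (monom 1 N - [:z1 * (z1 * z2) ^ m:]) y1 = 0"
      unfolding z12 using y_nz by (simp add: poly_monom z1_def)
    have "inj_on (\<lambda>j. \<zeta> ^ (3 * j) * y1) {..<N}"
    proof (rule linorder_inj_onI)
      fix i j assume ij: "i < j" "i \<in> {..<N}" "j \<in> {..<N}"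
      show "\<zeta> ^ (3 * i) * y1 \<noteq> \<zeta> ^ (3 * j) * y1"
      proof
        assume "\<zeta> ^ (3 * i) * y1 = \<zeta> ^ (3 * j) * y1"
        then have "\<zeta> ^ (3 * i) = \<zeta> ^ (3 * j)" using y_nz by simp
        also have "3 * j = 3 * i + 3 * (j - i)" using ij by simp
        finally have "\<zeta> ^ (3 * (j - i)) = 1" using zeta_nz by (simp only: power_add) simp
        then have "N dvd j - i" using const(7)[of "3 * (j - i)"] by (simp add: N_def)
        then show False using ij by (auto dest: dvd_imp_le)
      qed
    qed auto
    then have "card ((\<lambda>\<sigma>. \<sigma> y1) ` S) = N"
      by (simp add: S_def image_image ta_pow_y card_image)
    then show "degree (monom 1 N - [:z1 * (z1 * z2) ^ m:]) \<le> card ((\<lambda>\<sigma>. \<sigma> y1) ` S)" using deg by simp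
    show "f \<in> fixed_field S" using assms S_sub by (auto simp: fixed_field_def)
    interpret E: subfld "adjoin L1 {y1}" by (rule subfld_adjoin)
    have y1: "y1 \<in> adjoin L1 {y1}" and E: "L1 \<subseteq> adjoin L1 {y1}"
      using adjoin_incl(1)[of L1 "{y1}"] adjoin_incl(2)[of "{y1}" L1] by auto
    have "z1 * z2 / y1 \<in> adjoin L1 {y1}" using y1 E LU_L1 by blast
    then have "y2 \<in> adjoin L1 {y1}" using z12 y_nz by simp
    then have "L0 \<subseteq> adjoin L1 {y1}"
      unfolding L0_def using y1 E LU_L1(1) k0_LU x_LU by (intro adjoin_subset_adjoin) auto
    then show "f \<in> adjoin L1 {y1}" using assms by blast
  qed
qed

text \<open>A linear substitution preserves degrees, so if it fixes \<open>x\<^sub>1 + x\<^sub>1 x\<^sub>2\<close>, it fixes \<open>x\<^sub>1\<close> and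
  \<open>x\<^sub>1 x\<^sub>2\<close>, hence \<open>x\<^sub>2\<close>.\<close>

lemma x_fixed_if_theta_fixed:
  assumes s: "\<sigma> \<in> \<Gamma>" and th: "\<sigma> (x1 + x1 * x2) = x1 + x1 * x2"
  shows "\<sigma> x1 = x1 \<and> \<sigma> x2 = x2"
proof -
  interpret s: endo \<sigma> using endo[OF s] .
  obtain a b c d where k: "a \<in> k0" "b \<in> k0" "c \<in> k0" "d \<in> k0"
    and lin: "\<sigma> x1 = a * x1 + c * x2" "\<sigma> x2 = b * x1 + d * x2" using lin_x[OF s] by blast
  have a0: "adjoin k0 {} = k0" using k0 by (rule adjoin_empty)
  interpret A: subfld "adjoin k0 {x1}" by (rule subfld_adjoin)
  have kA: "x \<in> adjoin k0 {x1}" if "x \<in> k0" for x using that adjoin_incl(1)[of k0 "{x1}"] by blast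
  have xA: "x1 \<in> adjoin k0 {x1}" using adjoin_incl(2)[of "{x1}" k0] by simp
  let ?p = "[:a * x1 + a * b * x1 * x1 - x1, c + c * b * x1 + a * d * x1 - x1, c * d:]"
  have "poly ?p x2 = \<sigma> (x1 + x1 * x2) - (x1 + x1 * x2)"
    unfolding s.add s.mult lin by (simp add: algebra_simps)
  then have "poly ?p x2 = 0" by (simp only: th diff_self)
  moreover have "?p \<in> polys_over (adjoin k0 {x1})"
    by (intro A.polys_pCons A.polys_0 A.add A.diff A.mult kA k xA)
  ultimately have "?p = 0" using transcendental_coeffs_0[OF tr(2)] by blast
  then have *: "a * x1 + a * b * x1 * x1 - x1 = 0" "c + c * b * x1 + a * d * x1 - x1 = 0" by auto
  have "poly [:0, a - 1, a * b:] x1 = 0" "poly [:c, c * b + a * d - 1:] x1 = 0"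
    using * by (simp_all add: algebra_simps)
  moreover have "[:0, a - 1, a * b:] \<in> polys_over (adjoin k0 {})" "[:c, c * b + a * d - 1:] \<in> polys_over (adjoin k0 {})"
    unfolding a0 using k by (intro k0.polys_pCons k0.polys_0; auto)+
  ultimately have "[:0, a - 1, a * b:] = 0" "[:c, c * b + a * d - 1:] = 0"
    using transcendental_coeffs_0[OF tr(1)] by blast+
  then have "a = 1" "b = 0" "c = 0" "d = 1" by auto
  then show ?thesis using lin by simp
qed

text \<open>An automorphism that fixes \<open>x\<^sub>1\<close> and \<open>x\<^sub>2\<close> fixes \<open>v\<close>, which excludes a factor \<open>\<nu>\<close>, and \<open>w\<close>, which
  makes the exponent of \<open>\<tau>\<close> divisible by \<open>3\<close>.\<close>

lemma trivial_on_L1: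
  assumes s: "\<sigma> \<in> \<Gamma>" and x: "\<sigma> x1 = x1" "\<sigma> x2 = x2"
  shows "\<sigma> z1 = z1 \<and> \<sigma> z2 = z2"
proof -
  interpret s: endo \<sigma> using endo[OF s] .
  have fx: "\<sigma> w = w" "\<sigma> v = v"
    using x by (simp_all add: w_def v_def qa_def qb_def qc_def)
  obtain i j k e where e: "e < 2" "\<sigma> = la ^^ i \<circ> ro ^^ j \<circ> ta ^^ k \<circ> nu ^^ e" using normal_form[OF s] by blast
  have fun_fix: "(g ^^ n) y = y" if "g y = y" for g :: "'a \<Rightarrow> 'a" and y n using that by (induction n) auto
  have nu1: "nu ^^ e = id"
  proof (rule ccontr)
    assume ne: "nu ^^ e \<noteq> id"
    then have "e = 1" using e(1) by (cases "e = 0") auto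
    then have "nu \<noteq> id" using ne by auto
    then have "\<sigma> v = (la ^^ i) ((ro ^^ j) ((ta ^^ k) (- v)))"
      using anti_invariants_nu \<open>e = 1\<close> by (simp add: e(2))
    also have "\<dots> = - v"
      using fun_fix[of ta "- v"] fun_fix[of ro "- v"] fun_fix[of la "- v"]
      by (simp add: invariants_la invariants_ro invariants_ta)
    finally show False using fx(2) one_neq_minus_one[OF q_nz(5)] by simp
  qed
  have ta3: "(ta ^^ 3) w = w" using ta_w(3) by (simp add: numeral_3_eq_3)
  have "(ta ^^ k) w = (ta ^^ (k mod 3)) w"
  proof -
    have "(ta ^^ (3 * (k div 3))) w = w"
      using fun_fix[of "ta ^^ 3" w] ta3 by (simp add: funpow_mult)
    moreover have "(ta ^^ k) w = (ta ^^ (k mod 3 + 3 * (k div 3))) w" by simp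
    ultimately show ?thesis by (simp only: funpow_add comp_apply)
  qed
  moreover have "k mod 3 < 3" by simp
  then have "k mod 3 = 0 \<or> k mod 3 = 1 \<or> k mod 3 = 2" by linarith
  ultimately have tw: "(ta ^^ k) w \<in> {w, ta w, ta (ta w)}" and k3: "(ta ^^ k) w = w \<Longrightarrow> 3 dvd k"
    using w_conjugates by (auto simp: numeral_2_eq_2 dvd_eq_mod_eq_0)
  have "la (ta w) = ta w" "ro (ta w) = ta w" unfolding ta_w(1) by (simp_all add: la_q ro_q)
  moreover have "la (ta (ta w)) = ta (ta w)" "ro (ta (ta w)) = ta (ta w)"
    unfolding ta_w(2) by (simp_all add: la_q ro_q)
  ultimately have "la y = y \<and> ro y = y" if "y \<in> {w, ta w, ta (ta w)}" for y
    using that invariants_la(1) invariants_ro(1) by auto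
  then have "\<sigma> w = (ta ^^ k) w"
    using tw fun_fix[of ro "(ta ^^ k) w"] fun_fix[of la "(ta ^^ k) w"] nu1 by (simp add: e(2))
  then have "3 dvd k" using k3 fx by simp
  have y: "\<sigma> y1 = \<zeta> ^ k * y1" "\<sigma> y2 = y2 / \<zeta> ^ k"
  proof -
    have lr: "(la ^^ i) y1 = y1" "(la ^^ i) y2 = y2" "(ro ^^ j) y1 = y1" "(ro ^^ j) y2 = y2"
      by (simp_all add: fun_fix la ro)
    have "\<zeta> ^ k \<in> k0" using const by auto
    then have "\<tau> (\<zeta> ^ k) = \<zeta> ^ k" if "\<tau> \<in> \<Gamma>" for \<tau> using const_fixed that by blast
    then have z: "(la ^^ i) (\<zeta> ^ k) = \<zeta> ^ k" "(ro ^^ j) (\<zeta> ^ k) = \<zeta> ^ k" using gens funpow_in by blast+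
    interpret lai: endo "la ^^ i" using gens funpow_in endo by blast
    interpret roj: endo "ro ^^ j" using gens funpow_in endo by blast
    show "\<sigma> y1 = \<zeta> ^ k * y1" "\<sigma> y2 = y2 / \<zeta> ^ k"
      using nu1 lr z by (simp_all add: e(2) ta_pow_y del: lai.power roj.power)
  qed
  obtain k' where "k = 3 * k'" using \<open>3 dvd k\<close> by (rule dvdE)
  then have "\<zeta> ^ (k * N) = 1" unfolding const(7) by (simp add: N_def)
  then have "(\<zeta> ^ k) ^ N = 1" by (simp add: power_mult)
  then show ?thesis
    using z_transform(1)[OF s _ y] zeta_nz by (simp add: power_inverse)
qed

lemma stable_adjoin_k0:
  assumes "\<And>\<sigma> b. \<sigma> \<in> \<Gamma> \<Longrightarrow> b \<in> B \<Longrightarrow> \<sigma> b \<in> adjoin k0 B" "\<sigma> \<in> \<Gamma>" "x \<in> adjoin k0 B"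
  shows "\<sigma> x \<in> adjoin k0 B"
proof (rule adjoin_stable[OF endos[OF assms(2)] _ _ assms(3)])
  show "\<sigma> x \<in> adjoin k0 B" if "x \<in> k0" for x
    using that const_fixed[OF assms(2)] adjoin_incl(1)[of k0 B] by auto
qed (use assms in auto)

lemma x_stable: "\<sigma> \<in> \<Gamma> \<Longrightarrow> \<sigma> x1 \<in> LU \<and> \<sigma> x2 \<in> LU"
proof -
  assume *: "\<sigma> \<in> \<Gamma>"
  obtain p q r s where k: "p \<in> k0" "q \<in> k0" "r \<in> k0" "s \<in> k0"
    and lin: "\<sigma> x1 = p * x1 + r * x2" "\<sigma> x2 = q * x1 + s * x2" using lin_x[OF *] by blast
  have "p \<in> LU" "q \<in> LU" "r \<in> LU" "s \<in> LU" using k k0_LU by blast+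
  then show ?thesis unfolding lin using x_LU by (intro conjI LU.add LU.mult)
qed

lemma LU_stable: "\<sigma> \<in> \<Gamma> \<Longrightarrow> x \<in> LU \<Longrightarrow> \<sigma> x \<in> LU"
  unfolding LU_def by (rule stable_adjoin_k0) (use x_stable in \<open>auto simp: LU_def\<close>)

lemma L0_incl: "k0 \<subseteq> L0" "LU \<subseteq> L0" "x1 \<in> L0" "x2 \<in> L0" "y1 \<in> L0" "y2 \<in> L0"
  using adjoin_incl(1)[of k0 "{x1, x2, y1, y2}"] adjoin_incl(2)[of "{x1, x2, y1, y2}" k0]
    adjoin_mono[of k0 k0 "{x1, x2}" "{x1, x2, y1, y2}"]
  by (auto simp: L0_def LU_def)

lemma L0_stable:
  assumes "\<sigma> \<in> \<Gamma>" "x \<in> L0"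
  shows "\<sigma> x \<in> L0"
proof -
  interpret L0: subfld L0 unfolding L0_def by (rule subfld_adjoin)
  have "\<sigma> b \<in> adjoin k0 {x1, x2, y1, y2}" if s: "\<sigma> \<in> \<Gamma>" and b: "b \<in> {x1, x2, y1, y2}" for \<sigma> b
  proof -
    obtain p where "p \<in> k0" "\<sigma> y1 = p * y1 \<and> \<sigma> y2 = y2 / p \<or> \<sigma> y1 = p * y2 \<and> \<sigma> y2 = y1 / p"
      using lin_y[OF s] by blast
    then have "\<sigma> y1 \<in> L0 \<and> \<sigma> y2 \<in> L0" using L0_incl by (metis L0.div L0.mult subsetD)
    then show ?thesis using b x_stable[OF s] L0_incl(2) by (auto simp: L0_def)
  qed
  then show ?thesis using assms unfolding L0_def by (rule stable_adjoin_k0)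
qed

lemma L0_fixed: "\<exists>B. finite B \<and> card B \<le> 4 \<and> L0 \<inter> Fix = adjoin k0 B"
proof -
  have fixLU: "\<sigma> x = x" if "\<sigma> \<in> \<Gamma>" "\<sigma> x1 = x1" "\<sigma> x2 = x2" "x \<in> LU" for \<sigma> x
  proof -
    have "LU \<subseteq> fixed_field {\<sigma>}" unfolding LU_def
      using that endos const_fixed by (intro adjoin_fixed) (auto simp: fixed_field_def)
    then show ?thesis using that by (auto simp: fixed_field_def)
  qed
  have "\<exists>T. finite T \<and> card T \<le> card {z1, z2} \<and> adjoin LU {z1, z2} \<inter> Fix = adjoin (LU \<inter> Fix) T"
  proof (rule no_name[where L = LU and \<theta> = "x1 + x1 * x2"])
    show "is_subfield LU" by (rule LU.sub)
    show "\<sigma> x \<in> LU" if "\<sigma> \<in> \<Gamma>" "x \<in> LU" for \<sigma> x using that by (rule LU_stable)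
    show "x1 + x1 * x2 \<in> LU" using x_LU by auto
    show "\<sigma> z \<in> lspan LU (insert 1 {z1, z2})" if s: "\<sigma> \<in> \<Gamma>" and z: "z \<in> {z1, z2}" for \<sigma> z
    proof -
      obtain p where p: "p \<in> k0" "p \<noteq> 0"
        "\<sigma> y1 = p * y1 \<and> \<sigma> y2 = y2 / p \<or> \<sigma> y1 = p * y2 \<and> \<sigma> y2 = y1 / p"
        using lin_y[OF s] by blast
      then have "\<sigma> z1 = p ^ N * z1 \<and> \<sigma> z2 = inverse p ^ N * z2 \<or> \<sigma> z1 = p ^ N * z2 \<and> \<sigma> z2 = inverse p ^ N * z1"
        using z_transform[OF s p(2)] by blast
      moreover have "p ^ N \<in> k0" "inverse p ^ N \<in> k0" using p(1) by auto
      ultimately have "\<exists>q\<in>k0. \<exists>z'\<in>{z1, z2}. \<sigma> z = q * z'" using z by blast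
      then obtain q z' where "q \<in> k0" "z' \<in> {z1, z2}" "\<sigma> z = q * z'" by blast
      then show ?thesis
        using k0_LU LU.lspan_superset[of "insert 1 {z1, z2}"] by (auto intro!: LU.lspan_scale)
    qed
    show "\<sigma> x = x" if s: "\<sigma> \<in> \<Gamma>" and th: "\<sigma> (x1 + x1 * x2) = x1 + x1 * x2" and x: "x \<in> LU \<union> {z1, z2}" for \<sigma> x
      using x_fixed_if_theta_fixed[OF s th] trivial_on_L1[OF s] fixLU[OF s] x by auto
  qed auto
  then obtain T where T: "finite T" "card T \<le> 2" "L1 \<inter> Fix = adjoin (LU \<inter> Fix) T"
    using card_insert_le_m1[of 2 "{z2}" z1] by (auto simp: L1_def card_insert_if split: if_splits)
  obtain B where B: "finite B" "card B \<le> 2" "LU \<inter> Fix = adjoin k0 B" using LU_fixed by blast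
  have "L1 \<subseteq> L0"
  proof -
    interpret L0: subfld L0 unfolding L0_def by (rule subfld_adjoin)
    have "z1 \<in> L0" "z2 \<in> L0" using L0_incl unfolding z1_def z2_def by blast+
    then show ?thesis unfolding L1_def using L0_incl L0.sub by (intro adjoin_least) auto
  qed
  then have "L0 \<inter> Fix = L1 \<inter> Fix" using fixed_by_tau_cubed by blast
  also have "\<dots> = adjoin k0 (B \<union> T)" using T B by (simp add: adjoin_adjoin)
  finally show ?thesis
    using T(1,2) B(1,2) card_Un_le[of B T] by (intro exI[of _ "B \<union> T"]) auto
qed

text \<open>The element \<open>x\<^sub>1 + x\<^sub>1 x\<^sub>2 + x\<^sub>1 x\<^sub>2 y\<^sub>1\<close> has a trivial stabilizer: considered as a polynomial in
  the \<open>y\<^sub>i\<close>, its constant term determines the action on \<open>x\<^sub>1, x\<^sub>2\<close>, and its linear term that on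
  \<open>y\<^sub>1, y\<^sub>2\<close>.\<close>

theorem fixed_field_generators:
  assumes Z: "finite Z" "\<And>\<sigma> z. \<sigma> \<in> \<Gamma> \<Longrightarrow> z \<in> Z \<Longrightarrow> \<sigma> z \<in> lspan L0 (insert 1 Z)"
    and faithful: "\<And>\<sigma> z. \<sigma> \<in> \<Gamma> \<Longrightarrow> \<sigma> x1 = x1 \<Longrightarrow> \<sigma> x2 = x2 \<Longrightarrow> \<sigma> y1 = y1 \<Longrightarrow> \<sigma> y2 = y2 \<Longrightarrow> z \<in> Z \<Longrightarrow> \<sigma> z = z"
  shows "\<exists>B. finite B \<and> card B \<le> 4 + card Z \<and> adjoin L0 Z \<inter> Fix = adjoin k0 B"
proof -
  interpret L0: subfld L0 unfolding L0_def by (rule subfld_adjoin)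
  have y_fixed: "\<sigma> x1 = x1 \<and> \<sigma> x2 = x2 \<and> \<sigma> y1 = y1 \<and> \<sigma> y2 = y2"
    if s: "\<sigma> \<in> \<Gamma>" and th: "\<sigma> (x1 + x1 * x2 + x1 * x2 * y1) = x1 + x1 * x2 + x1 * x2 * y1" for \<sigma>
  proof -
    interpret s: endo \<sigma> using endo[OF s] .
    define P Q where "P = \<sigma> x1" and "Q = \<sigma> x2"
    have PQ: "P \<in> LU" "Q \<in> LU" "P \<noteq> 0" "Q \<noteq> 0" using x_stable[OF s] x_nz by (auto simp: P_def Q_def)
    obtain p where p: "p \<in> k0" "p \<noteq> 0"
      "\<sigma> y1 = p * y1 \<and> \<sigma> y2 = y2 / p \<or> \<sigma> y1 = p * y2 \<and> \<sigma> y2 = y1 / p"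
      using lin_y[OF s] by blast
    then consider "\<sigma> y1 = p * y2" | "\<sigma> y1 = p * y1" "\<sigma> y2 = y2 / p" by blast
    then show ?thesis
    proof cases
      case 1
      let ?A = "adjoin k0 {x1, x2, y1}"
      interpret A: subfld ?A by (rule subfld_adjoin)
      have sub: "LU \<subseteq> ?A" unfolding LU_def by (rule adjoin_mono) auto
      have y1: "y1 \<in> ?A" using adjoin_incl(2)[of "{x1, x2, y1}" k0] by auto
      let ?p = "[:P + P * Q - (x1 + x1 * x2 + x1 * x2 * y1), P * Q * p:]"
      have "poly ?p y2 = 0" using th by (simp add: P_def Q_def 1 algebra_simps)
      moreover have "?p \<in> polys_over ?A"
        using PQ p(1) y1 sub x_LU k0_LU by (intro A.polys_pCons A.polys_0 A.add A.diff A.mult) auto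
      ultimately have "?p = 0" using transcendental_coeffs_0[OF tr(4)] by blast
      then show ?thesis using PQ p(2) by simp
    next
      case 2
      let ?p = "[:P + P * Q - (x1 + x1 * x2), P * Q * p - x1 * x2:]"
      have "poly ?p y1 = 0" using th by (simp add: P_def Q_def 2 algebra_simps)
      moreover have "?p \<in> polys_over (adjoin k0 {x1, x2})"
        unfolding LU_def[symmetric]
        using PQ p(1) x_LU k0_LU by (intro LU.polys_pCons LU.polys_0 LU.add LU.diff LU.mult) auto
      ultimately have "?p = 0" using transcendental_coeffs_0[OF tr(3)] by blast
      then have "P + P * Q - (x1 + x1 * x2) = 0 \<and> P * Q * p - x1 * x2 = 0" by (simp only: pCons_eq_0_iff)
      then have eq: "P + P * Q = x1 + x1 * x2" "P * Q * p = x1 * x2" by (simp_all only: right_minus_eq)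
      have "\<sigma> (x1 + x1 * x2) = x1 + x1 * x2" using eq(1) by (simp only: P_def Q_def s.add s.mult)
      from x_fixed_if_theta_fixed[OF s this] have x: "\<sigma> x1 = x1" "\<sigma> x2 = x2" by blast+
      then have "p = 1" using eq(2) x_nz by (simp add: P_def Q_def)
      then show ?thesis using x 2 by simp
    qed
  qed
  have fixL0: "\<sigma> x = x" if "\<sigma> \<in> \<Gamma>" "\<sigma> x1 = x1 \<and> \<sigma> x2 = x2 \<and> \<sigma> y1 = y1 \<and> \<sigma> y2 = y2" "x \<in> L0" for \<sigma> x
  proof -
    have "L0 \<subseteq> fixed_field {\<sigma>}" unfolding L0_def
      using that endos const_fixed by (intro adjoin_fixed) (auto simp: fixed_field_def)
    then show ?thesis using that by (auto simp: fixed_field_def)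
  qed
  have "\<exists>T. finite T \<and> card T \<le> card Z \<and> adjoin L0 Z \<inter> Fix = adjoin (L0 \<inter> Fix) T"
  proof (rule no_name[where L = L0 and \<theta> = "x1 + x1 * x2 + x1 * x2 * y1"])
    show "is_subfield L0" by (rule L0.sub)
    show "\<sigma> x \<in> L0" if "\<sigma> \<in> \<Gamma>" "x \<in> L0" for \<sigma> x using that by (rule L0_stable)
    show "\<sigma> z \<in> lspan L0 (insert 1 Z)" if "\<sigma> \<in> \<Gamma>" "z \<in> Z" for \<sigma> z using that by (rule Z)
    show "finite Z" by (rule Z)
    show "x1 + x1 * x2 + x1 * x2 * y1 \<in> L0" using L0_incl by auto
    show "\<sigma> x = x" if "\<sigma> \<in> \<Gamma>" "\<sigma> (x1 + x1 * x2 + x1 * x2 * y1) = x1 + x1 * x2 + x1 * x2 * y1" "x \<in> L0 \<union> Z" for \<sigma> x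
      using y_fixed[OF that(1,2)] fixL0[OF that(1)] faithful[OF that(1)] that(3) by blast
  qed
  then obtain T where T: "finite T" "card T \<le> card Z" "adjoin L0 Z \<inter> Fix = adjoin (L0 \<inter> Fix) T" by blast
  obtain B where B: "finite B" "card B \<le> 4" "L0 \<inter> Fix = adjoin k0 B" using L0_fixed by blast
  have "adjoin L0 Z \<inter> Fix = adjoin k0 (B \<union> T)" using T(3) B(3) by (simp only: adjoin_adjoin)
  moreover have "card (B \<union> T) \<le> 4 + card Z" using card_Un_le[of B T] T(2) B(2) by linarith
  ultimately show ?thesis using T(1) B(1) by (intro exI[of _ "B \<union> T"]) simp
qed

end

section \<open>The regular representation\<close>

lemma ratfun_const_divide:
  "ratfun_const (a / b) = (ratfun_const a / ratfun_const b :: ('i, 'k::field) ratfun)"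
  by (simp add: divide_inverse ratfun_const_hom ratfun_const_inverse)

lemma ratfun_const_power: "ratfun_const (a ^ n) = (ratfun_const a ^ n :: ('i, 'k::field) ratfun)"
  by (induction n) (simp_all add: ratfun_const_hom)

lemma ratfun_const_of_nat: "ratfun_const (of_nat n) = (of_nat n :: ('i, 'k::field) ratfun)"
  by (induction n) (simp_all add: ratfun_const_hom)

lemma ratfun_const_numeral: "ratfun_const (numeral n) = (numeral n :: ('i, 'k::field) ratfun)"
  using ratfun_const_of_nat[of "numeral n"] by simp

lemmas ratfun_const_simps = ratfun_const_hom ratfun_const_uminus ratfun_const_diff ratfun_const_inverse
  ratfun_const_divide ratfun_const_power ratfun_const_numeral

lemma ratfun_const_eq_iff: "ratfun_const a = (ratfun_const b :: ('i, 'k::field) ratfun) \<longleftrightarrow> a = b"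
  using inj_ratfun_const by (auto dest: injD)

text \<open>A finite group with the two representations \<open>RU\<close>, a binary octahedral (or tetrahedral) one, and
  \<open>RD\<close>, a dihedral (or cyclic) one.  The case \<open>n = \<one>\<close> is that of \<open>G\<^sub>1\<close>.\<close>

locale octahedral_group = group G for G (structure) +
  fixes RU RD :: "'a \<Rightarrow> 'k::field mat2" and l r t n :: 'a and im c \<zeta> :: 'k and L :: nat
  assumes fin: "finite (carrier G)" and infinite_type: "infinite (UNIV :: 'a set)"
    and closed [simp]: "l \<in> carrier G" "r \<in> carrier G" "t \<in> carrier G" "n \<in> carrier G"
    and RU_mult: "\<And>x y. x \<in> carrier G \<Longrightarrow> y \<in> carrier G \<Longrightarrow> RU (x \<otimes> y) = RU x * RU y" and RU_one: "RU \<one> = 1"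
    and RD_mult: "\<And>x y. x \<in> carrier G \<Longrightarrow> y \<in> carrier G \<Longrightarrow> RD (x \<otimes> y) = RD x * RD y" and RD_one: "RD \<one> = 1"
    and RU_gens: "RU l = Mat2 im 0 0 (- im)" "RU r = Mat2 0 1 (- 1) 0"
      "RU t = Mat2 (- (1 + im) / 2) (- (1 + im) / 2) ((1 - im) / 2) (- (1 - im) / 2)"
    and RD_gens: "RD l = 1" "RD r = 1" "RD t = Mat2 \<zeta> 0 0 (1 / \<zeta>)"
    and n_cases: "n = \<one> \<or> RU n = Mat2 c (- c) (- c) (- c) \<and> RD n = Mat2 0 1 1 0"
    and normal_form: "\<And>g. g \<in> carrier G \<Longrightarrow>
      \<exists>i j k e. j < 2 \<and> e < 2 \<and> g = l [^] (i::nat) \<otimes> r [^] (j::nat) \<otimes> t [^] (k::nat) \<otimes> n [^] (e::nat)"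
    and orders: "l [^] (4::nat) = \<one>" "t [^] (3 * 3 ^ L :: nat) = \<one>"
    and const: "im\<^sup>2 = -1" "2 * c\<^sup>2 = -1" "(2 :: 'k) \<noteq> 0" "\<And>j. \<zeta> ^ j = 1 \<longleftrightarrow> 3 * 3 ^ L dvd j"
begin

abbreviation C :: "'k \<Rightarrow> ('a, 'k) ratfun" where "C \<equiv> ratfun_const"
abbreviation var :: "'a \<Rightarrow> ('a, 'k) ratfun" where "var \<equiv> ratfun_var"
abbreviation tr :: "'a \<Rightarrow> ('a, 'k) ratfun \<Rightarrow> ('a, 'k) ratfun" where "tr \<equiv> translation G"
abbreviation k0 :: "('a, 'k) ratfun set" where "k0 \<equiv> range ratfun_const"

definition lin :: "('a \<Rightarrow> 'k) \<Rightarrow> ('a, 'k) ratfun" where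
  "lin f = (\<Sum>g\<in>carrier G. C (f g) * var g)"

lemma tr_lin:
  assumes h: "h \<in> carrier G"
  shows "tr h (lin f) = lin (\<lambda>g. f (inv h \<otimes> g))"
proof -
  interpret e: endo "tr h" using translation_endo[OF is_group h] by unfold_locales
  have "tr h (lin f) = (\<Sum>g\<in>carrier G. C (f g) * var (h \<otimes> g))"
    unfolding lin_def e.sum e.mult
    by (rule sum.cong) (simp_all add: translation_const[OF is_group h] translation_var[OF is_group h])
  also have "\<dots> = lin (\<lambda>g. f (inv h \<otimes> g))"
    unfolding lin_def
    by (rule sum.reindex_bij_witness[of _ "\<lambda>g. inv h \<otimes> g" "\<lambda>g. h \<otimes> g"])
      (use h in \<open>simp_all add: m_assoc[symmetric]\<close>)
  finally show ?thesis .
qed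

lemma lin_add: "lin (\<lambda>g. a * f g + b * f' g) = C a * lin f + C b * lin f'"
  by (simp add: lin_def ratfun_const_simps sum.distrib sum_distrib_left algebra_simps)

lemma lin_cong: "(\<And>g. g \<in> carrier G \<Longrightarrow> f g = f' g) \<Longrightarrow> lin f = lin f'"
  by (simp add: lin_def)

text \<open>Matrix coefficients, as functions of \<open>g\<inverse>\<close>, give linear forms that span copies of the two
  representations.  For \<open>RU\<close> the first row is taken.  For \<open>RD\<close> it is the sum of the rows, so that the
  coefficients of \<open>q1\<close> and \<open>q2\<close> at \<open>\<one>\<close> and \<open>t\<close> are nonzero and not proportional.\<close>

definition "p1 = lin (\<lambda>g. m11 (RU (inv g)))"
definition "p2 = lin (\<lambda>g. m12 (RU (inv g)))"
definition "q1 = lin (\<lambda>g. m11 (RD (inv g)) + m21 (RD (inv g)))"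
definition "q2 = lin (\<lambda>g. m12 (RD (inv g)) + m22 (RD (inv g)))"

lemma inv_shift:
  assumes "h \<in> carrier G" "g \<in> carrier G"
  shows "RU (inv (inv h \<otimes> g)) = RU (inv g) * RU h" "RD (inv (inv h \<otimes> g)) = RD (inv g) * RD h"
  using assms by (simp_all add: inv_mult_group RU_mult RD_mult)

lemma tr_pq:
  assumes h: "h \<in> carrier G"
  shows "tr h p1 = C (m11 (RU h)) * p1 + C (m21 (RU h)) * p2"
    and "tr h p2 = C (m12 (RU h)) * p1 + C (m22 (RU h)) * p2"
    and "tr h q1 = C (m11 (RD h)) * q1 + C (m21 (RD h)) * q2"
    and "tr h q2 = C (m12 (RD h)) * q1 + C (m22 (RD h)) * q2"
  unfolding p1_def p2_def q1_def q2_def tr_lin[OF h] lin_add[symmetric]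
  using h by (auto intro!: lin_cong simp: inv_shift algebra_simps)

text \<open>The linear forms are independent already on these four elements, so that they can replace the
  corresponding variables.\<close>

definition "four = {\<one>, l \<otimes> l, r, t}"
definition "Z = var ` (carrier G - four)"
definition "P = {p1, p2, q1, q2}"

lemma zeta_nz: "\<zeta> \<noteq> 0"
  using const(4)[of "3 * 3 ^ L"] by (auto simp: power_0_left)

lemma zeta_not_1: "\<zeta> \<noteq> 1" "\<zeta>\<^sup>2 \<noteq> 1"
proof -
  have "1 \<le> (3 :: nat) ^ L" by simp
  then have "3 * 3 ^ L > (2 :: nat)" by linarith
  then have "\<not> 3 * 3 ^ L dvd (1 :: nat)" "\<not> 3 * 3 ^ L dvd (2 :: nat)" by (auto dest: dvd_imp_le)
  then show "\<zeta> \<noteq> 1" "\<zeta>\<^sup>2 \<noteq> 1" using const(4)[of 1] const(4)[of 2] by auto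
qed

lemma minus_one_neq_one: "- 1 \<noteq> (1 :: 'k)"
  using const(3) by (metis add.right_inverse one_add_one)

lemma RU_ll: "RU (l \<otimes> l) = Mat2 (- 1) 0 0 (- 1)"
  using const(1) by (auto simp: RU_mult RU_gens power2_eq_square intro!: mat2_eqI)

lemma four_subset: "four \<subseteq> carrier G"
  by (simp add: four_def)

lemma four_distinct: "l \<otimes> l \<noteq> \<one>" "r \<noteq> \<one>" "r \<noteq> l \<otimes> l" "t \<noteq> \<one>" "t \<noteq> l \<otimes> l" "t \<noteq> r"
proof -
  have "RD t \<noteq> 1" using zeta_not_1 by (auto simp: RD_gens dest: arg_cong[of _ _ m11])
  then show "t \<noteq> \<one>" "t \<noteq> l \<otimes> l" "t \<noteq> r" using RD_gens RD_one RD_mult[of l l] by auto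
  have "RU (l \<otimes> l) \<noteq> 1" using minus_one_neq_one unfolding RU_ll by (auto dest: arg_cong[of _ _ m11])
  then show "l \<otimes> l \<noteq> \<one>" using RU_one by auto
  have "RU r \<noteq> 1" "RU r \<noteq> RU (l \<otimes> l)" unfolding RU_gens RU_ll by (auto dest: arg_cong[of _ _ m11])
  then show "r \<noteq> \<one>" "r \<noteq> l \<otimes> l" using RU_one by auto
qed

lemma card_four: "card four = 4"
  using four_distinct[symmetric] by (simp add: four_def card_insert_if)

lemma sum_four: "sum f four = f \<one> + f (l \<otimes> l) + f r + f t"
  using four_distinct[symmetric] by (simp add: four_def add_ac)

lemma card_Z: "finite Z" "4 + card Z = card (carrier G)"
proof -
  show "finite Z" using fin by (simp add: Z_def)
  have "card Z = card (carrier G - four)"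
    unfolding Z_def by (rule card_image) (auto simp: inj_on_def ratfun_var_inject)
  also have "\<dots> = card (carrier G) - 4" using card_Diff_subset[OF _ four_subset] fin card_four
    by (metis four_subset finite_subset)
  finally show "4 + card Z = card (carrier G)" using card_mono[OF fin four_subset] card_four by simp
qed

lemma inverse_coeffs:
  "m11 (RU (inv \<one>)) = 1" "m12 (RU (inv \<one>)) = 0" "m11 (RU (inv (l \<otimes> l))) = - 1" "m12 (RU (inv (l \<otimes> l))) = 0"
  "m11 (RU (inv r)) = 0" "m12 (RU (inv r)) = - 1"
  "RD (inv \<one>) = 1" "RD (inv (l \<otimes> l)) = 1" "RD (inv r) = 1" "RD (inv t) = Mat2 (1 / \<zeta>) 0 0 \<zeta>"
proof -
  have inv: "RU (inv g) * RU g = 1" "RD (inv g) * RD g = 1" if "g \<in> carrier G" for g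
    using that by (simp_all add: RU_one RD_one flip: RU_mult RD_mult)
  show "m11 (RU (inv \<one>)) = 1" "m12 (RU (inv \<one>)) = 0" "RD (inv \<one>) = 1"
    by (simp_all add: RU_one RD_one)
  have "RU (inv (l \<otimes> l)) * Mat2 (- 1) 0 0 (- 1) = 1" using inv(1)[of "l \<otimes> l"] by (simp add: RU_ll)
  from arg_cong[OF this, of m11] arg_cong[OF this, of m12]
  have "- m11 (RU (inv (l \<otimes> l))) = 1" "- m12 (RU (inv (l \<otimes> l))) = 0" by simp_all
  then show "m11 (RU (inv (l \<otimes> l))) = - 1" "m12 (RU (inv (l \<otimes> l))) = 0" by (metis minus_minus, simp)
  have "RU (inv r) * Mat2 0 1 (- 1) 0 = 1" using inv(1)[of r] by (simp add: RU_gens)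
  from arg_cong[OF this, of m11] arg_cong[OF this, of m12]
  have "- m12 (RU (inv r)) = 1" "m11 (RU (inv r)) = 0" by simp_all
  then show "m11 (RU (inv r)) = 0" "m12 (RU (inv r)) = - 1" by (simp, metis minus_minus)
  show "RD (inv (l \<otimes> l)) = 1" using inv(2)[of "l \<otimes> l"] by (simp add: RD_mult RD_gens)
  show "RD (inv r) = 1" using inv(2)[of r] by (simp add: RD_gens)
  have *: "RD (inv t) * Mat2 \<zeta> 0 0 (1 / \<zeta>) = 1" using inv(2)[of t] by (simp add: RD_gens)
  show "RD (inv t) = Mat2 (1 / \<zeta>) 0 0 \<zeta>"
    using arg_cong[OF *, of m11] arg_cong[OF *, of m12] arg_cong[OF *, of m21] arg_cong[OF *, of m22] zeta_nz
    by (intro mat2_eqI) (auto simp: field_simps)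
qed

definition "L0 = adjoin k0 P"

interpretation L0: subfld L0 unfolding L0_def by (rule subfld_adjoin)

lemma C_L0: "C a \<in> L0"
  using adjoin_incl(1)[of k0 P] by (auto simp: L0_def)

text \<open>Modulo \<open>Z\<close> the forms \<open>q1 - q2\<close>, \<open>p2\<close>, \<open>p1 + q1\<close> and \<open>p1\<close> yield, in this order, the variables
  of \<open>t\<close>, \<open>r\<close>, \<open>\<one>\<close> and \<open>l\<^sup>2\<close>.\<close>

lemma var_in_span:
  assumes "g \<in> carrier G"
  shows "var g \<in> lspan L0 (insert 1 Z)"
proof -
  define W where "W = lspan L0 (insert 1 Z)"
  have W_add: "x + y \<in> W" "x - y \<in> W" if "x \<in> W" "y \<in> W" for x y
    using that L0.lspan_diff lspan_add by (auto simp: W_def)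
  have W_scale: "a * x \<in> W" if "a \<in> L0" "x \<in> W" for a x
    using that L0.lspan_scale by (auto simp: W_def)
  have W_L0: "a \<in> W" if "a \<in> L0" for a
    using W_scale[OF that, of 1] L0.lspan_superset[of "insert 1 Z"] by (auto simp: W_def)
  have W_Z: "var g \<in> W" if "g \<in> carrier G - four" for g
    using that L0.lspan_superset[of "insert 1 Z"] by (auto simp: W_def Z_def)
  have W_div: "x \<in> W" if "C a * x \<in> W" "a \<noteq> 0" for a x
    using W_scale[OF C_L0[of "inverse a"] that(1)] that(2)
    by (simp add: ratfun_const_inverse ratfun_const_eq_0_iff flip: mult.assoc)
  have lin: "C (f \<one>) * var \<one> + C (f (l \<otimes> l)) * var (l \<otimes> l) + C (f r) * var r + C (f t) * var t \<in> W"
    if "lin f \<in> P" for f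
  proof -
    have "lin f \<in> W" using that adjoin_incl(2)[of P k0] by (intro W_L0) (auto simp: L0_def)
    moreover have "lin f = (\<Sum>g\<in>carrier G - four. C (f g) * var g) + (\<Sum>g\<in>four. C (f g) * var g)"
      unfolding lin_def by (rule sum.subset_diff[OF four_subset fin])
    moreover have "(\<Sum>g\<in>carrier G - four. C (f g) * var g) \<in> W"
      unfolding W_def using W_Z by (intro lspan_sum L0.lspan_scale C_L0) (auto simp: W_def)
    ultimately have "(\<Sum>g\<in>four. C (f g) * var g) \<in> W"
      using W_add(2)[of "lin f" "\<Sum>g\<in>carrier G - four. C (f g) * var g"] by simp
    moreover have "(\<Sum>g\<in>four. C (f g) * var g) =
        C (f \<one>) * var \<one> + C (f (l \<otimes> l)) * var (l \<otimes> l) + C (f r) * var r + C (f t) * var t"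
      by (rule sum_four)
    ultimately show ?thesis by simp
  qed
  have "lin (\<lambda>g. m11 (RU (inv g))) \<in> P" "lin (\<lambda>g. m12 (RU (inv g))) \<in> P"
    "lin (\<lambda>g. m11 (RD (inv g)) + m21 (RD (inv g))) \<in> P" "lin (\<lambda>g. m12 (RD (inv g)) + m22 (RD (inv g))) \<in> P"
    by (simp_all add: P_def p1_def p2_def q1_def q2_def)
  note e = this[THEN lin]
  define \<alpha> \<beta> where "\<alpha> = m11 (RU (inv t))" and "\<beta> = m12 (RU (inv t))"
  have e1: "var \<one> - var (l \<otimes> l) + C \<alpha> * var t \<in> W" and e2: "C \<beta> * var t - var r \<in> W"
    using e(1,2) by (simp_all add: inverse_coeffs ratfun_const_simps \<alpha>_def \<beta>_def del: inv_one)
  have e3: "var \<one> + var (l \<otimes> l) + var r + C (1 / \<zeta>) * var t \<in> W" and e4: "var \<one> + var (l \<otimes> l) + var r + C \<zeta> * var t \<in> W"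
    using e(3,4) by (simp_all add: inverse_coeffs ratfun_const_hom del: inv_one)
  have "C (1 / \<zeta> - \<zeta>) * var t \<in> W" using W_add(2)[OF e3 e4] by (simp add: ratfun_const_diff algebra_simps)
  moreover have "1 / \<zeta> - \<zeta> \<noteq> 0" using zeta_not_1 zeta_nz by (simp add: field_simps power2_eq_square)
  ultimately have t: "var t \<in> W" by (rule W_div)
  have r: "var r \<in> W" using W_add(2)[OF W_scale[OF C_L0 t, of \<beta>] e2] by simp
  have "C 2 * var \<one> \<in> W"
    using W_add(2)[OF W_add(2)[OF W_add(2)[OF W_add(1)[OF e1 e3] W_scale[OF C_L0 t, of \<alpha>]] W_scale[OF C_L0 t, of "1 / \<zeta>"]] r]
    by (simp add: ratfun_const_numeral algebra_simps)
  then have o: "var \<one> \<in> W" using const(3) by (rule W_div)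
  have z: "var (l \<otimes> l) \<in> W"
    using W_add(2)[OF W_add(1)[OF o W_scale[OF C_L0 t, of \<alpha>]] e1] by (simp add: algebra_simps)
  show ?thesis
    using assms W_Z[of g] t r o z unfolding W_def[symmetric] by (cases "g \<in> four") (auto simp: four_def)
qed

lemma generators: "adjoin L0 Z = adjoin k0 (var ` carrier G)"
proof
  have "lin f \<in> adjoin k0 (var ` carrier G)" for f
  proof -
    interpret E: subfld "adjoin k0 (var ` carrier G)" by (rule subfld_adjoin)
    show ?thesis unfolding lin_def
      using adjoin_incl(1)[of k0 "var ` carrier G"] adjoin_incl(2)[of "var ` carrier G" k0]
      by (intro E.sum E.mult) auto
  qed
  then have "P \<subseteq> adjoin k0 (var ` carrier G)" by (auto simp: P_def p1_def p2_def q1_def q2_def)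
  then have "L0 \<subseteq> adjoin k0 (var ` carrier G)" unfolding L0_def by (intro adjoin_subset_adjoin adjoin_incl)
  then show "adjoin L0 Z \<subseteq> adjoin k0 (var ` carrier G)"
    using adjoin_incl(2)[of "var ` carrier G" k0] by (intro adjoin_subset_adjoin) (auto simp: Z_def)
  have "insert 1 Z \<subseteq> adjoin L0 Z"
    using adjoin_incl(2)[of Z L0] subfld.one[OF subfld_adjoin] by auto
  then have "var ` carrier G \<subseteq> adjoin L0 Z" using var_in_span L0.lspan_subset_adjoin by blast
  then show "adjoin k0 (var ` carrier G) \<subseteq> adjoin L0 Z"
    using adjoin_incl(1)[of L0 Z] adjoin_incl(1)[of k0 P] by (intro adjoin_subset_adjoin) (auto simp: L0_def)
qed

lemma vars_indep: "acl_indep k0 (var ` carrier G)" "finite (var ` carrier G)" "card (var ` carrier G) = card (carrier G)"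
  using ratfun_vars_acl_indep[OF infinite_type fin] fin
  by (auto simp: card_image inj_on_def ratfun_var_inject)

text \<open>The forms and the remaining variables are as many as the \<open>x\<^sub>g\<close> and generate the same field.\<close>

lemma P_transcendental:
  "p1 \<notin> acl k0 {}" "p2 \<notin> acl k0 {p1}" "q1 \<notin> acl k0 {p1, p2}" "q2 \<notin> acl k0 {p1, p2, q1}"
proof -
  have le: "card (P \<union> Z) \<le> card P + card Z" by (rule card_Un_le)
  have "card P \<le> 4" by (simp add: P_def card_insert_if)
  then have "card (P \<union> Z) \<le> card (var ` carrier G)" using le card_Z vars_indep by simp
  moreover have "var ` carrier G \<subseteq> acl k0 (P \<union> Z)"
    using adjoin_subset_acl[of k0 "P \<union> Z"] generators adjoin_incl(2)[of "var ` carrier G" k0]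
    by (auto simp: L0_def adjoin_adjoin)
  moreover have "finite (P \<union> Z)" using card_Z by (simp add: P_def)
  ultimately have B: "card (P \<union> Z) = card (var ` carrier G)" "acl_indep k0 (P \<union> Z)"
    using generators_acl_indep[OF vars_indep(2,1)] by blast+
  have "card P = 4" using B(1) le \<open>card P \<le> 4\<close> card_Z vars_indep by simp
  then have d: "p1 \<noteq> p2" "p1 \<noteq> q1" "p1 \<noteq> q2" "p2 \<noteq> q1" "p2 \<noteq> q2" "q1 \<noteq> q2"
    by (auto simp: P_def card_insert_if split: if_splits)
  have tr: "p \<notin> acl k0 A" if "p \<in> P" "A \<subseteq> P - {p}" for p A
  proof -
    have "acl k0 A \<subseteq> acl k0 (P \<union> Z - {p})" using that by (intro acl_mono) auto
    then show ?thesis using B(2) that(1) by (auto simp: acl_indep_def)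
  qed
  show "p1 \<notin> acl k0 {}" "p2 \<notin> acl k0 {p1}" "q1 \<notin> acl k0 {p1, p2}" "q2 \<notin> acl k0 {p1, p2, q1}"
    by (rule tr; use d in \<open>auto simp: P_def\<close>)+
qed

lemma linear_independence:
  assumes "x \<notin> acl k0 A" "y \<notin> acl k0 (insert x A)" "C a * x + C b * y = C a' * x + C b' * y"
  shows "a = a' \<and> b = b'"
proof -
  interpret E: subfld "adjoin k0 (insert x A)" by (rule subfld_adjoin)
  have b: "b = b'"
  proof (rule ccontr)
    assume "b \<noteq> b'"
    have eq: "C (b - b') * y = C (a' - a) * x" using assms(3) by (simp add: ratfun_const_diff algebra_simps)
    then have "y = C (a' - a) * x / C (b - b')" using \<open>b \<noteq> b'\<close>
      by (simp add: eq_divide_eq ratfun_const_eq_0_iff mult.commute)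
    also have "\<dots> \<in> adjoin k0 (insert x A)"
      using adjoin_incl(1)[of k0 "insert x A"] adjoin_incl(2)[of "insert x A" k0] by (intro E.div E.mult) auto
    finally show False using assms(2) adjoin_subset_acl by blast
  qed
  moreover have "x \<noteq> 0" using assms(1) subfld.zero[OF subfld_adjoin] adjoin_subset_acl by blast
  ultimately show ?thesis using assms(3) by (simp add: ratfun_const_eq_iff)
qed

lemma RU_pow: "x \<in> carrier G \<Longrightarrow> RU (x [^] (i::nat)) = RU x ^ i"
  and RD_pow: "x \<in> carrier G \<Longrightarrow> RD (x [^] (i::nat)) = RD x ^ i"
  by (induction i) (simp_all add: RU_one RD_one RU_mult RD_mult power_commutes)

lemma RD_normal:
  "RD (l [^] (i::nat) \<otimes> r [^] (j::nat) \<otimes> t [^] (k::nat) \<otimes> n [^] (e::nat)) = Mat2 (\<zeta> ^ k) 0 0 ((1 / \<zeta>) ^ k) * RD n ^ e"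
  by (simp add: RD_mult RD_pow RD_gens diag_pow)

text \<open>The dihedral representation is faithful on the powers of \<open>t\<close> and on \<open>n\<close>, the other one on the
  quaternion group.\<close>

lemma kernel_trivial:
  assumes g: "g \<in> carrier G" and "RU g = 1" "RD g = 1"
  shows "g = \<one>"
proof -
  obtain i j k e :: nat where je: "j < 2" "e < 2" and g: "g = l [^] i \<otimes> r [^] j \<otimes> t [^] k \<otimes> n [^] e"
    using normal_form[OF g] by blast
  have RD: "Mat2 (\<zeta> ^ k) 0 0 ((1 / \<zeta>) ^ k) * RD n ^ e = 1" using assms(3) unfolding g RD_normal .
  have ne: "n [^] e = \<one>"
  proof (cases "n = \<one>")
    case False
    then have "RD n = Mat2 0 1 1 0" using n_cases by blast
    moreover have "e = 0 \<or> e = 1" using je by linarith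
    ultimately show ?thesis using arg_cong[OF RD, of m11] by auto
  qed simp
  then have "RD n ^ e = 1" using RD_pow[of n e] by (simp add: RD_one)
  then have "\<zeta> ^ k = 1" using arg_cong[OF RD, of m11] by simp
  then obtain k' where "k = 3 * 3 ^ L * k'" using const(4) by (auto elim: dvdE)
  then have tk: "t [^] k = \<one>" using orders(2) nat_pow_pow[of t "3 * 3 ^ L" k'] by simp
  then have g': "g = l [^] i \<otimes> r [^] j" using g ne by simp
  then have RU: "Mat2 (im ^ i) 0 0 ((- im) ^ i) * Mat2 0 1 (- 1) 0 ^ j = 1"
    using assms(2) by (simp add: RU_mult RU_pow RU_gens diag_pow)
  have "j = 0 \<or> j = 1" using je by linarith
  then have j: "j = 0" using arg_cong[OF RU, of m11] by auto
  then have "im ^ i = 1" using arg_cong[OF RU, of m11] by simp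
  moreover have "im ^ i = im ^ (i mod 4)"
  proof -
    have "im ^ 4 = (im\<^sup>2)\<^sup>2" by (simp flip: power_mult)
    then have "im ^ 4 = 1" by (simp add: const)
    then have "im ^ (4 * (i div 4) + i mod 4) = im ^ (i mod 4)" by (simp only: power_add power_mult) simp
    then show ?thesis by simp
  qed
  moreover have "im \<noteq> 1" "im\<^sup>2 \<noteq> 1" "im ^ 3 \<noteq> 1"
  proof -
    show 1: "im \<noteq> 1" "im\<^sup>2 \<noteq> 1" using const(1) minus_one_neq_one by auto
    have "im ^ 3 = - im" using const(1) by (simp add: power3_eq_cube power2_eq_square)
    then show "im ^ 3 \<noteq> 1" using 1 by (metis power2_minus power_one)
  qed
  moreover have "i mod 4 = 0 \<or> i mod 4 = 1 \<or> i mod 4 = 2 \<or> i mod 4 = 3" by linarith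
  ultimately have "i mod 4 = 0" by auto
  then obtain i' where "i = 4 * i'" by auto
  then have "l [^] i = \<one>" using orders(1) nat_pow_pow[of l 4 i'] by simp
  then show ?thesis using g' j by simp
qed

definition "\<Gamma> = tr ` carrier G"

lemma field_auts_Gamma: "field_auts \<Gamma>"
proof
  show "finite \<Gamma>" using fin by (simp add: \<Gamma>_def)
  have "tr \<one> = id" by (simp add: fun_eq_iff translation_one[OF is_group])
  then show "id \<in> \<Gamma>" unfolding \<Gamma>_def by (metis imageI one_closed)
  show "field_endo \<sigma>" if "\<sigma> \<in> \<Gamma>" for \<sigma> using that translation_endo[OF is_group] by (auto simp: \<Gamma>_def)
  show "\<sigma> \<circ> \<tau> \<in> \<Gamma>" if st: "\<sigma> \<in> \<Gamma>" "\<tau> \<in> \<Gamma>" for \<sigma> \<tau>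
  proof -
    from st obtain g h where gh: "g \<in> carrier G" "h \<in> carrier G" "\<sigma> = tr g" "\<tau> = tr h" by (auto simp: \<Gamma>_def)
    then have "\<sigma> \<circ> \<tau> = tr (g \<otimes> h)" by (simp add: fun_eq_iff translation_comp[OF is_group])
    then show ?thesis using gh by (simp add: \<Gamma>_def)
  qed
qed

lemma tr_pow: "x \<in> carrier G \<Longrightarrow> tr (x [^] (i::nat)) = tr x ^^ i"
proof (induction i)
  case 0
  then show ?case by (simp add: fun_eq_iff translation_one[OF is_group])
next
  case (Suc i)
  have "tr (x [^] Suc i) = tr x \<circ> tr (x [^] i)"
    unfolding nat_pow_Suc2[OF Suc.prems] using Suc.prems by (simp add: fun_eq_iff translation_comp[OF is_group])
  then show ?case using Suc by simp
qed

lemma octahedral_action_Gamma: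
  "octahedral_action \<Gamma> k0 (tr l) (tr r) (tr t) (tr n) p1 p2 q1 q2 (C im) (C c) (C \<zeta>) L"
proof (intro octahedral_action.intro field_auts_Gamma octahedral_action_axioms.intro)
  show "is_subfield k0" by (rule is_subfield_constants)
  show "k0 \<subseteq> fixed_field \<Gamma>"
    by (auto simp: fixed_field_def \<Gamma>_def translation_const[OF is_group])
  show "C im \<in> k0" "C c \<in> k0" "C \<zeta> \<in> k0" by auto
  show "(C im)\<^sup>2 = - 1" "2 * (C c)\<^sup>2 = - 1"
  proof -
    have "C (im\<^sup>2) = C (- 1)" "C (2 * c\<^sup>2) = C (- 1)" using const by simp_all
    then show "(C im)\<^sup>2 = - 1" "2 * (C c)\<^sup>2 = - 1" by (simp_all only: ratfun_const_simps)
  qed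
  have "C 2 \<noteq> 0" using const(3) by (simp only: ratfun_const_eq_0_iff) simp
  then show "(2 :: ('a, 'k) ratfun) \<noteq> 0" by (simp only: ratfun_const_simps) simp
  show "(C \<zeta> ^ j = 1) = (3 * 3 ^ L dvd j)" for j
    using ratfun_const_eq_iff[of "\<zeta> ^ j" 1, where ?'i = 'a] const(4) by (simp add: ratfun_const_simps)
  show "tr l \<in> \<Gamma>" "tr r \<in> \<Gamma>" "tr t \<in> \<Gamma>" "tr n \<in> \<Gamma>" by (auto simp: \<Gamma>_def)
  show "tr l p1 = C im * p1" "tr l p2 = - C im * p2" "tr l q1 = q1" "tr l q2 = q2"
    "tr r p1 = - p2" "tr r p2 = p1" "tr r q1 = q1" "tr r q2 = q2"
    "tr t p1 = - (1 + C im) / 2 * p1 + (1 - C im) / 2 * p2"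
    "tr t p2 = - (1 + C im) / 2 * p1 - (1 - C im) / 2 * p2"
    "tr t q1 = C \<zeta> * q1" "tr t q2 = q2 / C \<zeta>"
    by (simp_all add: tr_pq RU_gens RD_gens ratfun_const_simps) (simp_all add: left_diff_distrib)
  show "tr n = id \<or> tr n p1 = C c * (p1 - p2) \<and> tr n p2 = - C c * (p1 + p2) \<and> tr n q1 = q2 \<and> tr n q2 = q1"
    using n_cases
  proof
    assume "n = \<one>"
    then show ?thesis by (simp add: fun_eq_iff translation_one[OF is_group])
  qed (simp add: tr_pq ratfun_const_simps algebra_simps)
  show "\<exists>i j k e. e < 2 \<and> \<sigma> = tr l ^^ i \<circ> tr r ^^ j \<circ> tr t ^^ k \<circ> tr n ^^ e" if "\<sigma> \<in> \<Gamma>" for \<sigma>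
  proof -
    from that obtain g where g: "g \<in> carrier G" "\<sigma> = tr g" by (auto simp: \<Gamma>_def)
    obtain i j k e :: nat where e: "e < 2" "g = l [^] i \<otimes> r [^] j \<otimes> t [^] k \<otimes> n [^] e"
      using normal_form[OF g(1)] by blast
    have "tr g = tr l ^^ i \<circ> tr r ^^ j \<circ> tr t ^^ k \<circ> tr n ^^ e"
      by (simp add: e fun_eq_iff translation_comp[OF is_group, symmetric] tr_pow[symmetric])
    then show ?thesis using g e(1) by blast
  qed
  show "\<exists>p\<in>k0. \<exists>q\<in>k0. \<exists>r\<in>k0. \<exists>s\<in>k0. \<sigma> p1 = p * p1 + r * p2 \<and> \<sigma> p2 = q * p1 + s * p2" if "\<sigma> \<in> \<Gamma>" for \<sigma>
    using that tr_pq(1,2) by (fastforce simp: \<Gamma>_def)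
  show "\<exists>p\<in>k0. p \<noteq> 0 \<and> (\<sigma> q1 = p * q1 \<and> \<sigma> q2 = q2 / p \<or> \<sigma> q1 = p * q2 \<and> \<sigma> q2 = q1 / p)" if "\<sigma> \<in> \<Gamma>" for \<sigma>
  proof -
    from that obtain g where g: "g \<in> carrier G" "\<sigma> = tr g" by (auto simp: \<Gamma>_def)
    obtain i j k e :: nat where e: "e < 2" "g = l [^] i \<otimes> r [^] j \<otimes> t [^] k \<otimes> n [^] e"
      using normal_form[OF g(1)] by blast
    have "RD n ^ e = 1 \<or> RD n ^ e = Mat2 0 1 1 0"
      using n_cases RD_one e(1) by (cases "e = 0") (auto simp: less_2_cases_iff)
    then have RDg: "RD g = Mat2 (\<zeta> ^ k) 0 0 ((1 / \<zeta>) ^ k) \<or> RD g = Mat2 0 (\<zeta> ^ k) ((1 / \<zeta>) ^ k) 0"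
      unfolding e(2) RD_normal by (auto intro!: mat2_eqI)
    define d where "d = C (\<zeta> ^ k)"
    have inv_d: "C ((1 / \<zeta>) ^ k) = inverse d"
      by (simp add: d_def ratfun_const_simps power_one_over divide_inverse power_inverse)
    have "d \<noteq> 0" using zeta_nz by (simp add: d_def ratfun_const_eq_0_iff)
    moreover have "d \<in> k0" "inverse d \<in> k0" unfolding inv_d[symmetric] by (simp_all add: d_def)
    ultimately have d: "d \<noteq> 0" "d \<in> k0" "inverse d \<in> k0" by blast+
    from RDg show ?thesis
    proof
      assume *: "RD g = Mat2 (\<zeta> ^ k) 0 0 ((1 / \<zeta>) ^ k)"
      have "tr g q1 = d * q1" "tr g q2 = inverse d * q2"
        unfolding tr_pq[OF g(1)] * mat2.sel inv_d d_def[symmetric] by (simp_all add: ratfun_const_hom)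
      then show ?thesis
        using d by (intro bexI[of _ d]) (simp_all add: g divide_inverse mult.commute)
    next
      assume *: "RD g = Mat2 0 (\<zeta> ^ k) ((1 / \<zeta>) ^ k) 0"
      have "tr g q1 = inverse d * q2" "tr g q2 = d * q1"
        unfolding tr_pq[OF g(1)] * mat2.sel inv_d d_def[symmetric] by (simp_all add: ratfun_const_hom)
      then show ?thesis
        using d by (intro bexI[of _ "inverse d"]) (simp_all add: g divide_inverse mult.commute)
    qed
  qed
qed (rule P_transcendental)+

text \<open>The fixed field is generated by \<open>|G|\<close> elements, and every variable is algebraic over it as a root
  of its orbit polynomial.\<close>

theorem noether_field_rational: "rational_over k0 (noether_field G :: ('a, 'k) ratfun set)"
proof -
  interpret A: octahedral_action \<Gamma> k0 "tr l" "tr r" "tr t" "tr n" p1 p2 q1 q2 "C im" "C c" "C \<zeta>" L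
    by (rule octahedral_action_Gamma)
  have L0: "A.L0 = L0" by (simp add: A.L0_def L0_def P_def)
  let ?K = "adjoin k0 (var ` carrier G)"
  have "\<exists>B. finite B \<and> card B \<le> 4 + card Z \<and> adjoin A.L0 Z \<inter> A.Fix = adjoin k0 B"
  proof (rule A.fixed_field_generators[OF card_Z(1)])
    fix \<sigma> z assume s: "\<sigma> \<in> \<Gamma>" and z: "z \<in> Z"
    from s obtain g where g: "g \<in> carrier G" "\<sigma> = tr g" by (auto simp: \<Gamma>_def)
    from z obtain h where h: "h \<in> carrier G" "z = var h" by (auto simp: Z_def)
    have "\<sigma> z = var (g \<otimes> h)" using g h by (simp add: translation_var[OF is_group])
    then show "\<sigma> z \<in> lspan A.L0 (insert 1 Z)" unfolding L0 using var_in_span g h by simp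
    assume fx: "\<sigma> p1 = p1" "\<sigma> p2 = p2" "\<sigma> q1 = q1" "\<sigma> q2 = q2"
    have "C (m11 (RU g)) * p1 + C (m21 (RU g)) * p2 = C 1 * p1 + C 0 * p2"
      "C (m12 (RU g)) * p1 + C (m22 (RU g)) * p2 = C 0 * p1 + C 1 * p2"
      "C (m11 (RD g)) * q1 + C (m21 (RD g)) * q2 = C 1 * q1 + C 0 * q2"
      "C (m12 (RD g)) * q1 + C (m22 (RD g)) * q2 = C 0 * q1 + C 1 * q2"
      using fx by (simp_all add: g tr_pq ratfun_const_hom)
    note eq = this
    have q: "q1 \<notin> acl k0 {p1, p2}" "q2 \<notin> acl k0 (insert q1 {p1, p2})"
      using P_transcendental(3,4) by (simp_all add: insert_commute)
    have "RU g = 1"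
      using linear_independence[OF P_transcendental(1,2) eq(1)] linear_independence[OF P_transcendental(1,2) eq(2)]
      by (intro mat2_eqI) auto
    moreover have "RD g = 1"
      using linear_independence[OF q eq(3)] linear_independence[OF q eq(4)] by (intro mat2_eqI) auto
    ultimately have "g = \<one>" using kernel_trivial g by blast
    then show "\<sigma> z = z" using g by (simp add: translation_one[OF is_group])
  qed
  then obtain B where B: "finite B" "card B \<le> card (carrier G)" "?K \<inter> A.Fix = adjoin k0 B"
    unfolding L0 generators card_Z by blast
  have "noether_field G = ?K \<inter> A.Fix"
    by (auto simp: noether_field_def fixed_field_def \<Gamma>_def)
  moreover have "alg_independent k0 B"
  proof (rule acl_indep_imp_alg_independent[OF B(1)])
    have "var g \<in> acl k0 B" if g: "g \<in> carrier G" for g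
    proof -
      have stable: "\<sigma> x \<in> ?K" if "\<sigma> \<in> \<Gamma>" "x \<in> ?K" for \<sigma> x
      proof (rule A.stable_adjoin_k0[OF _ that])
        fix \<sigma> b assume "\<sigma> \<in> \<Gamma>" "b \<in> var ` carrier G"
        then show "\<sigma> b \<in> ?K"
          using adjoin_incl(2)[of "var ` carrier G" k0] by (auto simp: \<Gamma>_def translation_var[OF is_group])
      qed
      have "var g \<in> ?K" using g adjoin_incl(2)[of "var ` carrier G" k0] by auto
      then have "A.orbit_poly (var g) \<in> polys_over (?K \<inter> A.Fix)"
        using A.orbit_poly_over[of ?K "var g"] stable adjoin_is_subfield by blast
      then show ?thesis
        unfolding B(3) acl_def algebraic_over_def using A.orbit_poly_roots[of "var g"] by blast
    qed
    then show "acl_indep k0 B"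
      using generators_acl_indep(2)[OF vars_indep(2,1) B(1)] vars_indep(3) B(2) by auto
  qed
  ultimately show ?thesis unfolding rational_over_def using B(3) by auto
qed

end

section \<open>The presented groups\<close>

text \<open>The rule \<open>r l = l\<^sup>3 r\<close> comes from \<open>r\<^sup>2 = (l r)\<^sup>2\<close>, which gives \<open>l r l = r\<close>, and \<open>l\<^sup>4 = 1\<close>.\<close>

lemma presented_quaternion_cyclic:
  fixes S :: "generator set" and R l and G (structure)
  assumes G_def: "G = presented_group S R"
  defines "cl \<equiv> word_class S R"
  assumes S: "{Tau, Lambda, Rho} \<subseteq> S" and R: "G1_relations l \<subseteq> R"
  shows "quaternion_cyclic G (cl lambda) (cl rho) (cl tau)"
    and "cl lambda [^]\<^bsub>G\<^esub> (4::nat) = \<one>\<^bsub>G\<^esub>" and "cl tau [^]\<^bsub>G\<^esub> (3 ^ l :: nat) = \<one>\<^bsub>G\<^esub>"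
proof -
  interpret group G unfolding G_def by (rule presented_group_is_group)
  have lists: "lambda \<in> lists (S \<times> UNIV)" "rho \<in> lists (S \<times> UNIV)" "tau \<in> lists (S \<times> UNIV)"
    by (rule gen_in_lists, use S in simp)+
  have app: "u @ v \<in> lists (S \<times> UNIV)" if "u \<in> lists (S \<times> UNIV)" "v \<in> lists (S \<times> UNIV)" for u v :: "generator word"
    using that by (simp add: lists_eq_set)
  have pow_in: "word_pow u (int n) \<in> lists (S \<times> UNIV)" if "u \<in> lists (S \<times> UNIV)" for u n
    using word_class_replicate[OF that, of n R] by (simp add: word_pow_def)
  have clm: "cl (u @ v) = cl u \<otimes> cl v" if "u \<in> lists (S \<times> UNIV)" "v \<in> lists (S \<times> UNIV)" for u v
    using presented_group_mult[OF that] by (simp add: G_def cl_def)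
  have clp: "cl (word_pow u (int n)) = cl u [^] n" if "u \<in> lists (S \<times> UNIV)" for u n
    using word_class_pow_nat[OF that] by (simp add: G_def cl_def)
  have cli: "cl (word_inv u) = inv (cl u)" if "u \<in> lists (S \<times> UNIV)" for u
    using word_class_inv[OF that] by (simp add: G_def cl_def)
  have cl0: "cl [] = \<one>" by (simp add: G_def cl_def presented_group_one)
  have rel: "cl u = cl v" if "(u, v) \<in> G1_relations l" "u \<in> lists (S \<times> UNIV)" "v \<in> lists (S \<times> UNIV)" for u v
    using word_class_relation[of u v R S] that R by (auto simp: cl_def)
  note inl = word_inv_in_lists
  let ?l = "cl lambda" and ?r = "cl rho" and ?t = "cl tau"
  have closed: "?l \<in> carrier G" "?r \<in> carrier G" "?t \<in> carrier G"
    using lists by (auto simp: G_def cl_def intro: word_class_closed)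
  have "cl (word_pow tau (int (3 ^ l))) = cl []"
    using lists pow_in[OF lists(3), of "3 ^ l"] by (intro rel) (simp_all add: G1_relations_def)
  then show tp: "?t [^] (3 ^ l :: nat) = \<one>" by (simp only: clp lists cl0)
  have "cl (word_pow lambda (int 4)) = cl []"
    using lists pow_in[of lambda 4] by (intro rel) (simp_all add: G1_relations_def)
  then show lp: "?l [^] (4::nat) = \<one>" by (simp only: clp lists cl0)
  have "cl (word_pow lambda (int 2)) = cl (word_pow rho (int 2))"
    using lists pow_in[of _ 2] by (intro rel) (simp_all add: G1_relations_def)
  then have "?l [^] (2::nat) = ?r [^] (2::nat)" by (simp only: clp lists)
  then have rr: "?r \<otimes> ?r = ?l \<otimes> ?l" using closed by (simp add: numeral_2_eq_2)
  have "cl (word_pow rho (int 2)) = cl (word_pow (lambda @ rho) (int 2))"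
    using lists pow_in[of _ 2] app by (intro rel) (simp_all add: G1_relations_def)
  then have "?r [^] (2::nat) = (?l \<otimes> ?r) [^] (2::nat)" by (simp only: clp clm lists app)
  then have "?r \<otimes> ?r = (?l \<otimes> ?r \<otimes> ?l) \<otimes> ?r" using closed by (simp add: numeral_2_eq_2 m_assoc)
  then have lrl: "?l \<otimes> (?r \<otimes> ?l) = ?r"
    using closed right_cancel[of ?r ?r "?l \<otimes> ?r \<otimes> ?l"] by (simp add: m_assoc)
  have l3: "?l [^] (3::nat) \<otimes> ?l = \<one>" using lp closed by (simp add: numeral_eq_Suc)
  have "?l [^] (3::nat) \<otimes> ?r = ?l [^] (3::nat) \<otimes> (?l \<otimes> (?r \<otimes> ?l))" by (simp only: lrl)
  also have "\<dots> = (?l [^] (3::nat) \<otimes> ?l) \<otimes> (?r \<otimes> ?l)" using closed by (simp only: m_assoc m_closed nat_pow_closed)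
  also have "\<dots> = ?r \<otimes> ?l" unfolding l3 using closed by simp
  finally have "?l [^] (3::nat) \<otimes> ?r = ?r \<otimes> ?l" .
  moreover
  have "cl (tau @ lambda @ word_inv tau) = cl rho" "cl (tau @ rho @ word_inv tau) = cl (lambda @ rho)"
    by (rule rel, simp add: G1_relations_def, intro app inl lists, intro app inl lists)+
  then have "?t \<otimes> (?l \<otimes> inv ?t) = ?r" "?t \<otimes> (?r \<otimes> inv ?t) = ?l \<otimes> ?r"
    by (simp_all only: clm cli lists app inl)
  note e = this
  have "?t \<otimes> ?l = ?r \<otimes> ?t" by (rule commute_from_conj[OF e(1)]) (use closed in simp_all)
  moreover have "?t \<otimes> ?r = (?l \<otimes> ?r) \<otimes> ?t" by (rule commute_from_conj[OF e(2)]) (use closed in simp_all)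
  ultimately show "quaternion_cyclic G ?l ?r ?t"
    using closed rr by unfold_locales auto
qed

text \<open>In \<open>a\<^sup>2 - 1 = (a + 1) (a - 1)\<close> the second factor is prime to \<open>3\<close>.\<close>

lemma exponent_minus_one:
  fixes a :: int
  assumes "[a + 1 = 0] (mod 3)" "[a\<^sup>2 = 1] (mod 3 ^ l)"
  shows "3 ^ l dvd a + 1"
proof -
  have "3 dvd a + 1" using assms(1) by (simp add: cong_0_iff)
  then have "\<not> 3 dvd a - 1" by presburger
  then have "coprime 3 (a - 1)" by (intro prime_imp_coprime) auto
  then have cop: "coprime (3 ^ l) (a - 1)" by simp
  have "3 ^ l dvd a\<^sup>2 - 1" using assms(2) by (simp add: cong_iff_dvd_diff)
  also have "a\<^sup>2 - 1 = (a + 1) * (a - 1)" by (simp add: algebra_simps power2_eq_square)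
  finally show ?thesis using cop coprime_dvd_mult_left_iff by blast
qed

text \<open>The values of the letters in the two representations; the letters \<open>(s, False)\<close> have the inverse
  matrices.\<close>

fun octahedral_letter :: "'k::field \<Rightarrow> 'k \<Rightarrow> generator \<times> bool \<Rightarrow> 'k mat2" where
  "octahedral_letter im c (Lambda, b) = (if b then Mat2 im 0 0 (- im) else Mat2 (- im) 0 0 im)"
| "octahedral_letter im c (Rho, b) = (if b then Mat2 0 1 (- 1) 0 else Mat2 0 (- 1) 1 0)"
| "octahedral_letter im c (Tau, b) = (if b
     then Mat2 (- (1 + im) / 2) (- (1 + im) / 2) ((1 - im) / 2) (- (1 - im) / 2)
     else Mat2 (- (1 - im) / 2) ((1 + im) / 2) (- (1 - im) / 2) (- (1 + im) / 2))"
| "octahedral_letter im c (Nu, b) = (if b then Mat2 c (- c) (- c) (- c) else Mat2 (- c) c c c)"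

fun dihedral_letter :: "'k::field \<Rightarrow> generator \<times> bool \<Rightarrow> 'k mat2" where
  "dihedral_letter \<zeta> (Lambda, b) = 1"
| "dihedral_letter \<zeta> (Rho, b) = 1"
| "dihedral_letter \<zeta> (Tau, b) = (if b then Mat2 \<zeta> 0 0 (1 / \<zeta>) else Mat2 (1 / \<zeta>) 0 0 \<zeta>)"
| "dihedral_letter \<zeta> (Nu, b) = Mat2 0 1 1 0"

text \<open>The left hand side is \<open>x\<^sup>a\<close> in the shape in which words with integral exponents are evaluated.\<close>

lemma power_minus_one_mod:
  fixes x y :: "'m::monoid_mult" and a :: int
  assumes "x * y = 1" "y * x = 1" "x ^ m = 1" "int m dvd a + 1"
  shows "(if a < 0 then y else x) ^ nat \<bar>a\<bar> = y"
proof (cases "a < 0")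
  case True
  have y: "y ^ m = 1"
  proof -
    have "y ^ i * x ^ i = 1" for i
    proof (induction i)
      case (Suc i)
      have "y ^ Suc i * x ^ Suc i = y ^ i * (y * x) * x ^ i"
        by (simp only: power_Suc2[of y i] power_Suc[of x i] mult.assoc)
      then show ?case using Suc assms(2) by simp
    qed simp
    then show ?thesis using assms(3) by (metis mult_1_right)
  qed
  have "int m dvd - a - 1" using assms(4) by (metis dvd_minus_iff minus_add_distrib uminus_add_conv_diff add.commute)
  then have "m dvd nat (- a - 1)" using True by (simp add: nat_dvd_iff int_dvd_int_iff[symmetric])
  then obtain q where q: "nat (- a - 1) = m * q" by (rule dvdE)
  then have "nat \<bar>a\<bar> = Suc (m * q)" using True by linarith
  then show ?thesis using True y by (simp add: power_mult)
next
  case False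
  then have "m dvd Suc (nat a)" using assms(4) by (simp add: int_dvd_int_iff[symmetric] add.commute)
  then obtain q where q: "Suc (nat a) = m * q" by (rule dvdE)
  have "x ^ Suc (nat a) = 1" unfolding q power_mult assms(3) by simp
  then have "x ^ nat a * x * y = y" by (simp only: power_Suc2) simp
  then show ?thesis using False assms(1) by (simp add: mult.assoc)
qed

locale octahedral_constants =
  fixes im c \<zeta> :: "'k::field" and L :: nat and a :: int
  assumes const: "im\<^sup>2 = -1" "2 * c\<^sup>2 = -1" "(2 :: 'k) \<noteq> 0" "\<And>j. \<zeta> ^ j = 1 \<longleftrightarrow> 3 * 3 ^ L dvd j"
    and a: "3 * 3 ^ L dvd a + 1"
begin

abbreviation "U \<equiv> octahedral_letter im c"
abbreviation "D \<equiv> dihedral_letter \<zeta>"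

lemma im2: "im * im = -1" "im * (im * x) = - x"
proof -
  show *: "im * im = -1" using const(1) by (simp add: power2_eq_square)
  show "im * (im * x) = - x" unfolding mult.assoc[symmetric] * by simp
qed

lemma c2: "c * c = - (1 / 2)" "c * (c * x) = - (x / 2)"
proof -
  show *: "c * c = - (1 / 2)"
    using const(2,3) by (simp add: field_simps power2_eq_square)
  show "c * (c * x) = - (x / 2)" unfolding mult.assoc[symmetric] * by simp
qed

lemma zeta_nz: "\<zeta> \<noteq> 0"
  using const(4)[of "3 * 3 ^ L"] by (auto simp: power_0_left)

lemma half: "1 / 2 + 1 / 2 = (1 :: 'k)"
  using const(3) by (simp flip: add_divide_distrib)

lemma four_nz: "(4 :: 'k) \<noteq> 0"
proof -
  have "(2 :: 'k) * 2 \<noteq> 0" using const(3) by (intro no_zero_divisors)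
  then show ?thesis by simp
qed

lemma sixteen_nz: "(16 :: 'k) \<noteq> 0"
proof -
  have "(4 :: 'k) * 4 \<noteq> 0" using four_nz by (intro no_zero_divisors)
  then show ?thesis by simp
qed

lemma letters_inverse: "U (s, b) * U (s, \<not> b) = 1" "D (s, b) * D (s, \<not> b) = 1"
proof -
  show "U (s, b) * U (s, \<not> b) = 1"
    using const(3) four_nz
    by (cases s; cases b) (auto intro!: mat2_eqI simp: im2 c2 half field_simps)
  show "D (s, b) * D (s, \<not> b) = 1"
    using zeta_nz by (cases s; cases b) (auto intro!: mat2_eqI)
qed

lemma tau_cubed: "U (Tau, True) ^ 3 = 1"
proof -
  let ?T = "U (Tau, True)"
  have "?T * ?T = U (Tau, False)"
    using const(3) four_nz by (intro mat2_eqI) (simp_all add: im2 field_simps)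
  then have "?T ^ 3 = U (Tau, False) * U (Tau, \<not> False)" by (simp only: power3_eq_cube not_False_eq_True)
  then show ?thesis by (simp only: letters_inverse)
qed

lemma relations:
  assumes "(u, v) \<in> G2_relations (Suc L) a"
  shows "word_value U u = word_value U v" "word_value D u = word_value D v"
proof -
  have val: "word_value \<phi> (word_pow w 2) = word_value \<phi> w ^ 2" "word_value \<phi> (word_pow w 4) = word_value \<phi> w ^ 4"
    "word_value \<phi> (word_pow w (3 ^ Suc L)) = word_value \<phi> w ^ (3 * 3 ^ L)" "word_value \<phi> [] = 1"
    for \<phi> :: "generator \<times> bool \<Rightarrow> 'k mat2" and w
    by (simp_all add: word_value_pow nat_mult_distrib nat_power_eq) (simp add: word_value_def)
  note val = val word_value_append word_value_gen word_value_inv_gen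
  have inv: "U (Tau, True) * U (Tau, False) = 1" "U (Tau, False) * U (Tau, True) = 1"
    "D (Tau, True) * D (Tau, False) = 1" "D (Tau, False) * D (Tau, True) = 1"
    using letters_inverse[of Tau True] letters_inverse[of Tau False] by (simp_all only: not_True_eq_False not_False_eq_True)
  have a3: "int 3 dvd a + 1" using a by (metis dvd_mult_left of_nat_numeral)
  have aN: "int (3 * 3 ^ L) dvd a + 1" using a by simp
  have tU: "U (Tau, True) ^ (3 * 3 ^ L) = 1" by (simp only: power_mult tau_cubed power_one)
  have tD: "D (Tau, True) ^ (3 * 3 ^ L) = 1"
    using const(4)[of "3 * 3 ^ L"] zeta_nz by (simp add: diag_pow power_one_over one_mat2_def)
  have nU: "word_value U (word_pow tau a) = U (Tau, False)"
    unfolding word_value_pow word_value_gen word_value_inv_gen by (rule power_minus_one_mod[OF inv(1,2) tau_cubed a3])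
  have nD: "word_value D (word_pow tau a) = D (Tau, False)"
    unfolding word_value_pow word_value_gen word_value_inv_gen by (rule power_minus_one_mod[OF inv(3,4) tD aN])
  note rels = G2_relations_def G1_relations_def
  let ?easy = "{(word_pow lambda 4, []), (word_pow lambda 2, word_pow rho 2), (word_pow rho 2, word_pow (lambda @ rho) 2),
     (tau @ lambda @ word_inv tau, rho), (tau @ rho @ word_inv tau, lambda @ rho),
     (word_pow lambda 2, word_pow nu 2), (nu @ lambda @ word_inv nu, rho @ lambda), (nu @ rho @ word_inv nu, word_inv rho)}"
  have "G2_relations (Suc L) a = insert (word_pow tau (3 ^ Suc L), []) (insert (nu @ tau @ word_inv nu, word_pow tau a) ?easy)"
    unfolding rels by (simp only: Un_insert_left Un_insert_right Un_empty_left Un_empty_right insert_commute)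
  then consider "u = word_pow tau (3 ^ Suc L)" "v = []" | "(u, v) \<in> ?easy" | "u = nu @ tau @ word_inv nu" "v = word_pow tau a"
    using assms by (metis insertE Pair_inject)
  then have "word_value U u = word_value U v \<and> word_value D u = word_value D v"
  proof cases
    case 1
    then show ?thesis using tU tD by (simp only: val)
  next
    case 2
    then show ?thesis
      using const(3) four_nz zeta_nz
      by (auto simp: val numeral_eq_Suc im2 c2 field_simps intro!: mat2_eqI)
  next
    case 3
    then show ?thesis
      using const(3) four_nz sixteen_nz zeta_nz unfolding 3 val nU nD
      by (auto simp: im2 c2 field_simps intro!: mat2_eqI)
  qed
  then show "word_value U u = word_value U v" "word_value D u = word_value D v" by blast+
qed

end

lemma (in group) nat_pow_mod:
  assumes "x \<in> carrier G" "x [^] (m::nat) = \<one>"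
  shows "x [^] (i::nat) = x [^] (i mod m)"
proof -
  have "x [^] i = x [^] (m * (i div m) + i mod m)" by simp
  also have "\<dots> = x [^] (m * (i div m)) \<otimes> x [^] (i mod m)" using assms(1) by (simp only: nat_pow_mult)
  also have "x [^] (m * (i div m)) = \<one>" using assms nat_pow_pow[of x m "i div m"] by simp
  finally show ?thesis using assms(1) by simp
qed

lemma (in group) finite_if_normal_form:
  assumes "l \<in> carrier G" "r \<in> carrier G" "t \<in> carrier G" "n \<in> carrier G"
    and "l [^] (p::nat) = \<one>" "t [^] (q::nat) = \<one>" "p > 0" "q > 0"
    and nf: "\<And>g. g \<in> carrier G \<Longrightarrow> \<exists>i j k e. j < 2 \<and> e < 2 \<and> g = l [^] (i::nat) \<otimes> r [^] (j::nat) \<otimes> t [^] (k::nat) \<otimes> n [^] (e::nat)"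
  shows "finite (carrier G)"
proof (rule finite_subset)
  show "carrier G \<subseteq> (\<lambda>(i, j, k, e). l [^] i \<otimes> r [^] j \<otimes> t [^] k \<otimes> n [^] e) ` ({..<p} \<times> {..<2::nat} \<times> {..<q} \<times> {..<2::nat})"
  proof
    fix g assume "g \<in> carrier G"
    then obtain i j k e :: nat where "j < 2" "e < 2" "g = l [^] i \<otimes> r [^] j \<otimes> t [^] k \<otimes> n [^] e" using nf by blast
    then show "g \<in> (\<lambda>(i, j, k, e). l [^] i \<otimes> r [^] j \<otimes> t [^] k \<otimes> n [^] e) ` ({..<p} \<times> {..<2::nat} \<times> {..<q} \<times> {..<2::nat})"
      using nat_pow_mod[OF assms(1,5), of i] nat_pow_mod[OF assms(3,6), of k] assms(7,8)
      by (intro image_eqI[of _ _ "(i mod p, j, k mod q, e)"]) auto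
  qed
qed auto

lemma presented_quaternion_cyclic_ext:
  fixes l a and G (structure)
  assumes G_def: "G = presented_group {Tau, Lambda, Rho, Nu} (G2_relations l a)"
  defines "cl \<equiv> word_class {Tau, Lambda, Rho, Nu} (G2_relations l a)"
  shows "\<exists>b. quaternion_cyclic_ext G (cl lambda) (cl rho) (cl tau) (cl nu) b"
    and "cl nu [^] (4::nat) = \<one>"
proof -
  let ?S = "{Tau, Lambda, Rho, Nu}" and ?R = "G2_relations l a"
  interpret group G unfolding G_def by (rule presented_group_is_group)
  let ?l = "cl lambda" and ?r = "cl rho" and ?t = "cl tau" and ?n = "cl nu"
  have sub: "{Tau, Lambda, Rho} \<subseteq> ?S" "G1_relations l \<subseteq> ?R" by (auto simp: G2_relations_def)
  have qc: "quaternion_cyclic G ?l ?r ?t" and orders: "?l [^] (4::nat) = \<one>" "?t [^] (3 ^ l :: nat) = \<one>"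
    unfolding cl_def by (rule presented_quaternion_cyclic[OF G_def sub])+
  interpret quaternion_cyclic G ?l ?r ?t by (rule qc)
  have lists: "lambda \<in> lists (?S \<times> UNIV)" "rho \<in> lists (?S \<times> UNIV)" "tau \<in> lists (?S \<times> UNIV)" "nu \<in> lists (?S \<times> UNIV)"
    by (rule gen_in_lists, simp)+
  have app: "u @ v \<in> lists (?S \<times> UNIV)" if "u \<in> lists (?S \<times> UNIV)" "v \<in> lists (?S \<times> UNIV)" for u v :: "generator word"
    using that by (simp add: lists_eq_set)
  note inl = word_inv_in_lists
  have repl: "concat (replicate m u) \<in> lists (?S \<times> UNIV)" "cl (concat (replicate m u)) = cl u [^] m"
    if "u \<in> lists (?S \<times> UNIV)" for u m
    using word_class_replicate[OF that, of m ?R] by (simp_all add: G_def cl_def)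
  have clm: "cl (u @ v) = cl u \<otimes> cl v" if "u \<in> lists (?S \<times> UNIV)" "v \<in> lists (?S \<times> UNIV)" for u v
    using presented_group_mult[OF that] by (simp add: G_def cl_def)
  have cli: "cl (word_inv u) = inv (cl u)" if "u \<in> lists (?S \<times> UNIV)" for u
    using word_class_inv[OF that] by (simp add: G_def cl_def)
  have rel: "cl u = cl v" if "(u, v) \<in> ?R" "u \<in> lists (?S \<times> UNIV)" "v \<in> lists (?S \<times> UNIV)" for u v
    using word_class_relation[of u v ?R ?S] that by (auto simp: cl_def)
  have n: "?n \<in> carrier G" using lists by (auto simp: G_def cl_def intro: word_class_closed)
  have pow2: "word_pow u 2 = concat (replicate 2 u)" for u :: "generator word" by (simp add: word_pow_def)
  have "cl (word_pow lambda 2) = cl (word_pow nu 2)"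
    unfolding pow2 using lists repl(1) by (intro rel) (simp_all add: G2_relations_def pow2)
  then have "?l [^] (2::nat) = ?n [^] (2::nat)" by (simp only: pow2 repl lists)
  then have nn: "?n \<otimes> ?n = ?l \<otimes> ?l" using n by (simp add: numeral_2_eq_2)
  have "?n [^] (4::nat) = (?n \<otimes> ?n) \<otimes> (?n \<otimes> ?n)" using n by (simp add: numeral_eq_Suc m_assoc)
  also have "\<dots> = ?l [^] (4::nat)" unfolding nn by (simp add: numeral_eq_Suc m_assoc)
  finally show n4: "?n [^] (4::nat) = \<one>" using orders by simp
  have "?r [^] Suc 3 = \<one>" using r_pow4 orders by simp
  then have ri: "inv ?r = ?r [^] (3::nat)" by (intro inv_eq_pow) simp_all
  have "cl (nu @ lambda @ word_inv nu) = cl (rho @ lambda)" "cl (nu @ rho @ word_inv nu) = cl (word_inv rho)"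
    by (rule rel, simp add: G2_relations_def, intro app inl lists, intro app inl lists)+
  then have "?n \<otimes> (?l \<otimes> inv ?n) = ?r \<otimes> ?l" "?n \<otimes> (?r \<otimes> inv ?n) = inv ?r"
    by (simp_all only: clm cli lists app inl)
  note e = this
  have nl: "?n \<otimes> ?l = (?r \<otimes> ?l) \<otimes> ?n" by (rule commute_from_conj[OF e(1)]) (use n in simp_all)
  have nr: "?n \<otimes> ?r = ?r [^] (3::nat) \<otimes> ?n" by (rule commute_from_conj[OF e(2)[unfolded ri]]) (use n in simp_all)
  have wp: "word_pow tau a \<in> lists (?S \<times> UNIV)" "\<exists>b::nat. cl (word_pow tau a) = ?t [^] b"
  proof -
    show "word_pow tau a \<in> lists (?S \<times> UNIV)"
      using repl(1)[OF lists(3), of "nat \<bar>a\<bar>"] repl(1)[OF inl[OF lists(3)], of "nat \<bar>a\<bar>"]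
      unfolding word_pow_def by (cases "a < 0") (simp_all only: if_True if_False)
    have "Suc (3 ^ l - 1) = (3 :: nat) ^ l" by simp
    then have "inv ?t = ?t [^] (3 ^ l - 1 :: nat)" using orders(2) by (intro inv_eq_pow) simp_all
    then have it: "cl (word_inv tau) = ?t [^] (3 ^ l - 1 :: nat)" by (simp only: cli lists)
    define m where "m = nat \<bar>a\<bar>"
    show "\<exists>b::nat. cl (word_pow tau a) = ?t [^] b"
    proof (cases "a < 0")
      case True
      then have "word_pow tau a = concat (replicate m (word_inv tau))" by (simp only: word_pow_def if_True m_def)
      then have "cl (word_pow tau a) = (?t [^] (3 ^ l - 1 :: nat)) [^] m"
        by (simp only: repl(2)[OF inl[OF lists(3)]] it)
      then show ?thesis by (simp only: nat_pow_pow closed) blast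
    next
      case False
      then have "word_pow tau a = concat (replicate m tau)" by (simp only: word_pow_def if_False m_def)
      then have "cl (word_pow tau a) = ?t [^] m" by (simp only: repl(2)[OF lists(3)])
      then show ?thesis by blast
    qed
  qed
  then obtain b :: nat where b: "cl (word_pow tau a) = ?t [^] b" by blast
  have "cl (nu @ tau @ word_inv nu) = cl (word_pow tau a)"
    by (rule rel, simp add: G2_relations_def, intro app inl lists, rule wp)
  then have "?n \<otimes> (?t \<otimes> inv ?n) = ?t [^] b"
    by (simp only: clm cli lists app inl b)
  then have nt: "?n \<otimes> ?t = ?t [^] b \<otimes> ?n" by (rule commute_from_conj) (use n in simp_all)
  have "quaternion_cyclic_ext G ?l ?r ?t ?n b"
    using n nl nr nt nn by unfold_locales
  then show "\<exists>b. quaternion_cyclic_ext G ?l ?r ?t ?n b" by blast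
qed

lemma (in group) inv_left_closed:
  assumes "x \<in> carrier G" "H \<subseteq> carrier G" "\<And>h. h \<in> H \<Longrightarrow> x \<otimes> h \<in> H" "h \<in> H" "x [^] (m::nat) = \<one>" "m > 0"
  shows "inv x \<otimes> h \<in> H"
proof -
  have "x [^] Suc (m - 1) = \<one>" using assms(5,6) by simp
  then have "inv x = x [^] (m - 1)" by (rule inv_eq_pow[OF assms(1)])
  then show ?thesis using left_mult_pow[OF assms(1-4)] by simp
qed

lemma G1_normal_form:
  fixes l and G (structure)
  assumes G_def: "G = G1 l" 
  defines "cl \<equiv> word_class {Tau, Lambda, Rho} (G1_relations l)"
  assumes g: "g \<in> carrier G"
  shows "\<exists>i j k. j < 2 \<and> g = cl lambda [^] (i::nat) \<otimes> cl rho [^] (j::nat) \<otimes> cl tau [^] (k::nat)"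
proof -
  have G: "G = presented_group {Tau, Lambda, Rho} (G1_relations l)" by (simp add: G_def G1_def)
  let ?l = "cl lambda" and ?r = "cl rho" and ?t = "cl tau"
  have qc: "quaternion_cyclic G ?l ?r ?t" and orders: "?l [^] (4::nat) = \<one>" "?t [^] (3 ^ l :: nat) = \<one>"
    unfolding cl_def by (rule presented_quaternion_cyclic[OF G subset_refl subset_refl])+
  interpret quaternion_cyclic G ?l ?r ?t by (rule qc)
  have r4: "?r [^] (4::nat) = \<one>" using r_pow4 orders by simp
  have "g \<in> carrier (presented_group {Tau, Lambda, Rho} (G1_relations l))" using g by (simp only: G)
  then have "g \<in> H"
  proof (rule presented_group_induct)
    show "\<one>\<^bsub>presented_group {Tau, Lambda, Rho} (G1_relations l)\<^esub> \<in> H" using one_H by (simp add: G)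
    fix s h assume s: "s \<in> {Tau, Lambda, Rho}" and h: "h \<in> H"
    have "cl (gen s) \<otimes> h \<in> H" using s h l_H r_H t_H by auto
    then show "word_class {Tau, Lambda, Rho} (G1_relations l) (gen s) \<otimes>\<^bsub>presented_group {Tau, Lambda, Rho} (G1_relations l)\<^esub> h \<in> H"
      by (simp add: cl_def G)
    have "inv (cl (gen s)) \<otimes> h \<in> H"
      using s inv_left_closed[OF closed(1) H_closed l_H h orders(1)] inv_left_closed[OF closed(2) H_closed r_H h r4]
        inv_left_closed[OF closed(3) H_closed t_H h orders(2)] by auto
    then show "inv\<^bsub>presented_group {Tau, Lambda, Rho} (G1_relations l)\<^esub> (word_class {Tau, Lambda, Rho} (G1_relations l) (gen s)) \<otimes>\<^bsub>presented_group {Tau, Lambda, Rho} (G1_relations l)\<^esub> h \<in> H"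
      by (simp add: cl_def G)
  qed
  then show ?thesis by (elim HE QE) blast
qed

lemma G2_normal_form:
  fixes l a and G (structure)
  assumes G_def: "G = G2 l a"
  defines "cl \<equiv> word_class {Tau, Lambda, Rho, Nu} (G2_relations l a)"
  assumes g: "g \<in> carrier G"
  shows "\<exists>i j k e. j < 2 \<and> e < 2 \<and> g = cl lambda [^] (i::nat) \<otimes> cl rho [^] (j::nat) \<otimes> cl tau [^] (k::nat) \<otimes> cl nu [^] (e::nat)"
proof -
  let ?S = "{Tau, Lambda, Rho, Nu}" and ?R = "G2_relations l a"
  have G: "G = presented_group ?S ?R" by (simp add: G_def G2_def)
  let ?l = "cl lambda" and ?r = "cl rho" and ?t = "cl tau" and ?n = "cl nu"
  have sub: "{Tau, Lambda, Rho} \<subseteq> ?S" "G1_relations l \<subseteq> ?R" by (auto simp: G2_relations_def)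
  have orders: "?l [^] (4::nat) = \<one>" "?t [^] (3 ^ l :: nat) = \<one>"
    unfolding cl_def by (rule presented_quaternion_cyclic[OF G sub])+
  obtain b where qe: "quaternion_cyclic_ext G ?l ?r ?t ?n b" and n4: "?n [^] (4::nat) = \<one>"
    using presented_quaternion_cyclic_ext[OF G] unfolding cl_def by blast
  interpret quaternion_cyclic_ext G ?l ?r ?t ?n b by (rule qe)
  have r4: "?r [^] (4::nat) = \<one>" using r_pow4 orders by simp
  have "g \<in> carrier (presented_group ?S ?R)" using g by (simp only: G)
  then have "g \<in> K"
  proof (rule presented_group_induct)
    show "\<one>\<^bsub>presented_group ?S ?R\<^esub> \<in> K" using one_K by (simp add: G)
    fix s h assume s: "s \<in> ?S" and h: "h \<in> K"
    have "cl (gen s) \<otimes> h \<in> K" using s h l_K r_K t_K n_K by auto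
    then show "word_class ?S ?R (gen s) \<otimes>\<^bsub>presented_group ?S ?R\<^esub> h \<in> K"
      by (simp add: cl_def G)
    have "inv (cl (gen s)) \<otimes> h \<in> K"
      using s inv_left_closed[OF closed(1) K_closed l_K h orders(1)] inv_left_closed[OF closed(2) K_closed r_K h r4]
        inv_left_closed[OF closed(3) K_closed t_K h orders(2)] inv_left_closed[OF n_closed K_closed n_K h n4] by auto
    then show "inv\<^bsub>presented_group ?S ?R\<^esub> (word_class ?S ?R (gen s)) \<otimes>\<^bsub>presented_group ?S ?R\<^esub> h \<in> K"
      by (simp add: cl_def G)
  qed
  then show ?thesis by (elim KE HE QE) blast
qed

lemma infinite_word_sets: "infinite (UNIV :: generator word set set)"
  by (simp add: Finite_Set.finite_set infinite_UNIV_listI)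

context octahedral_constants
begin

lemma G1_octahedral_group:
  defines "cl \<equiv> word_class {Tau, Lambda, Rho} (G1_relations (Suc L))"
  shows "octahedral_group (G1 (Suc L)) (class_value U) (class_value D) (cl lambda) (cl rho) (cl tau)
    \<one>\<^bsub>G1 (Suc L)\<^esub> im c \<zeta> L"
proof -
  let ?S = "{Tau, Lambda, Rho}" and ?R = "G1_relations (Suc L)"
  define G where "G = G1 (Suc L)"
  have G: "G = presented_group ?S ?R" by (simp add: G_def G1_def)
  interpret group G unfolding G by (rule presented_group_is_group)
  have relU: "\<And>u v. (u, v) \<in> ?R \<Longrightarrow> word_value U u = word_value U v"
    and relD: "\<And>u v. (u, v) \<in> ?R \<Longrightarrow> word_value D u = word_value D v"
    using relations by (auto simp: G2_relations_def)
  note cU = class_value_class[where S = ?S and R = ?R and \<phi> = U, OF letters_inverse(1) relU]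
    and cD = class_value_class[where S = ?S and R = ?R and \<phi> = D, OF letters_inverse(2) relD]
    and mU = class_value_mult[where S = ?S and R = ?R and \<phi> = U, OF letters_inverse(1) relU]
    and mD = class_value_mult[where S = ?S and R = ?R and \<phi> = D, OF letters_inverse(2) relD]
  have lists: "gen s \<in> lists (?S \<times> UNIV)" if "s \<in> ?S" for s using that by (rule gen_in_lists)
  have n: "\<exists>i j k e. j < 2 \<and> e < 2 \<and> g = cl lambda [^]\<^bsub>G\<^esub> (i::nat) \<otimes>\<^bsub>G\<^esub> cl rho [^]\<^bsub>G\<^esub> (j::nat)
      \<otimes>\<^bsub>G\<^esub> cl tau [^]\<^bsub>G\<^esub> (k::nat) \<otimes>\<^bsub>G\<^esub> \<one>\<^bsub>G\<^esub> [^]\<^bsub>G\<^esub> (e::nat)" if g: "g \<in> carrier G" for g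
  proof -
    obtain i j k :: nat where "j < 2" "g = cl lambda [^]\<^bsub>G\<^esub> i \<otimes>\<^bsub>G\<^esub> cl rho [^]\<^bsub>G\<^esub> j \<otimes>\<^bsub>G\<^esub> cl tau [^]\<^bsub>G\<^esub> k"
      using G1_normal_form[OF G_def g] unfolding cl_def by blast
    then have "g = cl lambda [^]\<^bsub>G\<^esub> i \<otimes>\<^bsub>G\<^esub> cl rho [^]\<^bsub>G\<^esub> j \<otimes>\<^bsub>G\<^esub> cl tau [^]\<^bsub>G\<^esub> k \<otimes>\<^bsub>G\<^esub> \<one>\<^bsub>G\<^esub> [^]\<^bsub>G\<^esub> (0::nat)"
      using g by simp
    then show ?thesis using \<open>j < 2\<close> zero_less_numeral by blast
  qed
  note qc = presented_quaternion_cyclic[OF G subset_refl subset_refl, folded cl_def]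
  have closed: "cl lambda \<in> carrier G" "cl rho \<in> carrier G" "cl tau \<in> carrier G"
    unfolding cl_def G by (auto intro!: word_class_closed lists)
  have "octahedral_group G (class_value U) (class_value D) (cl lambda) (cl rho) (cl tau) \<one>\<^bsub>G\<^esub> im c \<zeta> L"
  proof (intro octahedral_group.intro octahedral_group_axioms.intro is_group)
    have "(3 :: nat) ^ Suc L > 0" by simp
    then show "finite (carrier G)"
      using finite_if_normal_form[OF closed one_closed qc(2,3) _ _ n] by simp
    show "infinite (UNIV :: generator word set set)" by (rule infinite_word_sets)
    show "class_value U (x \<otimes>\<^bsub>G\<^esub> y) = class_value U x * class_value U y" if "x \<in> carrier G" "y \<in> carrier G" for x y
      unfolding G by (rule mU) (use that G in simp_all)
    show "class_value D (x \<otimes>\<^bsub>G\<^esub> y) = class_value D x * class_value D y" if "x \<in> carrier G" "y \<in> carrier G" for x y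
      unfolding G by (rule mD) (use that G in simp_all)
    show "class_value U \<one>\<^bsub>G\<^esub> = 1" "class_value D \<one>\<^bsub>G\<^esub> = 1"
      by (simp_all add: G presented_group_one cU cD word_value_def)
    show "class_value U (cl lambda) = Mat2 im 0 0 (- im)" "class_value U (cl rho) = Mat2 0 1 (- 1) 0"
      "class_value U (cl tau) = Mat2 (- (1 + im) / 2) (- (1 + im) / 2) ((1 - im) / 2) (- (1 - im) / 2)"
      "class_value D (cl lambda) = 1" "class_value D (cl rho) = 1" "class_value D (cl tau) = Mat2 \<zeta> 0 0 (1 / \<zeta>)"
      by (simp_all add: cl_def cU cD lists word_value_gen)
    show "cl tau [^]\<^bsub>G\<^esub> (3 * 3 ^ L :: nat) = \<one>\<^bsub>G\<^esub>" using qc(3) by simp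
  qed (use closed qc const n in simp_all)
  then show ?thesis by (simp add: G_def)
qed

lemma G2_octahedral_group:
  defines "cl \<equiv> word_class {Tau, Lambda, Rho, Nu} (G2_relations (Suc L) a)"
  shows "octahedral_group (G2 (Suc L) a) (class_value U) (class_value D) (cl lambda) (cl rho) (cl tau)
    (cl nu) im c \<zeta> L"
proof -
  let ?S = "{Tau, Lambda, Rho, Nu}" and ?R = "G2_relations (Suc L) a"
  define G where "G = G2 (Suc L) a"
  have G: "G = presented_group ?S ?R" by (simp add: G_def G2_def)
  interpret group G unfolding G by (rule presented_group_is_group)
  note cU = class_value_class[where S = ?S and R = ?R and \<phi> = U, OF letters_inverse(1) relations(1)]
    and cD = class_value_class[where S = ?S and R = ?R and \<phi> = D, OF letters_inverse(2) relations(2)]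
    and mU = class_value_mult[where S = ?S and R = ?R and \<phi> = U, OF letters_inverse(1) relations(1)]
    and mD = class_value_mult[where S = ?S and R = ?R and \<phi> = D, OF letters_inverse(2) relations(2)]
  have lists: "gen s \<in> lists (?S \<times> UNIV)" if "s \<in> ?S" for s using that by (rule gen_in_lists)
  note n = G2_normal_form[OF G_def, folded cl_def]
  have sub: "{Tau, Lambda, Rho} \<subseteq> ?S" "G1_relations (Suc L) \<subseteq> ?R" by (auto simp: G2_relations_def)
  note qc = presented_quaternion_cyclic[OF G sub, folded cl_def]
  have closed: "cl lambda \<in> carrier G" "cl rho \<in> carrier G" "cl tau \<in> carrier G" "cl nu \<in> carrier G"
    unfolding cl_def G by (auto intro!: word_class_closed lists)
  have "octahedral_group G (class_value U) (class_value D) (cl lambda) (cl rho) (cl tau) (cl nu) im c \<zeta> L"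
  proof (intro octahedral_group.intro octahedral_group_axioms.intro is_group)
    have "(3 :: nat) ^ Suc L > 0" by simp
    then show "finite (carrier G)"
      using finite_if_normal_form[OF closed qc(2,3) _ _ n] by simp
    show "infinite (UNIV :: generator word set set)" by (rule infinite_word_sets)
    show "class_value U (x \<otimes>\<^bsub>G\<^esub> y) = class_value U x * class_value U y" if "x \<in> carrier G" "y \<in> carrier G" for x y
      unfolding G by (rule mU) (use that G in simp_all)
    show "class_value D (x \<otimes>\<^bsub>G\<^esub> y) = class_value D x * class_value D y" if "x \<in> carrier G" "y \<in> carrier G" for x y
      unfolding G by (rule mD) (use that G in simp_all)
    show "class_value U \<one>\<^bsub>G\<^esub> = 1" "class_value D \<one>\<^bsub>G\<^esub> = 1"
      by (simp_all add: G presented_group_one cU cD word_value_def)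
    show "class_value U (cl lambda) = Mat2 im 0 0 (- im)" "class_value U (cl rho) = Mat2 0 1 (- 1) 0"
      "class_value U (cl tau) = Mat2 (- (1 + im) / 2) (- (1 + im) / 2) ((1 - im) / 2) (- (1 - im) / 2)"
      "class_value D (cl lambda) = 1" "class_value D (cl rho) = 1" "class_value D (cl tau) = Mat2 \<zeta> 0 0 (1 / \<zeta>)"
      "cl nu = \<one>\<^bsub>G\<^esub> \<or> class_value U (cl nu) = Mat2 c (- c) (- c) (- c) \<and> class_value D (cl nu) = Mat2 0 1 1 0"
      by (simp_all add: cl_def cU cD lists word_value_gen)
    show "cl tau [^]\<^bsub>G\<^esub> (3 * 3 ^ L :: nat) = \<one>\<^bsub>G\<^esub>" using qc(3) by simp
  qed (use closed qc const n in simp_all)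
  then show ?thesis by (simp add: G_def)
qed

text \<open>The exponent of \<open>G\<^sub>2\<close> is a multiple of \<open>8 \<cdot> 3\<^sup>l\<close>, because \<open>\<lambda>\<nu>\<close> has order \<open>8\<close> in the binary
  octahedral group and \<open>\<tau>\<close> has order \<open>3\<^sup>l\<close> in the dihedral group.\<close>

lemma exponent_multiple: "8 dvd group_exponent (G2 (Suc L) a)" "3 * 3 ^ L dvd group_exponent (G2 (Suc L) a)"
proof -
  let ?G = "G2 (Suc L) a" and ?cl = "word_class {Tau, Lambda, Rho, Nu} (G2_relations (Suc L) a)"
  interpret octahedral_group ?G "class_value U" "class_value D" "?cl lambda" "?cl rho" "?cl tau" "?cl nu" im c \<zeta> L
    by (rule G2_octahedral_group)
  have ord: "ord x dvd group_exponent ?G" if "x \<in> carrier ?G" for x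
    using that unfolding group_exponent_def by (intro dvd_Lcm imageI)
  have "class_value D (?cl tau) ^ ord (?cl tau) = 1"
    using pow_ord_eq_1[of "?cl tau"] RD_pow[of "?cl tau" "ord (?cl tau)"] by (simp add: RD_one)
  then have "Mat2 (\<zeta> ^ ord (?cl tau)) 0 0 ((1 / \<zeta>) ^ ord (?cl tau)) = 1" by (simp only: RD_gens diag_pow)
  from arg_cong[OF this, of m11] have "3 * 3 ^ L dvd ord (?cl tau)" using const(4) by simp
  then show "3 * 3 ^ L dvd group_exponent ?G" using ord[OF closed(3)] by (rule dvd_trans)
  define y where "y = class_value U (?cl lambda \<otimes>\<^bsub>?G\<^esub> ?cl nu)"
  have clnu: "class_value U (?cl nu) = Mat2 c (- c) (- c) (- c)"
  proof -
    have "class_value U (?cl nu) = word_value U nu"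
      by (rule class_value_class[OF letters_inverse(1) relations(1)]) (assumption | rule gen_in_lists, simp)+
    then show ?thesis by (simp add: word_value_gen)
  qed
  have y: "y = Mat2 (im * c) (- im * c) (im * c) (im * c)"
    by (simp add: y_def RU_mult RU_gens clnu) (simp add: times_mat2_def)
  have "y * y = Mat2 0 (- 1) 1 0"
    unfolding y using const(3) by (intro mat2_eqI) (simp_all add: mult_ac im2 c2 half)
  then have y4: "y ^ 4 = Mat2 (- 1) 0 0 (- 1)"
    by (simp add: power4_eq_xxxx mult.assoc[symmetric]) (simp add: mult.assoc, simp add: times_mat2_def)
  have y4i: "y ^ (4 * i) = Mat2 ((- 1) ^ i) 0 0 ((- 1) ^ i)" for i
    by (simp only: power_mult y4 diag_pow)
  have even: "even i" if "(- 1 :: 'k) ^ i = 1" for i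
    using that minus_one_neq_one by (cases "even i") auto
  let ?k = "ord (?cl lambda \<otimes>\<^bsub>?G\<^esub> ?cl nu)"
  have yk: "y ^ ?k = 1"
    using pow_ord_eq_1[of "?cl lambda \<otimes>\<^bsub>?G\<^esub> ?cl nu"] RU_pow[of "?cl lambda \<otimes>\<^bsub>?G\<^esub> ?cl nu" ?k]
    by (simp add: RU_one y_def)
  have *: "(- 1 :: 'k) ^ i = 1" if "4 * i = ?k * j" for i j
  proof -
    have "y ^ (4 * i) = 1" unfolding that by (simp add: power_mult yk)
    then have "Mat2 ((- 1) ^ i) 0 0 ((- 1) ^ i) = (1 :: 'k mat2)" by (simp only: y4i)
    from arg_cong[OF this, of m11] show ?thesis by simp
  qed
  have "even ?k" using even[OF *[of ?k 4]] by simp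
  then obtain k2 where k2: "?k = 2 * k2" by blast
  have "even k2" using even[OF *[of k2 2]] k2 by simp
  then obtain k4 where k4: "k2 = 2 * k4" by blast
  have "even k4" using even[OF *[of k4 1]] k2 k4 by simp
  then have "8 dvd ?k" using k2 k4 by auto
  then show "8 dvd group_exponent ?G" using ord[of "?cl lambda \<otimes>\<^bsub>?G\<^esub> ?cl nu"] by (auto intro: dvd_trans)
qed

end

section \<open>Constants in the ground field\<close>

text \<open>The orders of elements of \<open>G\<^sub>2\<close> are bounded below by means of the representations over \<open>\<complex>\<close>, before
  anything is known about the roots of unity in \<open>k\<close>.\<close>

lemma complex_octahedral_constants:
  assumes "3 * 3 ^ L dvd (a + 1 :: int)"
  shows "octahedral_constants \<i> (\<i> / of_real (sqrt 2)) (cis (2 * pi / real (3 * 3 ^ L))) L a"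
proof
  show "\<i>\<^sup>2 = - 1" by simp
  show "2 * (\<i> / complex_of_real (sqrt 2))\<^sup>2 = - 1"
    by (simp add: power_divide flip: of_real_power)
  show "(cis (2 * pi / real (3 * 3 ^ L)) ^ j = 1) \<longleftrightarrow> 3 * 3 ^ L dvd j" for j
  proof -
    define q where "q = (3 * 3 ^ L :: nat)"
    have q: "q > 0" by (simp add: q_def)
    have "cis (2 * pi / real q) ^ j = cis (2 * pi * (real j / real q))"
      by (simp add: DeMoivre mult_ac)
    moreover have "cis (2 * pi * (real j / real q)) = 1 \<longleftrightarrow> q dvd j"
    proof
      assume "cis (2 * pi * (real j / real q)) = 1"
      then have "cos (2 * pi * (real j / real q)) = 1" by (metis cis.sel(1) one_complex.sel(1))
      then obtain n :: int where "2 * pi * (real j / real q) = of_int n * 2 * pi"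
        unfolding cos_one_2pi_int by blast
      then have "2 * pi * (real j / real q) = 2 * pi * of_int n" by (simp only: mult_ac)
      then have "real j / real q = n" by (simp only: mult_cancel_left) simp
      then have "real_of_int (int j) = real_of_int (n * int q)" using q by (simp add: field_simps)
      then have "int j = n * int q" by (simp only: of_int_eq_iff)
      then have "int q dvd int j" by simp
      then show "q dvd j" by (simp only: int_dvd_int_iff)
    next
      assume "q dvd j"
      then obtain n where "j = q * n" by (rule dvdE)
      then have "real j / real q = real n" using q by simp
      then show "cis (2 * pi * (real j / real q)) = 1" by (simp only: cis_multiple_2pi Ints_of_nat)
    qed
    ultimately show ?thesis unfolding q_def by simp
  qed
qed (use assms in simp_all)

lemma primitive_root_power:
  assumes "primitive_root_of_unity e z"
  shows "z ^ j = 1 \<longleftrightarrow> e dvd j"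
proof
  have e: "e > 0" "z ^ e = 1" "\<And>m. 0 < m \<Longrightarrow> m < e \<Longrightarrow> z ^ m \<noteq> 1"
    using assms by (auto simp: primitive_root_of_unity_def)
  assume "z ^ j = 1"
  have "z ^ (e * (j div e) + j mod e) = 1" using \<open>z ^ j = 1\<close> by simp
  then have "z ^ (j mod e) = 1" by (simp only: power_add power_mult e power_one mult_1_left)
  then have "j mod e = 0" using e(3)[of "j mod e"] e(1) by (cases "j mod e = 0") auto
  then show "e dvd j" by (simp add: dvd_eq_mod_eq_0)
next
  assume "e dvd j"
  then show "z ^ j = 1" using assms by (auto simp: primitive_root_of_unity_def power_mult elim!: dvdE)
qed

text \<open>If \<open>r\<close> is a primitive eighth root of unity, then \<open>im = r\<^sup>2\<close>, and \<open>r + 1 / r\<close> is a square root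
  of \<open>2\<close>.\<close>

lemma octahedral_constants_exist:
  assumes "primitive_root_of_unity e (z :: 'k::field)" "8 dvd e" "3 * 3 ^ L dvd e" "3 * 3 ^ L dvd (a + 1 :: int)"
  shows "\<exists>im c \<zeta> :: 'k. octahedral_constants im c \<zeta> L a"
proof -
  have e: "e > 0" using assms(1) by (simp add: primitive_root_of_unity_def)
  note z = primitive_root_power[OF assms(1)]
  obtain e8 where e8: "e = 8 * e8" using assms(2) by (rule dvdE)
  obtain e3 where e3: "e = 3 * 3 ^ L * e3" using assms(3) by (rule dvdE)
  define r where "r = z ^ e8"
  have "r ^ 8 = 1" using z[of e] by (simp add: r_def e8 mult.commute flip: power_mult)
  have "\<not> e dvd e8 * 4" using e e8 by (auto dest: dvd_imp_le)
  then have "r ^ 4 \<noteq> 1" using z[of "e8 * 4"] by (simp add: r_def flip: power_mult)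
  have "(r ^ 4 - 1) * (r ^ 4 + 1) = 0"
  proof -
    have "r ^ 4 * r ^ 4 = 1" using \<open>r ^ 8 = 1\<close> by (simp flip: power_add)
    then show ?thesis by (simp add: algebra_simps)
  qed
  then have r4: "r ^ 4 = - 1" using \<open>r ^ 4 \<noteq> 1\<close> by (simp add: eq_neg_iff_add_eq_0)
  have two: "(2 :: 'k) \<noteq> 0"
  proof
    assume "(2 :: 'k) = 0"
    then have "(1 :: 'k) = - 1" by (metis add_eq_0_iff one_add_one)
    then show False using r4 \<open>r ^ 4 \<noteq> 1\<close> by simp
  qed
  have r0: "r \<noteq> 0" using \<open>r ^ 8 = 1\<close> by auto
  define im where "im = r\<^sup>2"
  define c where "c = im * (r + inverse r) / 2"
  have im: "im\<^sup>2 = - 1" using r4 by (simp add: im_def flip: power_mult)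
  then have im0: "im * im = -1" by (simp add: power2_eq_square)
  have "inverse im = - im" by (rule inverse_unique) (simp add: im0)
  \<comment> \<open>The middle term cancels the other two as \<open>im + 1 / im = 0\<close>.\<close>
  have "(r + inverse r)\<^sup>2 = im + 2 + inverse im"
    using r0 by (simp add: im_def power2_eq_square algebra_simps)
  also have "\<dots> = 2" by (simp add: \<open>inverse im = - im\<close>)
  finally have rr: "(r + inverse r)\<^sup>2 = 2" .
  have "2 * c = im * (r + inverse r)" using two by (simp add: c_def)
  then have "(2 * c)\<^sup>2 = im\<^sup>2 * (r + inverse r)\<^sup>2" by (simp only: power_mult_distrib)
  then have "2 * (2 * c\<^sup>2) = 2 * - 1" unfolding im rr by (simp add: power_mult_distrib)
  then have c: "2 * c\<^sup>2 = - 1" using two by (simp only: mult_cancel_left) simp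
  define \<zeta> where "\<zeta> = z ^ e3"
  have "e3 > 0" using e e3 by (cases "e3 = 0") auto
  have "\<zeta> ^ j = 1 \<longleftrightarrow> 3 * 3 ^ L dvd j" for j
  proof -
    have "\<zeta> ^ j = 1 \<longleftrightarrow> e3 * (3 * 3 ^ L) dvd e3 * j"
      using z[of "e3 * j"] by (simp add: \<zeta>_def e3 mult_ac flip: power_mult)
    then show ?thesis using \<open>e3 > 0\<close> by simp
  qed
  then have "octahedral_constants im c \<zeta> L a"
    using im c two assms(4) by unfold_locales auto
  then show ?thesis by blast
qed

theorem theorem4p4:
  fixes l :: nat and a :: int
  assumes "l \<ge> 1"
    and "[a + 1 = 0] (mod 3)"
    and "[a\<^sup>2 = 1] (mod 3 ^ l)"
    and "contains_zeta TYPE('k::field) (group_exponent (G2 l a))"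
  shows "rational_over (range ratfun_const) (noether_field (G1 l) :: (generator word set, 'k) ratfun set) \<and>
    rational_over (range ratfun_const) (noether_field (G2 l a) :: (generator word set, 'k) ratfun set)"
proof -
  obtain L where l: "l = Suc L" using assms(1) by (cases l) auto
  have a: "3 * 3 ^ L dvd a + 1" using exponent_minus_one[OF assms(2,3)] by (simp add: l)
  interpret complex: octahedral_constants \<i> "\<i> / of_real (sqrt 2)" "cis (2 * pi / real (3 * 3 ^ L))" L a
    by (rule complex_octahedral_constants[OF a])
  obtain z :: 'k where "primitive_root_of_unity (group_exponent (G2 l a)) z"
    using assms(4) by (auto simp: contains_zeta_def)
  then obtain im c \<zeta> :: 'k where "octahedral_constants im c \<zeta> L a"
    using octahedral_constants_exist[OF _ _ _ a] complex.exponent_multiple unfolding l by blast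
  then interpret octahedral_constants im c \<zeta> L a .
  show ?thesis
    using octahedral_group.noether_field_rational[OF G1_octahedral_group]
      octahedral_group.noether_field_rational[OF G2_octahedral_group] by (simp add: l)
qed

end
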